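(* Let $Q$ be the unique generalized quadrangle of order $(3,5)$ and let $G$ be a group of automorphisms of $Q$ that is regular on the edges. Then the action $(G,Q)$ is isomorphic to the action of one of the groups $L_1,\dots,L_{11}$ given below on its coset graph with respect to the subgroup generated by its generators $a_i$, which has order four, and the subgroup generated by its generators $b_i$, which has order six. Furthermore, these 11 actions are pairwise not isomorphic. $L_1=\langle a_1,b_1\mid a_1^4,\ b_1^6,\ a_1 b_1^{-1} a_1^{-1} b_1^2 a_1^{-1} b_1 a_1^{-2} b_1,\ a_1 b_1 a_1^{-2} b_1^{-1} a_1^{-1} b_1 a_1^{-2} b_1^{-1},\ a_1 b_1 a_1 b_1^{-1} a_1 b_1^{-2} a_1^{-1} b_1^2\rangle$ $L_2=\langle a_1,a_2,b_1,b_2\mid a_1^2, a_2^2, (a_1a_2)^2, b_1^2, b_2^3, (b_1b_2)^2,\ a_2 b_2 a_1 b_2^{-1} a_2 b_2^{-1} a_1 b_2,\ (a_1 b_2^{-1} a_1 b_2)^2,\ a_2 b_2 a_2 b_1 a_1 b_2^{-1} a_1 b_1,\ a_1 a_2 b_2 a_1 b_2 b_1 a_2 b_2 a_1 b_1,\ a_1 b_2 b_1 (a_1b_1b_2^{-1})^3\rangle$ $L_3=\langle a_1,a_2,b_1\mid a_1^2, a_2^2, (a_1a_2)^2, b_1^6,\ a_1 b_1 a_2 b_1 a_2 b_1^{-1} a_2 b_1^{-1},\ a_2 b_1^{-1} a_2 b_1 a_2 b_1 a_1 b_1^{-1},\ (a_1 b_1)^4,\ a_1 b_1 a_2 b_1^{-2}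 a_1 b_1^{-2} a_2 b_1\rangle$ $L_4=\langle a_1,a_2,b_1,b_2\mid a_1^2, a_2^2, (a_1a_2)^2, b_1^2, b_2^3, (b_1b_2)^2,\ (a_2 b_1 a_1 b_1)^2,\ (a_1 b_1)^4,\ a_2 b_2 a_2 b_1 a_1 b_2^{-1} a_1 b_1,\ (a_1 b_2^{-1} a_1 b_2)^2,\ a_2 b_2 a_1 b_2^{-1} a_2 a_1 b_2 a_1 b_2^{-1},\ a_1 b_2^{-1} a_2 b_1 b_2 a_2 b_2 a_1 b_1 b_2,\ a_1 b_2 a_2 b_1 b_2^{-1} a_2 b_2^{-1} a_1 b_2 b_1\rangle$ $L_5=\langle a_1,a_2,b_1\mid a_1^2, a_2^2, (a_1a_2)^2, b_1^6,\ (a_2 b_1)^4,\ (a_2 b_1 a_1 b_1)^2,\ (a_1 b_1)^4,\ a_2 b_1^{-1} a_1 b_1^2 a_2 b_1 a_1 b_1^{-2},\ a_2 b_1^2 a_1 b_1^{-2} a_2 b_1 a_2 b_1^{-1}\rangle$ $L_6=\langle a_1,b_1,b_2\mid a_1^4, b_1^2, b_2^3, (b_1 b_2^{-1})^2,\ (a_1 b_2^{-1} a_1 b_1)^2,\ a_1 b_1 a_1^{-1} b_1 a_1 b_1 a_1^{-1} b_1 b_2^{-1},\ a_1^{-1} b_2^{-1} a_1 b_2^{-1} a_1^{-1} b_1 a_1^{-1} b_1 b_2\rangle$ $L_7=\langle a_1,a_2,b_1\mid a_1^2, a_2^2, (a_1a_2)^2, b_1^6,\ (a_2 b_1 a_2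 b_1^{-1})^2,\ (a_1 b_1 a_2 b_1^{-1})^2,\ (a_2 b_1 a_1 b_1^{-1})^2,\ (a_1 b_1 a_1 b_1^{-1})^2,\ a_1 b_1 a_2 b_1 a_1 b_1^2 a_2 b_1^2,\ (a_1 b_1 a_1 b_1^2)^2,\ a_2 b_1 a_2 b_1 a_1 a_2 b_1 a_1 b_1^3\rangle$ $L_8=\langle a_1,a_2,b_1\mid a_1^2, a_2^2, (a_1a_2)^2, b_1^6,\ (b_1 a_1 b_1^{-1} a_2)^2,\ a_2 b_1 a_1 a_2 b_1 a_2 b_1^{-1} a_2 b_1^{-1},\ a_1 b_1^2 a_2 b_1 a_2 b_1^2 a_1 b_1\rangle$ $L_9=\langle a_1,b_1,b_2\mid a_1^4, b_1^2, b_2^3, (b_1b_2)^2,\ (a_1 b_2)^4,\ a_1 b_2^{-1} a_1 b_1 a_1^{-1} b_2 a_1^{-1} b_1 b_2,\ a_1 b_1 a_1 b_1 b_2 a_1 b_2^{-1} a_1^{-1} b_2^{-1},\ a_1 b_1 b_2 a_1 b_1 a_1 b_2 a_1^{-1} b_2,\ a_1 b_2 a_1 b_1 a_1 b_1 a_1^2 b_2 b_1\rangle$ $L_{10}=\langle a_1,a_2,b_1,b_2\mid a_1^2, a_2^2, (a_1a_2)^2, b_1^2, b_2^3, (b_1b_2)^2,\ (a_1 b_2^{-1} a_1 b_2)^2,\ a_2 b_2^{-1} a_1 b_1 a_1 b_2 a_2 b_2 b_1,\ a_2 a_1 b_2^{-1} a_1 b_1 a_2 b_2 a_1 b_1 b_2^{-1},\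 a_2 b_2^{-1} a_1 b_2 b_1 a_2 b_1 b_2^{-1} a_1 b_2\rangle$ $L_{11}=\langle a_1,a_2,b_1,b_2\mid a_1^2, a_2^2, (a_1a_2)^2, b_1^2, b_2^3, (b_1b_2)^2,\ (a_1 b_1)^4,\ (a_2 b_2^{-1} a_1 b_2)^2,\ (a_1 b_2^{-1} a_1 b_1)^2,\ (a_1 b_2^{-1} a_1 b_2)^2,\ a_1 b_2 a_2 b_2 a_2 b_2 b_1 a_2 b_1,\ a_1 b_2 a_2 b_1 a_2 b_2^{-1} a_1 b_1 b_2\rangle$
   Context: A generalized quadrangle is a bipartite graph of diameter $4$ and girth $8$ in which every vertex has valency at least three. $Q$ is the (up to isomorphism unique) generalized quadrangle in which the vertices of one type (points) have valency $6$ and the vertices of the other type (lines) have valency $4$. For subgroups $E\neq F$ of a group $V$, the coset graph of $V$ with respect to $E$ and $F$ is the bipartite graph with vertex set $V/E\sqcup V/F$ and edges $\{gE,gF\}$ for $g\in V$; $V$ acts on it by left multiplication. Two actions $(G,X)$, $(G',X')$ of groups on graphs are isomorphic if there are a group isomorphism $G\to G'$ and a graph isomorphism $X\to X'$ equivariant with respect to it. Regular means simply transitive. In the presentations, a listed word $w$ means the relation $w=1$. *)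

theory Defs
  imports "HOL-Algebra.Bij" "HOL-Algebra.Left_Coset" "HOL-Algebra.Generated_Groups"
    "HOL-Library.Extended_Nat"
begin

section \<open>Graphs and generalized quadrangles\<close>

record 'v graph =
  verts :: "'v set"
  edges :: "'v set set"

definition simple_graph :: "'v graph \<Rightarrow> bool" where
  "simple_graph X \<longleftrightarrow> (\<forall>e \<in> edges X. e \<subseteq> verts X \<and> card e = 2)"

abbreviation adjacent :: "'v graph \<Rightarrow> 'v \<Rightarrow> 'v \<Rightarrow> bool" where
  "adjacent X u v \<equiv> {u, v} \<in> edges X"

definition valency :: "'v graph \<Rightarrow> 'v \<Rightarrow> enat" where
  "valency X v =
     (if finite {e \<in> edges X. v \<in> e} then enat (card {e \<in> edges X. v \<in> e}) else \<infinity>)"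

definition bipartition :: "'v graph \<Rightarrow> 'v set \<Rightarrow> 'v set \<Rightarrow> bool" where
  "bipartition X P L \<longleftrightarrow> P \<union> L = verts X \<and> P \<inter> L = {} \<and>
     (\<forall>e \<in> edges X. \<exists>p \<in> P. \<exists>l \<in> L. e = {p, l})"

text \<open>The distance is \<open>\<infinity>\<close> if there is no walk, so a graph of finite diameter is connected.\<close>

definition walks :: "'v graph \<Rightarrow> 'v \<Rightarrow> 'v \<Rightarrow> 'v list set" where
  "walks X u v =
     {p. p \<noteq> [] \<and> set p \<subseteq> verts X \<and> successively (adjacent X) p \<and> hd p = u \<and> last p = v}"

definition distance :: "'v graph \<Rightarrow> 'v \<Rightarrow> 'v \<Rightarrow> enat" where
  "distance X u v = (INF p \<in> walks X u v. enat (length p - 1))"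

definition diameter :: "'v graph \<Rightarrow> enat" where
  "diameter X = (SUP u \<in> verts X. SUP v \<in> verts X. distance X u v)"

definition cycles :: "'v graph \<Rightarrow> 'v list set" where
  "cycles X = {p. 3 \<le> length p \<and> distinct p \<and> set p \<subseteq> verts X \<and>
     successively (adjacent X) p \<and> adjacent X (last p) (hd p)}"

definition girth :: "'v graph \<Rightarrow> enat" where
  "girth X = (INF p \<in> cycles X. enat (length p))"

definition generalized_quadrangle :: "'v graph \<Rightarrow> bool" where
  "generalized_quadrangle X \<longleftrightarrow> simple_graph X \<and> (\<exists>P L. bipartition X P L) \<and>
     diameter X = 4 \<and> girth X = 8 \<and> (\<forall>v \<in> verts X. 3 \<le> valency X v)"

text \<open>Order \<open>(s, t)\<close>: the lines have \<open>s + 1\<close> points and the points are on \<open>t + 1\<close> lines.\<close>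

definition generalized_quadrangle_of_order :: "nat \<Rightarrow> nat \<Rightarrow> 'v graph \<Rightarrow> bool" where
  "generalized_quadrangle_of_order s t X \<longleftrightarrow> generalized_quadrangle X \<and>
     (\<exists>P L. bipartition X P L \<and> (\<forall>p \<in> P. valency X p = enat (t + 1)) \<and>
        (\<forall>l \<in> L. valency X l = enat (s + 1)))"


section \<open>Group actions on graphs\<close>

definition graph_iso :: "('v \<Rightarrow> 'w) \<Rightarrow> 'v graph \<Rightarrow> 'w graph \<Rightarrow> bool" where
  "graph_iso f X Y \<longleftrightarrow> bij_betw f (verts X) (verts Y) \<and>
     (\<forall>u \<in> verts X. \<forall>v \<in> verts X. adjacent X u v \<longleftrightarrow> adjacent Y (f u) (f v))"

definition graph_auts :: "'v graph \<Rightarrow> ('v \<Rightarrow> 'v) set" where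
  "graph_auts X = {f \<in> Bij (verts X). graph_iso f X X}"

definition aut_subgroup :: "('v \<Rightarrow> 'v) set \<Rightarrow> 'v graph \<Rightarrow> bool" where
  "aut_subgroup G X \<longleftrightarrow> subgroup G (BijGroup (verts X)) \<and> G \<subseteq> graph_auts X"

definition regular_on_edges ::
  "('a, 'm) monoid_scheme \<Rightarrow> ('a \<Rightarrow> 'v \<Rightarrow> 'v) \<Rightarrow> 'v graph \<Rightarrow> bool" where
  "regular_on_edges G \<phi> X \<longleftrightarrow>
     (\<forall>e \<in> edges X. \<forall>e' \<in> edges X. \<exists>!g. g \<in> carrier G \<and> \<phi> g ` e = e')"

definition isomorphic_actions ::
  "('a, 'm) monoid_scheme \<Rightarrow> ('a \<Rightarrow> 'v \<Rightarrow> 'v) \<Rightarrow> 'v graph \<Rightarrow>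
   ('b, 'n) monoid_scheme \<Rightarrow> ('b \<Rightarrow> 'w \<Rightarrow> 'w) \<Rightarrow> 'w graph \<Rightarrow> bool" where
  "isomorphic_actions G \<phi> X H \<psi> Y \<longleftrightarrow>
     (\<exists>\<theta> \<in> iso G H. \<exists>f. graph_iso f X Y \<and>
        (\<forall>g \<in> carrier G. \<forall>v \<in> verts X. f (\<phi> g v) = \<psi> (\<theta> g) (f v)))"


section \<open>Coset graphs\<close>

definition coset_graph :: "('a, 'm) monoid_scheme \<Rightarrow> 'a set \<Rightarrow> 'a set \<Rightarrow> ('a set + 'a set) graph" where
  "coset_graph V E F =
     \<lparr>verts = (lcosets\<^bsub>V\<^esub> E) <+> (lcosets\<^bsub>V\<^esub> F),
      edges = (\<lambda>g. {Inl (g <#\<^bsub>V\<^esub> E), Inr (g <#\<^bsub>V\<^esub> F)}) ` carrier V\<rparr>"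

definition coset_action ::
  "('a, 'm) monoid_scheme \<Rightarrow> 'a \<Rightarrow> ('a set + 'a set) \<Rightarrow> ('a set + 'a set)" where
  "coset_action V g = map_sum (\<lambda>C. g <#\<^bsub>V\<^esub> C) (\<lambda>C. g <#\<^bsub>V\<^esub> C)"


section \<open>Groups given by a presentation\<close>

text \<open>A letter is a generator together with the sign of its exponent (\<open>True\<close> for \<open>1\<close>).\<close>

type_synonym 'x word = "('x \<times> bool) list"

definition word_inv :: "'x word \<Rightarrow> 'x word" where
  "word_inv w = rev (map (\<lambda>(x, e). (x, \<not> e)) w)"

definition word_pow :: "'x word \<Rightarrow> int \<Rightarrow> 'x word" (infixl \<open>\<up>\<close> 75) where
  "w \<up> k = (if 0 \<le> k then concat (replicate (nat k) w)
           else concat (replicate (nat (- k)) (word_inv w)))"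

abbreviation words :: "'x set \<Rightarrow> 'x word set" where
  "words S \<equiv> lists (S \<times> UNIV)"

text \<open>The least congruence on the words over \<open>S\<close> that contains the free cancellations and
  identifies each relator with the empty word.\<close>

inductive pres_eq :: "'x set \<Rightarrow> 'x word set \<Rightarrow> 'x word \<Rightarrow> 'x word \<Rightarrow> bool" for S R where
  refl: "w \<in> words S \<Longrightarrow> pres_eq S R w w"
| sym: "pres_eq S R v w \<Longrightarrow> pres_eq S R w v"
| trans: "pres_eq S R u v \<Longrightarrow> pres_eq S R v w \<Longrightarrow> pres_eq S R u w"
| append: "pres_eq S R u u' \<Longrightarrow> pres_eq S R v v' \<Longrightarrow> pres_eq S R (u @ v) (u' @ v')"
| cancel: "x \<in> S \<Longrightarrow> pres_eq S R [(x, e), (x, \<not> e)] []"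
| relator: "r \<in> R \<Longrightarrow> r \<in> words S \<Longrightarrow> pres_eq S R r []"

definition word_class :: "'x set \<Rightarrow> 'x word set \<Rightarrow> 'x word \<Rightarrow> 'x word set" where
  "word_class S R w = {v. pres_eq S R w v}"

definition presented_group :: "'x set \<Rightarrow> 'x word set \<Rightarrow> 'x word set monoid" where
  "presented_group S R =
     \<lparr>carrier = word_class S R ` words S,
      mult = (\<lambda>A B. \<Union>u \<in> A. \<Union>v \<in> B. word_class S R (u @ v)),
      one = word_class S R []\<rparr>"

lemma pres_eq_words: "pres_eq S R v w \<Longrightarrow> v \<in> words S \<and> w \<in> words S"
  by (induction rule: pres_eq.induct) auto

lemma word_class_eqI:
  assumes "pres_eq S R v w"
  shows "word_class S R v = word_class S R w"
  unfolding word_class_def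
  using pres_eq.trans[OF assms] pres_eq.trans[OF pres_eq.sym[OF assms]] by auto

lemma presented_group_mult:
  assumes "v \<in> words S" "w \<in> words S"
  shows "word_class S R v \<otimes>\<^bsub>presented_group S R\<^esub> word_class S R w = word_class S R (v @ w)"
proof -
  let ?A = "word_class S R v" and ?B = "word_class S R w"
  have eq: "word_class S R (v' @ w') = word_class S R (v @ w)" if "v' \<in> ?A" "w' \<in> ?B" for v' w'
    using word_class_eqI[OF pres_eq.append, of S R v v' w w'] that by (simp add: word_class_def)
  have "v \<in> ?A" "w \<in> ?B"
    using assms by (simp_all add: word_class_def pres_eq.refl)
  then have "?A \<noteq> {}" "?B \<noteq> {}" by blast+
  then have "(\<Union>v' \<in> ?A. \<Union>w' \<in> ?B. word_class S R (v @ w)) = word_class S R (v @ w)" by simp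
  moreover have "(\<Union>v' \<in> ?A. \<Union>w' \<in> ?B. word_class S R (v' @ w')) =
      (\<Union>v' \<in> ?A. \<Union>w' \<in> ?B. word_class S R (v @ w))"
    by (rule SUP_cong[OF HOL.refl], rule SUP_cong[OF HOL.refl], rule eq)
  ultimately show ?thesis
    unfolding presented_group_def by (simp only: monoid.simps)
qed

lemma word_inv_words: "w \<in> words S \<Longrightarrow> word_inv w \<in> words S"
  unfolding word_inv_def by (induction w) auto

lemma pres_eq_word_inv: "w \<in> words S \<Longrightarrow> pres_eq S R (word_inv w @ w) []"
proof (induction w)
  case Nil
  show ?case by (simp add: word_inv_def pres_eq.refl)
next
  case (Cons a w)
  obtain x e where a: "a = (x, e)" by (cases a)
  have x: "x \<in> S" and w: "w \<in> words S" using Cons.prems a by auto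
  have "pres_eq S R [(x, \<not> e), (x, \<not> \<not> e)] []" using x by (rule pres_eq.cancel)
  from pres_eq.append[OF this pres_eq.refl[OF w]]
  have "pres_eq S R ((x, \<not> e) # (x, e) # w) w" by simp
  from pres_eq.append[OF pres_eq.refl[OF word_inv_words[OF w]] this]
  have "pres_eq S R (word_inv (a # w) @ a # w) (word_inv w @ w)"
    by (simp add: word_inv_def a)
  then show ?case using Cons.IH[OF w] by (rule pres_eq.trans)
qed

lemma group_presented_group: "group (presented_group S R)"
proof (rule groupI)
  let ?G = "presented_group S R"
  have carrier: "carrier ?G = word_class S R ` words S" and one: "\<one>\<^bsub>?G\<^esub> = word_class S R []"
    by (simp_all add: presented_group_def)
  show "\<one>\<^bsub>?G\<^esub> \<in> carrier ?G" by (auto simp: carrier one)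
  fix A B C assume A: "A \<in> carrier ?G"
  then obtain u where u: "u \<in> words S" "A = word_class S R u" by (auto simp: carrier)
  show "\<one>\<^bsub>?G\<^esub> \<otimes>\<^bsub>?G\<^esub> A = A"
    using presented_group_mult[of "[]" S u R] u by (simp add: one)
  have "word_class S R (word_inv u) \<otimes>\<^bsub>?G\<^esub> A = \<one>\<^bsub>?G\<^esub>"
    using u word_class_eqI[OF pres_eq_word_inv[OF u(1)]]
    by (simp add: presented_group_mult word_inv_words one)
  then show "\<exists>B \<in> carrier ?G. B \<otimes>\<^bsub>?G\<^esub> A = \<one>\<^bsub>?G\<^esub>"
    using word_inv_words[OF u(1)] by (auto simp: carrier)
  assume B: "B \<in> carrier ?G"
  then obtain v where v: "v \<in> words S" "B = word_class S R v" by (auto simp: carrier)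
  have uv: "u @ v \<in> words S" using u v by auto
  show "A \<otimes>\<^bsub>?G\<^esub> B \<in> carrier ?G"
    using u v uv by (auto simp: presented_group_mult carrier simp del: append_in_lists_conv)
  assume "C \<in> carrier ?G"
  then obtain w where w: "w \<in> words S" "C = word_class S R w" by (auto simp: carrier)
  have vw: "v @ w \<in> words S" using v w by auto
  show "A \<otimes>\<^bsub>?G\<^esub> B \<otimes>\<^bsub>?G\<^esub> C = A \<otimes>\<^bsub>?G\<^esub> (B \<otimes>\<^bsub>?G\<^esub> C)"
    unfolding u(2) v(2) w(2) by (simp only: presented_group_mult u(1) v(1) w(1) uv vw append_assoc)
qed


section \<open>The groups of the classification\<close>

datatype gen = A1 | A2 | B1 | B2

abbreviation a1 :: "gen word" where "a1 \<equiv> [(A1, True)]"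
abbreviation a2 :: "gen word" where "a2 \<equiv> [(A2, True)]"
abbreviation b1 :: "gen word" where "b1 \<equiv> [(B1, True)]"
abbreviation b2 :: "gen word" where "b2 \<equiv> [(B2, True)]"

definition pres1 :: "gen set \<times> gen word list" where
  "pres1 = ({A1, B1},
   [a1\<up>4,
    b1\<up>6,
    a1 @ b1\<up>-1 @ a1\<up>-1 @ b1\<up>2 @ a1\<up>-1 @ b1 @ a1\<up>-2 @ b1,
    a1 @ b1 @ a1\<up>-2 @ b1\<up>-1 @ a1\<up>-1 @ b1 @ a1\<up>-2 @ b1\<up>-1,
    a1 @ b1 @ a1 @ b1\<up>-1 @ a1 @ b1\<up>-2 @ a1\<up>-1 @ b1\<up>2])"

definition pres2 :: "gen set \<times> gen word list" where
  "pres2 = ({A1, A2, B1, B2},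
   [a1\<up>2,
    a2\<up>2,
    (a1 @ a2)\<up>2,
    b1\<up>2,
    b2\<up>3,
    (b1 @ b2)\<up>2,
    a2 @ b2 @ a1 @ b2\<up>-1 @ a2 @ b2\<up>-1 @ a1 @ b2,
    (a1 @ b2\<up>-1 @ a1 @ b2)\<up>2,
    a2 @ b2 @ a2 @ b1 @ a1 @ b2\<up>-1 @ a1 @ b1,
    a1 @ a2 @ b2 @ a1 @ b2 @ b1 @ a2 @ b2 @ a1 @ b1,
    a1 @ b2 @ b1 @ (a1 @ b1 @ b2\<up>-1)\<up>3])"

definition pres3 :: "gen set \<times> gen word list" where
  "pres3 = ({A1, A2, B1},
   [a1\<up>2,
    a2\<up>2,
    (a1 @ a2)\<up>2,
    b1\<up>6,
    a1 @ b1 @ a2 @ b1 @ a2 @ b1\<up>-1 @ a2 @ b1\<up>-1,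
    a2 @ b1\<up>-1 @ a2 @ b1 @ a2 @ b1 @ a1 @ b1\<up>-1,
    (a1 @ b1)\<up>4,
    a1 @ b1 @ a2 @ b1\<up>-2 @ a1 @ b1\<up>-2 @ a2 @ b1])"

definition pres4 :: "gen set \<times> gen word list" where
  "pres4 = ({A1, A2, B1, B2},
   [a1\<up>2,
    a2\<up>2,
    (a1 @ a2)\<up>2,
    b1\<up>2,
    b2\<up>3,
    (b1 @ b2)\<up>2,
    (a2 @ b1 @ a1 @ b1)\<up>2,
    (a1 @ b1)\<up>4,
    a2 @ b2 @ a2 @ b1 @ a1 @ b2\<up>-1 @ a1 @ b1,
    (a1 @ b2\<up>-1 @ a1 @ b2)\<up>2,
    a2 @ b2 @ a1 @ b2\<up>-1 @ a2 @ a1 @ b2 @ a1 @ b2\<up>-1,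
    a1 @ b2\<up>-1 @ a2 @ b1 @ b2 @ a2 @ b2 @ a1 @ b1 @ b2,
    a1 @ b2 @ a2 @ b1 @ b2\<up>-1 @ a2 @ b2\<up>-1 @ a1 @ b2 @ b1])"

definition pres5 :: "gen set \<times> gen word list" where
  "pres5 = ({A1, A2, B1},
   [a1\<up>2,
    a2\<up>2,
    (a1 @ a2)\<up>2,
    b1\<up>6,
    (a2 @ b1)\<up>4,
    (a2 @ b1 @ a1 @ b1)\<up>2,
    (a1 @ b1)\<up>4,
    a2 @ b1\<up>-1 @ a1 @ b1\<up>2 @ a2 @ b1 @ a1 @ b1\<up>-2,
    a2 @ b1\<up>2 @ a1 @ b1\<up>-2 @ a2 @ b1 @ a2 @ b1\<up>-1])"

definition pres6 :: "gen set \<times> gen word list" where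
  "pres6 = ({A1, B1, B2},
   [a1\<up>4,
    b1\<up>2,
    b2\<up>3,
    (b1 @ b2\<up>-1)\<up>2,
    (a1 @ b2\<up>-1 @ a1 @ b1)\<up>2,
    a1 @ b1 @ a1\<up>-1 @ b1 @ a1 @ b1 @ a1\<up>-1 @ b1 @ b2\<up>-1,
    a1\<up>-1 @ b2\<up>-1 @ a1 @ b2\<up>-1 @ a1\<up>-1 @ b1 @ a1\<up>-1 @ b1 @ b2])"

definition pres7 :: "gen set \<times> gen word list" where
  "pres7 = ({A1, A2, B1},
   [a1\<up>2,
    a2\<up>2,
    (a1 @ a2)\<up>2,
    b1\<up>6,
    (a2 @ b1 @ a2 @ b1\<up>-1)\<up>2,
    (a1 @ b1 @ a2 @ b1\<up>-1)\<up>2,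
    (a2 @ b1 @ a1 @ b1\<up>-1)\<up>2,
    (a1 @ b1 @ a1 @ b1\<up>-1)\<up>2,
    a1 @ b1 @ a2 @ b1 @ a1 @ b1\<up>2 @ a2 @ b1\<up>2,
    (a1 @ b1 @ a1 @ b1\<up>2)\<up>2,
    a2 @ b1 @ a2 @ b1 @ a1 @ a2 @ b1 @ a1 @ b1\<up>3])"

definition pres8 :: "gen set \<times> gen word list" where
  "pres8 = ({A1, A2, B1},
   [a1\<up>2,
    a2\<up>2,
    (a1 @ a2)\<up>2,
    b1\<up>6,
    (b1 @ a1 @ b1\<up>-1 @ a2)\<up>2,
    a2 @ b1 @ a1 @ a2 @ b1 @ a2 @ b1\<up>-1 @ a2 @ b1\<up>-1,
    a1 @ b1\<up>2 @ a2 @ b1 @ a2 @ b1\<up>2 @ a1 @ b1])"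

definition pres9 :: "gen set \<times> gen word list" where
  "pres9 = ({A1, B1, B2},
   [a1\<up>4,
    b1\<up>2,
    b2\<up>3,
    (b1 @ b2)\<up>2,
    (a1 @ b2)\<up>4,
    a1 @ b2\<up>-1 @ a1 @ b1 @ a1\<up>-1 @ b2 @ a1\<up>-1 @ b1 @ b2,
    a1 @ b1 @ a1 @ b1 @ b2 @ a1 @ b2\<up>-1 @ a1\<up>-1 @ b2\<up>-1,
    a1 @ b1 @ b2 @ a1 @ b1 @ a1 @ b2 @ a1\<up>-1 @ b2,
    a1 @ b2 @ a1 @ b1 @ a1 @ b1 @ a1\<up>2 @ b2 @ b1])"

definition pres10 :: "gen set \<times> gen word list" where
  "pres10 = ({A1, A2, B1, B2},
   [a1\<up>2,
    a2\<up>2,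
    (a1 @ a2)\<up>2,
    b1\<up>2,
    b2\<up>3,
    (b1 @ b2)\<up>2,
    (a1 @ b2\<up>-1 @ a1 @ b2)\<up>2,
    a2 @ b2\<up>-1 @ a1 @ b1 @ a1 @ b2 @ a2 @ b2 @ b1,
    a2 @ a1 @ b2\<up>-1 @ a1 @ b1 @ a2 @ b2 @ a1 @ b1 @ b2\<up>-1,
    a2 @ b2\<up>-1 @ a1 @ b2 @ b1 @ a2 @ b1 @ b2\<up>-1 @ a1 @ b2])"

definition pres11 :: "gen set \<times> gen word list" where
  "pres11 = ({A1, A2, B1, B2},
   [a1\<up>2,
    a2\<up>2,
    (a1 @ a2)\<up>2,
    b1\<up>2,
    b2\<up>3,
    (b1 @ b2)\<up>2,
    (a1 @ b1)\<up>4,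
    (a2 @ b2\<up>-1 @ a1 @ b2)\<up>2,
    (a1 @ b2\<up>-1 @ a1 @ b1)\<up>2,
    (a1 @ b2\<up>-1 @ a1 @ b2)\<up>2,
    a1 @ b2 @ a2 @ b2 @ a2 @ b2 @ b1 @ a2 @ b1,
    a1 @ b2 @ a2 @ b1 @ a2 @ b2\<up>-1 @ a1 @ b1 @ b2])"

definition pres :: "nat \<Rightarrow> gen set \<times> gen word list" where
  "pres i = [pres1, pres2, pres3, pres4, pres5, pres6, pres7, pres8, pres9, pres10, pres11] ! (i - 1)"

definition L :: "nat \<Rightarrow> gen word set monoid" where
  "L i = presented_group (fst (pres i)) (set (snd (pres i)))"

definition L_gen :: "nat \<Rightarrow> gen \<Rightarrow> gen word set" where
  "L_gen i x = word_class (fst (pres i)) (set (snd (pres i))) [(x, True)]"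

definition L_a :: "nat \<Rightarrow> gen word set set" where
  "L_a i = generate (L i) (L_gen i ` (fst (pres i) \<inter> {A1, A2}))"

definition L_b :: "nat \<Rightarrow> gen word set set" where
  "L_b i = generate (L i) (L_gen i ` (fst (pres i) \<inter> {B1, B2}))"

abbreviation L_graph :: "nat \<Rightarrow> (gen word set set + gen word set set) graph" where
  "L_graph i \<equiv> coset_graph (L i) (L_a i) (L_b i)"

end

theory Submission
  imports Defs "HOL-Algebra.Sylow" "HOL-Algebra.Multiplicative_Group"
begin

text \<open>Let \<open>E\<close> and \<open>F\<close> be the stabilizers of a line and of a point incident with it. They have orders 4
  and 6, so each is one of two known groups; \<open>G\<close> is generated by them and \<open>Q\<close> is their coset graph.
  Diameter 4 means \<open>G = F E F E\<close>, and girth 8 that no alternating product of 1 to 7 nontrivial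
  elements of \<open>E\<close> and \<open>F\<close> is trivial. Hence every alternating word \<open>a b c d\<close> of nontrivial letters has
  exactly one completion \<open>e f g h\<close> to an alternating relator of length eight, and these relators
  determine \<open>G\<close>. Their set is closed under rotation and inversion, and cancelling the common part of
  two overlapping relators gives another relator or a contradiction. A backtracking search over the
  partial tables \<open>a b c d \<mapsto> e f g h\<close>, up to automorphisms of \<open>E\<close> and \<open>F\<close>, always ends in a table that
  contains the relators of some \<open>L\<^sub>i\<close>. The relators of \<open>L\<^sub>i\<close> alone already generate a full table, so
  the elements of \<open>L\<^sub>i\<close> are the values of words in \<open>F E F E\<close>; by the girth condition the map from
  \<open>L\<^sub>i\<close> to \<open>G\<close> is then injective.

  An isomorphism between the actions of \<open>L\<^sub>i\<close> and \<open>L\<^sub>j\<close> is, up to conjugation, given by isomorphisms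
  between the two pairs of subgroups. There are few of these, and for each a permutation
  representation of \<open>L\<^sub>j\<close> of degree at most 16 detects a relator of \<open>L\<^sub>i\<close> that is not mapped to the
  identity. The same representations are faithful on the two subgroups.\<close>

section \<open>Tables of relators of length eight\<close>

text \<open>Two kinds of information are kept apart. Closure under rotation, inversion and
  cancellation holds for the relators of any two subgroups; a collision of entries is a
  contradiction only under the diameter and girth conditions. One table routine therefore serves
  both sides: in \<open>G\<close> a collision closes a branch, while in \<open>L i\<close>, where
  neither order nor girth is known yet, only the entries found are used. Half a relator is the right
  key because 4 + 3 = 7: an alternating word with four letters cannot equal one with at most three,
  so moving one letter across an equation makes completions unique. The obstacle is symmetry: the
  two subgroups have up to six automorphisms each, so most first guesses occur many times. All
  guesses are relators of one fixed group, and an automorphism changes only the identification of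
  its subgroups with the model groups; a branch equivalent to an earlier one thus has literally the
  same conclusion and is closed by reference. Certificates store branching positions and
  automorphisms, so checking them involves no search for either.\<close>

text \<open>In \<open>Ty p q\<close>, the multiplication on \<open>ee\<close> is cyclic if \<open>p\<close> and that of the Klein four-group
  otherwise; the one on \<open>ff\<close> is cyclic if \<open>q\<close> and that of \<open>S\<^sub>3\<close> otherwise, where \<open>F1\<close> has order three and
  \<open>F3\<close> order two. The computations below are carried out by rewriting with code equations, which
  explains the shape of many definitions: small functions that branch by pattern matching.\<close>

datatype ee = E0 | E1 | E2 | E3
datatype ff = F0 | F1 | F2 | F3 | F4 | F5
datatype ty = Ty bool bool

fun pickE :: "ee \<Rightarrow> 'a \<Rightarrow> 'a \<Rightarrow> 'a \<Rightarrow> 'a \<Rightarrow> 'a" where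
  "pickE E0 p q r s = p" | "pickE E1 p q r s = q" | "pickE E2 p q r s = r" | "pickE E3 p q r s = s"

fun pickF :: "ff \<Rightarrow> 'a \<Rightarrow> 'a \<Rightarrow> 'a \<Rightarrow> 'a \<Rightarrow> 'a \<Rightarrow> 'a \<Rightarrow> 'a" where
  "pickF F0 p q r s t u = p" | "pickF F1 p q r s t u = q" | "pickF F2 p q r s t u = r"
| "pickF F3 p q r s t u = s" | "pickF F4 p q r s t u = t" | "pickF F5 p q r s t u = u"

fun mulE :: "ty \<Rightarrow> ee \<Rightarrow> ee \<Rightarrow> ee" where
  "mulE (Ty x z) E0 y = y"
| "mulE (Ty True z) E1 y = pickE y E1 E2 E3 E0"
| "mulE (Ty True z) E2 y = pickE y E2 E3 E0 E1"
| "mulE (Ty True z) E3 y = pickE y E3 E0 E1 E2"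
| "mulE (Ty False z) E1 y = pickE y E1 E0 E3 E2"
| "mulE (Ty False z) E2 y = pickE y E2 E3 E0 E1"
| "mulE (Ty False z) E3 y = pickE y E3 E2 E1 E0"

fun mulF :: "ty \<Rightarrow> ff \<Rightarrow> ff \<Rightarrow> ff" where
  "mulF (Ty z x) F0 y = y"
| "mulF (Ty z True) F1 y = pickF y F1 F2 F3 F4 F5 F0"
| "mulF (Ty z True) F2 y = pickF y F2 F3 F4 F5 F0 F1"
| "mulF (Ty z True) F3 y = pickF y F3 F4 F5 F0 F1 F2"
| "mulF (Ty z True) F4 y = pickF y F4 F5 F0 F1 F2 F3"
| "mulF (Ty z True) F5 y = pickF y F5 F0 F1 F2 F3 F4"
| "mulF (Ty z False) F1 y = pickF y F1 F2 F0 F4 F5 F3"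
| "mulF (Ty z False) F2 y = pickF y F2 F0 F1 F5 F3 F4"
| "mulF (Ty z False) F3 y = pickF y F3 F5 F4 F0 F2 F1"
| "mulF (Ty z False) F4 y = pickF y F4 F3 F5 F1 F0 F2"
| "mulF (Ty z False) F5 y = pickF y F5 F4 F3 F2 F1 F0"

fun invE :: "ty \<Rightarrow> ee \<Rightarrow> ee" where
  "invE (Ty True z) y = pickE y E0 E3 E2 E1"
| "invE (Ty False z) y = y"

fun invF :: "ty \<Rightarrow> ff \<Rightarrow> ff" where
  "invF (Ty z True) y = pickF y F0 F5 F4 F3 F2 F1"
| "invF (Ty z False) y = pickF y F0 F2 F1 F3 F4 F5"

text \<open>The closed tables replace the equations through \<open>pickE\<close> and
  \<open>pickF\<close> as code equations: a product of two constructors is then a single rewrite in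
  the long computations.\<close>

lemma [code]: "mulE (Ty True x) E0 E0 = E0" "mulE (Ty True x) E0 E1 = E1" "mulE (Ty True x) E0 E2 = E2"
    "mulE (Ty True x) E0 E3 = E3" "mulE (Ty True x) E1 E0 = E1" "mulE (Ty True x) E1 E1 = E2"
    "mulE (Ty True x) E1 E2 = E3" "mulE (Ty True x) E1 E3 = E0" "mulE (Ty True x) E2 E0 = E2"
    "mulE (Ty True x) E2 E1 = E3" "mulE (Ty True x) E2 E2 = E0" "mulE (Ty True x) E2 E3 = E1"
    "mulE (Ty True x) E3 E0 = E3" "mulE (Ty True x) E3 E1 = E0" "mulE (Ty True x) E3 E2 = E1"
    "mulE (Ty True x) E3 E3 = E2" "mulE (Ty False x) E0 E0 = E0" "mulE (Ty False x) E0 E1 = E1"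
    "mulE (Ty False x) E0 E2 = E2" "mulE (Ty False x) E0 E3 = E3" "mulE (Ty False x) E1 E0 = E1"
    "mulE (Ty False x) E1 E1 = E0" "mulE (Ty False x) E1 E2 = E3" "mulE (Ty False x) E1 E3 = E2"
    "mulE (Ty False x) E2 E0 = E2" "mulE (Ty False x) E2 E1 = E3" "mulE (Ty False x) E2 E2 = E0"
    "mulE (Ty False x) E2 E3 = E1" "mulE (Ty False x) E3 E0 = E3" "mulE (Ty False x) E3 E1 = E2"
    "mulE (Ty False x) E3 E2 = E1" "mulE (Ty False x) E3 E3 = E0" by simp_all
lemma [code]: "mulF (Ty x True) F0 F0 = F0" "mulF (Ty x True) F0 F1 = F1" "mulF (Ty x True) F0 F2 = F2"
    "mulF (Ty x True) F0 F3 = F3" "mulF (Ty x True) F0 F4 = F4" "mulF (Ty x True) F0 F5 = F5"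
    "mulF (Ty x True) F1 F0 = F1" "mulF (Ty x True) F1 F1 = F2" "mulF (Ty x True) F1 F2 = F3"
    "mulF (Ty x True) F1 F3 = F4" "mulF (Ty x True) F1 F4 = F5" "mulF (Ty x True) F1 F5 = F0"
    "mulF (Ty x True) F2 F0 = F2" "mulF (Ty x True) F2 F1 = F3" "mulF (Ty x True) F2 F2 = F4"
    "mulF (Ty x True) F2 F3 = F5" "mulF (Ty x True) F2 F4 = F0" "mulF (Ty x True) F2 F5 = F1"
    "mulF (Ty x True) F3 F0 = F3" "mulF (Ty x True) F3 F1 = F4" "mulF (Ty x True) F3 F2 = F5"
    "mulF (Ty x True) F3 F3 = F0" "mulF (Ty x True) F3 F4 = F1" "mulF (Ty x True) F3 F5 = F2"
    "mulF (Ty x True) F4 F0 = F4" "mulF (Ty x True) F4 F1 = F5" "mulF (Ty x True) F4 F2 = F0"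
    "mulF (Ty x True) F4 F3 = F1" "mulF (Ty x True) F4 F4 = F2" "mulF (Ty x True) F4 F5 = F3"
    "mulF (Ty x True) F5 F0 = F5" "mulF (Ty x True) F5 F1 = F0" "mulF (Ty x True) F5 F2 = F1"
    "mulF (Ty x True) F5 F3 = F2" "mulF (Ty x True) F5 F4 = F3" "mulF (Ty x True) F5 F5 = F4"
    "mulF (Ty x False) F0 F0 = F0" "mulF (Ty x False) F0 F1 = F1" "mulF (Ty x False) F0 F2 = F2"
    "mulF (Ty x False) F0 F3 = F3" "mulF (Ty x False) F0 F4 = F4" "mulF (Ty x False) F0 F5 = F5"
    "mulF (Ty x False) F1 F0 = F1" "mulF (Ty x False) F1 F1 = F2" "mulF (Ty x False) F1 F2 = F0"
    "mulF (Ty x False) F1 F3 = F4" "mulF (Ty x False) F1 F4 = F5" "mulF (Ty x False) F1 F5 = F3"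
    "mulF (Ty x False) F2 F0 = F2" "mulF (Ty x False) F2 F1 = F0" "mulF (Ty x False) F2 F2 = F1"
    "mulF (Ty x False) F2 F3 = F5" "mulF (Ty x False) F2 F4 = F3" "mulF (Ty x False) F2 F5 = F4"
    "mulF (Ty x False) F3 F0 = F3" "mulF (Ty x False) F3 F1 = F5" "mulF (Ty x False) F3 F2 = F4"
    "mulF (Ty x False) F3 F3 = F0" "mulF (Ty x False) F3 F4 = F2" "mulF (Ty x False) F3 F5 = F1"
    "mulF (Ty x False) F4 F0 = F4" "mulF (Ty x False) F4 F1 = F3" "mulF (Ty x False) F4 F2 = F5"
    "mulF (Ty x False) F4 F3 = F1" "mulF (Ty x False) F4 F4 = F0" "mulF (Ty x False) F4 F5 = F2"
    "mulF (Ty x False) F5 F0 = F5" "mulF (Ty x False) F5 F1 = F4" "mulF (Ty x False) F5 F2 = F3"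
    "mulF (Ty x False) F5 F3 = F2" "mulF (Ty x False) F5 F4 = F1" "mulF (Ty x False) F5 F5 = F0" by simp_all
lemma [code]: "invE (Ty True x) E0 = E0" "invE (Ty True x) E1 = E3" "invE (Ty True x) E2 = E2"
    "invE (Ty True x) E3 = E1" "invE (Ty False x) E0 = E0" "invE (Ty False x) E1 = E1"
    "invE (Ty False x) E2 = E2" "invE (Ty False x) E3 = E3" by simp_all
lemma [code]: "invF (Ty x True) F0 = F0" "invF (Ty x True) F1 = F5" "invF (Ty x True) F2 = F4"
    "invF (Ty x True) F3 = F3" "invF (Ty x True) F4 = F2" "invF (Ty x True) F5 = F1"
    "invF (Ty x False) F0 = F0" "invF (Ty x False) F1 = F2" "invF (Ty x False) F2 = F1"
    "invF (Ty x False) F3 = F3" "invF (Ty x False) F4 = F4" "invF (Ty x False) F5 = F5" by simp_all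

text \<open>\<open>W a b c d e f g h\<close> is the alternating word with these letters. Its inverse is rotated by one
  letter, so as to begin in \<open>ee\<close> again.\<close>

datatype wd = W ee ff ee ff ee ff ee ff

fun invW :: "ty \<Rightarrow> wd \<Rightarrow> wd" where
  "invW t (W a b c d e f g h) =
     W (invE t g) (invF t f) (invE t e) (invF t d) (invE t c) (invF t b) (invE t a) (invF t h)"

section \<open>Partial tables of completions\<close>

text \<open>The entry \<open>V e f g h\<close> at position \<open>a b c d\<close> of a table stands for the relator \<open>W a b c d e f g h\<close>.\<close>

datatype slot = N | V ee ff ee ff
datatype 'a te = TE 'a 'a 'a
datatype 'a tf = TF 'a 'a 'a 'a 'a
type_synonym tab = "slot tf te tf te"

fun getE :: "ee \<Rightarrow> 'a te \<Rightarrow> 'a" where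
  "getE E1 (TE x y z) = x" | "getE E2 (TE x y z) = y" | "getE E3 (TE x y z) = z"
fun getF :: "ff \<Rightarrow> 'a tf \<Rightarrow> 'a" where
  "getF F1 (TF x y z u v) = x" | "getF F2 (TF x y z u v) = y" | "getF F3 (TF x y z u v) = z"
| "getF F4 (TF x y z u v) = u" | "getF F5 (TF x y z u v) = v"

fun updE :: "ee \<Rightarrow> ('a \<Rightarrow> 'a) \<Rightarrow> 'a te \<Rightarrow> 'a te" where
  "updE E1 k (TE x y z) = TE (k x) y z"
| "updE E2 k (TE x y z) = TE x (k y) z"
| "updE E3 k (TE x y z) = TE x y (k z)"
fun updF :: "ff \<Rightarrow> ('a \<Rightarrow> 'a) \<Rightarrow> 'a tf \<Rightarrow> 'a tf" where
  "updF F1 k (TF x y z u v) = TF (k x) y z u v"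
| "updF F2 k (TF x y z u v) = TF x (k y) z u v"
| "updF F3 k (TF x y z u v) = TF x y (k z) u v"
| "updF F4 k (TF x y z u v) = TF x y z (k u) v"
| "updF F5 k (TF x y z u v) = TF x y z u (k v)"

text \<open>An entry is never overwritten. Of the eight positions at which a relator is inserted,
  several coincide if it is symmetric; conflicts between entries are the business of
  \<open>cmp\<close>.\<close>

fun keep :: "slot \<Rightarrow> slot \<Rightarrow> slot" where
  "keep v N = v" | "keep v (V a b c d) = V a b c d"

definition look :: "ee \<Rightarrow> ff \<Rightarrow> ee \<Rightarrow> ff \<Rightarrow> tab \<Rightarrow> slot" where
  "look a b c d T = getF d (getE c (getF b (getE a T)))"

definition put :: "ee \<Rightarrow> ff \<Rightarrow> ee \<Rightarrow> ff \<Rightarrow> slot \<Rightarrow> tab \<Rightarrow> tab" where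
  "put a b c d v T = updE a (updF b (updE c (updF d (keep v)))) T"

fun ins4 :: "wd \<Rightarrow> tab \<Rightarrow> tab" where
  "ins4 (W a b c d e f g h) T =
     put a b c d (V e f g h) (put c d e f (V g h a b) (put e f g h (V a b c d) (put g h a b (V c d e f) T)))"

text \<open>With all eight readings of a relator in the table, a common part of three letters always
  shows at two keys that agree in \<open>a b c\<close> or in \<open>b c d\<close>.\<close>

definition ins :: "ty \<Rightarrow> wd \<Rightarrow> tab \<Rightarrow> tab" where
  "ins t w T = ins4 w (ins4 (invW t w) T)"

datatype status = New | Old | Diff

fun verdict :: "bool \<Rightarrow> status" where "verdict True = Old" | "verdict False = Diff"

fun cmp :: "slot \<Rightarrow> slot \<Rightarrow> status" where
  "cmp (V a b c d) (V a' b' c' d') = verdict (a = a' \<and> b = b' \<and> c = c' \<and> d = d')"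
| "cmp N v = New"

fun seek :: "wd \<Rightarrow> tab \<Rightarrow> status" where
  "seek (W a b c d e f g h) T = cmp (look a b c d T) (V e f g h)"

section \<open>Consequences of overlaps, and closure of a table under them\<close>

datatype queue = Clash | End | Push wd queue

fun push :: "wd \<Rightarrow> queue \<Rightarrow> queue" where
  "push w Clash = Clash" | "push w End = Push w End" | "push w (Push v q) = Push w (Push v q)"

fun own :: "status \<Rightarrow> queue \<Rightarrow> queue" where
  "own Old q = q" | "own Diff q = Clash" | "own New q = q"

text \<open>If \<open>a b c d e f g h\<close> and \<open>a b c d' e' f' g' h'\<close> are relators and \<open>d \<noteq> d'\<close>, \<open>h \<noteq> h'\<close>, cancelling
  \<open>a b c\<close> leaves a relator of length eight. If just one of \<open>d = d'\<close>, \<open>h = h'\<close> holds, a shorter relator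
  remains, which is a contradiction. \<open>ovF2\<close> does the same for a common part \<open>b c d\<close>.\<close>

fun ovE2 :: "bool \<Rightarrow> bool \<Rightarrow> ty \<Rightarrow> ff \<Rightarrow> slot \<Rightarrow> ff \<Rightarrow> slot \<Rightarrow> queue \<Rightarrow> queue" where
  "ovE2 True l t d v d' v' q = own (cmp v v') q"
| "ovE2 False True t d v d' v' q = Clash"
| "ovE2 False False t d (V e f g h) d' (V e' f' g' h') q =
     push (W e f g (mulF t h (invF t h')) (invE t g') (invF t f') (invE t e') (mulF t (invF t d') d)) q"

fun ovE :: "ty \<Rightarrow> ff \<Rightarrow> slot \<Rightarrow> ff \<Rightarrow> slot \<Rightarrow> queue \<Rightarrow> queue" where
  "ovE t d (V e f g h) d' (V e' f' g' h') q =
     ovE2 (d = d') (h = h') t d (V e f g h) d' (V e' f' g' h') q"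
| "ovE t d v d' N q = q"

fun ovF2 :: "bool \<Rightarrow> bool \<Rightarrow> ty \<Rightarrow> ee \<Rightarrow> slot \<Rightarrow> ee \<Rightarrow> slot \<Rightarrow> queue \<Rightarrow> queue" where
  "ovF2 True l t a v a' v' q = own (cmp v v') q"
| "ovF2 False True t a v a' v' q = Clash"
| "ovF2 False False t a (V e f g h) a' (V e' f' g' h') q =
     push (W (mulE t (invE t e) e') f' g' h' (mulE t a' (invE t a)) (invF t h) (invE t g) (invF t f)) q"

fun ovF :: "ty \<Rightarrow> ee \<Rightarrow> slot \<Rightarrow> ee \<Rightarrow> slot \<Rightarrow> queue \<Rightarrow> queue" where
  "ovF t a (V e f g h) a' (V e' f' g' h') q =
     ovF2 (a = a') (e = e') t a (V e f g h) a' (V e' f' g' h') q"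
| "ovF t a v a' N q = q"

fun rowE :: "ty \<Rightarrow> ff \<Rightarrow> slot \<Rightarrow> slot tf \<Rightarrow> queue \<Rightarrow> queue" where
  "rowE t d v (TF x y z u w) q =
     ovE t d v F5 w (ovE t d v F4 u (ovE t d v F3 z (ovE t d v F2 y (ovE t d v F1 x q))))"

definition look3 :: "ff \<Rightarrow> ee \<Rightarrow> ff \<Rightarrow> slot tf te tf \<Rightarrow> slot" where
  "look3 b c d T = getF d (getE c (getF b T))"

fun rowF :: "ty \<Rightarrow> ee \<Rightarrow> ff \<Rightarrow> ee \<Rightarrow> ff \<Rightarrow> slot \<Rightarrow> tab \<Rightarrow> queue \<Rightarrow> queue" where
  "rowF t a b c d v (TE x y z) q =
     ovF t a v E3 (look3 b c d z) (ovF t a v E2 (look3 b c d y) (ovF t a v E1 (look3 b c d x) q))"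

definition row :: "ty \<Rightarrow> ee \<Rightarrow> ff \<Rightarrow> ee \<Rightarrow> ff \<Rightarrow> slot \<Rightarrow> tab \<Rightarrow> queue \<Rightarrow> queue" where
  "row t a b c d v T q = rowE t d v (getE c (getF b (getE a T))) (rowF t a b c d v T q)"

text \<open>Overlaps of the inverse word are covered as well: overlapping it with an entry amounts
  to overlapping the word itself with the inverse entry, which is also in the table.\<close>

fun deduce :: "ty \<Rightarrow> wd \<Rightarrow> tab \<Rightarrow> queue" where
  "deduce t (W a b c d e f g h) T =
     row t a b c d (V e f g h) T (row t c d e f (V g h a b) T
       (row t e f g h (V a b c d) T (row t g h a b (V c d e f) T End)))"

datatype state = Bad | St tab queue

fun absorb :: "ty \<Rightarrow> queue \<Rightarrow> tab \<Rightarrow> queue \<Rightarrow> state"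
and absorb2 :: "status \<Rightarrow> ty \<Rightarrow> wd \<Rightarrow> queue \<Rightarrow> tab \<Rightarrow> queue \<Rightarrow> state" where
  "absorb t Clash T q = Bad"
| "absorb t End T q = St T q"
| "absorb t (Push w D) T q = absorb2 (seek w T) t w D T q"
| "absorb2 New t w D T q = absorb t D (ins t w T) (Push w q)"
| "absorb2 Old t w D T q = absorb t D T q"
| "absorb2 Diff t w D T q = Bad"

text \<open>When the bound is reached, the rest of the queue is kept and the table is still valid:
  fewer consequences have been drawn, but no false ones.\<close>

fun run :: "nat \<Rightarrow> ty \<Rightarrow> state \<Rightarrow> state" where
  "run n t Bad = Bad"
| "run n t (St T Clash) = Bad"
| "run n t (St T End) = St T End"
| "run 0 t (St T (Push w q)) = St T (Push w q)"
| "run (Suc n) t (St T (Push w q)) = run n t (absorb t (deduce t w T) T q)"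

section \<open>Possible completions of a given half\<close>

fun cnd :: "bool \<Rightarrow> wd \<Rightarrow> wd list \<Rightarrow> wd list" where
  "cnd True w ws = w # ws" | "cnd False w ws = ws"

fun fits :: "status \<Rightarrow> bool" where "fits New = True" | "fits Old = True" | "fits Diff = False"

text \<open>A relator beginning with \<open>a b c d\<close> can often be read off from a relator that overlaps it and is
  already in the table; if not, one more letter is tried out.\<close>

fun candH :: "ty \<Rightarrow> ee \<Rightarrow> ff \<Rightarrow> ee \<Rightarrow> ff \<Rightarrow> ee \<Rightarrow> ff \<Rightarrow> ee \<Rightarrow> tab \<Rightarrow> ff \<Rightarrow> wd list \<Rightarrow> wd list" where
  "candH t a b c d e f g T h ws =
     cnd (fits (cmp (look e f g h T) (V a b c d)) \<and> fits (cmp (look g h a b T) (V c d e f)))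
       (W a b c d e f g h) ws"

fun candG2 :: "slot \<Rightarrow> ty \<Rightarrow> ee \<Rightarrow> ff \<Rightarrow> ee \<Rightarrow> ff \<Rightarrow> ee \<Rightarrow> ff \<Rightarrow> ee \<Rightarrow> tab \<Rightarrow> wd list \<Rightarrow> wd list" where
  "candG2 (V c' b' a' h) t a b c d e f g T ws =
     cnd (invE t a = a' \<and> invF t b = b' \<and> invE t c = c') (W a b c d e f g (invF t h)) ws"
| "candG2 N t a b c d e f g T ws = candH t a b c d e f g T F1 (candH t a b c d e f g T F2
     (candH t a b c d e f g T F3 (candH t a b c d e f g T F4 (candH t a b c d e f g T F5 ws))))"

definition candG :: "ty \<Rightarrow> ee \<Rightarrow> ff \<Rightarrow> ee \<Rightarrow> ff \<Rightarrow> ee \<Rightarrow> ff \<Rightarrow> tab \<Rightarrow> ee \<Rightarrow> wd list \<Rightarrow> wd list" where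
  "candG t a b c d e f T g ws =
     candG2 (look (invE t g) (invF t f) (invE t e) (invF t d) T) t a b c d e f g T ws"

fun candF2 :: "slot \<Rightarrow> ty \<Rightarrow> ee \<Rightarrow> ff \<Rightarrow> ee \<Rightarrow> ff \<Rightarrow> ee \<Rightarrow> ff \<Rightarrow> tab \<Rightarrow> wd list \<Rightarrow> wd list" where
  "candF2 (V g h a' b') t a b c d e f T ws = cnd (a = a' \<and> b = b') (W a b c d e f g h) ws"
| "candF2 N t a b c d e f T ws =
     candG t a b c d e f T E1 (candG t a b c d e f T E2 (candG t a b c d e f T E3 ws))"

definition candF :: "ty \<Rightarrow> ee \<Rightarrow> ff \<Rightarrow> ee \<Rightarrow> ff \<Rightarrow> ee \<Rightarrow> tab \<Rightarrow> ff \<Rightarrow> wd list \<Rightarrow> wd list" where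
  "candF t a b c d e T f ws = candF2 (look c d e f T) t a b c d e f T ws"

text \<open>The key is the inverse relator read from \<open>e\<close> backwards. An entry there
  consists of the inverses of \<open>a\<close>, \<open>h\<close>, \<open>g\<close>,
  \<open>f\<close>: it must reproduce \<open>a\<close>, and it fixes the other three
  letters.\<close>

fun candE2 :: "slot \<Rightarrow> ty \<Rightarrow> ee \<Rightarrow> ff \<Rightarrow> ee \<Rightarrow> ff \<Rightarrow> ee \<Rightarrow> tab \<Rightarrow> wd list \<Rightarrow> wd list" where
  "candE2 (V a' h g f) t a b c d e T ws =
     cnd (invE t a = a') (W a b c d e (invF t f) (invE t g) (invF t h)) ws"
| "candE2 N t a b c d e T ws = candF t a b c d e T F1 (candF t a b c d e T F2
     (candF t a b c d e T F3 (candF t a b c d e T F4 (candF t a b c d e T F5 ws))))"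

definition candE :: "ty \<Rightarrow> ee \<Rightarrow> ff \<Rightarrow> ee \<Rightarrow> ff \<Rightarrow> tab \<Rightarrow> ee \<Rightarrow> wd list \<Rightarrow> wd list" where
  "candE t a b c d T e ws =
     candE2 (look (invE t e) (invF t d) (invE t c) (invF t b) T) t a b c d e T ws"

definition cands :: "ty \<Rightarrow> ee \<Rightarrow> ff \<Rightarrow> ee \<Rightarrow> ff \<Rightarrow> tab \<Rightarrow> wd list" where
  "cands t a b c d T = candE t a b c d T E1 (candE t a b c d T E2 (candE t a b c d T E3 []))"

text \<open>A bound on the number of relators that are processed, in the unary form on which \<open>run\<close> recurses.\<close>

definition fuel :: nat where
  "fuel = Suc (Suc (Suc (Suc (Suc (Suc (Suc (Suc (Suc (Suc (Suc (Suc (Suc (Suc (Suc (Suc (Suc (Suc (Suc (Suc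
    (Suc (Suc (Suc (Suc (Suc (Suc (Suc (Suc (Suc (Suc (Suc (Suc (Suc (Suc (Suc (Suc (Suc (Suc (Suc (Suc
    (Suc (Suc (Suc (Suc (Suc (Suc (Suc (Suc (Suc (Suc (Suc (Suc (Suc (Suc (Suc (Suc (Suc (Suc (Suc (Suc
    (Suc (Suc (Suc (Suc 0)))))))))))))))))))))))))))))))))))))))))))))))))))))))))))))))"

definition empty_tab :: tab where
  "empty_tab = (let x = TF N N N N N; y = TE x x x; z = TF y y y y y in TE z z z)"

fun mapW :: "ee te \<Rightarrow> ff tf \<Rightarrow> wd \<Rightarrow> wd" where
  "mapW x y (W a b c d e f g h) =
     W (getE a x) (getF b y) (getE c x) (getF d y) (getE e x) (getF f y) (getE g x) (getF h y)"

fun is_old :: "status \<Rightarrow> bool" where "is_old Old = True" | "is_old New = False" | "is_old Diff = False"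

fun all_in :: "wd list \<Rightarrow> ee te \<Rightarrow> ff tf \<Rightarrow> tab \<Rightarrow> bool" where
  "all_in [] x y T = True"
| "all_in (w # ws) x y T = (is_old (seek (mapW x y w) T) \<and> all_in ws x y T)"

text \<open>All automorphisms, given by the images of the nonunits. A cyclic group has only the
  identity and inversion; for the Klein four-group and for S_3 every permutation of the three
  involutions extends uniquely.\<close>

fun auts :: "ty \<Rightarrow> ee te list \<times> ff tf list" where
  "auts (Ty p q) =
    (if p then [TE E1 E2 E3, TE E3 E2 E1]
     else [TE E1 E2 E3, TE E1 E3 E2, TE E2 E1 E3, TE E2 E3 E1, TE E3 E1 E2, TE E3 E2 E1],
     if q then [TF F1 F2 F3 F4 F5, TF F5 F4 F3 F2 F1]
     else [TF F1 F2 F3 F4 F5, TF F1 F2 F4 F5 F3, TF F1 F2 F5 F3 F4,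
           TF F2 F1 F3 F5 F4, TF F2 F1 F4 F3 F5, TF F2 F1 F5 F4 F3])"

text \<open>The relators of length eight in the presentations of \<open>L\<^sub>1, \<dots>, L\<^sub>1\<^sub>1\<close>, by the type of the two subgroups.\<close>

fun bases :: "ty \<Rightarrow> wd list list" where
  "bases (Ty True True) =
    [[W E1 F5 E3 F2 E3 F1 E2 F1, W E1 F1 E2 F5 E3 F1 E2 F5, W E1 F1 E1 F5 E1 F4 E3 F2]]"
|   "bases (Ty False True) =
    [[W E1 F1 E2 F1 E2 F5 E2 F5, W E2 F5 E2 F1 E2 F1 E1 F5, W E1 F1 E1 F1 E1 F1 E1 F1, W E1 F1 E2 F4 E1 F4 E2 F1],
     [W E2 F1 E2 F1 E2 F1 E2 F1, W E2 F1 E1 F1 E2 F1 E1 F1, W E1 F1 E1 F1 E1 F1 E1 F1,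
         W E2 F5 E1 F2 E2 F1 E1 F4, W E2 F2 E1 F4 E2 F1 E2 F5],
     [W E2 F1 E2 F5 E2 F1 E2 F5, W E1 F1 E2 F5 E1 F1 E2 F5, W E2 F1 E1 F5 E2 F1 E1 F5,
         W E1 F1 E1 F5 E1 F1 E1 F5, W E1 F1 E2 F1 E1 F2 E2 F2, W E1 F1 E1 F2 E1 F1 E1 F2, W E2 F1 E2 F1 E3 F1 E1 F3],
     [W E1 F5 E2 F1 E1 F5 E2 F1, W E2 F1 E3 F1 E2 F5 E2 F5, W E1 F2 E2 F1 E2 F2 E1 F1]]"
|   "bases (Ty True False) =
    [[W E1 F2 E1 F3 E1 F2 E1 F3, W E1 F3 E3 F3 E1 F3 E3 F4, W E3 F2 E1 F2 E3 F3 E3 F5],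
     [W E1 F1 E1 F1 E1 F1 E1 F1, W E1 F2 E1 F3 E3 F1 E3 F5, W E1 F3 E1 F5 E1 F2 E3 F2,
         W E1 F5 E1 F3 E1 F1 E3 F1, W E1 F1 E1 F3 E1 F3 E2 F4]]"
|   "bases (Ty False False) =
    [[W E2 F1 E1 F2 E2 F2 E1 F1, W E1 F2 E1 F1 E1 F2 E1 F1, W E2 F1 E2 F3 E1 F2 E1 F3,
        W E3 F1 E1 F4 E2 F1 E1 F3, W E1 F4 E1 F4 E1 F4 E1 F4],
     [W E2 F3 E1 F3 E2 F3 E1 F3, W E1 F3 E1 F3 E1 F3 E1 F3, W E2 F1 E2 F3 E1 F2 E1 F3,
         W E1 F2 E1 F1 E1 F2 E1 F1, W E2 F1 E1 F2 E3 F1 E1 F2, W E1 F2 E2 F5 E2 F1 E1 F5, W E1 F1 E2 F4 E2 F2 E1 F4],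
     [W E1 F2 E1 F1 E1 F2 E1 F1, W E2 F2 E1 F3 E1 F1 E2 F4, W E3 F2 E1 F3 E2 F1 E1 F4, W E2 F2 E1 F4 E2 F4 E1 F1],
     [W E1 F3 E1 F3 E1 F3 E1 F3, W E2 F2 E1 F1 E2 F2 E1 F1, W E1 F2 E1 F3 E1 F2 E1 F3,
         W E1 F2 E1 F1 E1 F2 E1 F1, W E1 F1 E2 F1 E2 F4 E2 F3, W E1 F1 E2 F3 E2 F2 E1 F5]]"

text \<open>Representatives, up to rotation, inversion and automorphisms, for the branches that
  survive the split in \<open>top_cert\<close>. The order matters: a certificate may refer only to
  roots with smaller numbers, so roots that are refuted quickly come early and the large trees stand
  near the end.\<close>

fun roots :: "ty \<Rightarrow> wd list" where
  "roots (Ty True True) =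
    [W E1 F1 E2 F3 E2 F3 E3 F3,
     W E1 F2 E2 F1 E2 F3 E2 F3,
     W E1 F2 E1 F2 E2 F3 E2 F3,
     W E1 F1 E2 F2 E2 F3 E2 F3,
     W E1 F1 E1 F1 E2 F3 E2 F3,
     W E1 F3 E2 F3 E2 F3 E3 F3,
     W E1 F1 E2 F1 E2 F3 E2 F3,
     W E1 F2 E2 F2 E2 F3 E2 F3,
     W E1 F2 E2 F5 E2 F3 E2 F3,
     W E1 F1 E2 F4 E2 F3 E2 F3,
     W E1 F2 E2 F3 E2 F3 E1 F3,
     W E1 F2 E1 F3 E2 F3 E2 F4,
     W E1 F1 E1 F3 E2 F3 E2 F5,
     W E1 F1 E2 F3 E2 F3 E3 F5,
     W E1 F2 E2 F3 E2 F3 E3 F4,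
     W E1 F1 E2 F3 E2 F3 E1 F2,
     W E1 F1 E2 F3 E2 F3 E3 F2,
     W E1 F1 E3 F2 E2 F3 E2 F3,
     W E1 F1 E2 F3 E2 F3 E3 F4,
     W E1 F1 E3 F3 E2 F3 E2 F4,
     W E1 F2 E2 F3 E2 F3 E3 F2,
     W E1 F1 E2 F3 E2 F3 E3 F1,
     W E1 F1 E2 F3 E2 F3 E1 F4,
     W E1 F1 E1 F3 E2 F3 E2 F4,
     W E1 F1 E1 F2 E2 F3 E2 F3,
     W E2 F1 E2 F3 E2 F3 E2 F5,
     W E2 F2 E2 F3 E2 F3 E2 F4,
     W E2 F3 E2 F3 E2 F3 E2 F3]"
|   "roots (Ty False True) =
    [W E1 F1 E2 F3 E2 F3 E3 F3,
     W E1 F1 E2 F3 E2 F3 E1 F3,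
     W E1 F2 E2 F3 E2 F3 E3 F3,
     W E1 F2 E1 F2 E2 F3 E2 F3,
     W E1 F1 E1 F1 E2 F3 E2 F3,
     W E1 F2 E1 F2 E2 F3 E1 F3,
     W E1 F1 E1 F1 E2 F3 E1 F3,
     W E1 F1 E2 F3 E1 F3 E1 F4,
     W E1 F2 E2 F3 E2 F3 E3 F4,
     W E1 F2 E2 F2 E3 F3 E1 F3,
     W E1 F1 E1 F3 E1 F3 E2 F5,
     W E1 F1 E1 F3 E1 F3 E2 F4,
     W E1 F1 E1 F3 E2 F3 E2 F5,
     W E1 F1 E2 F1 E3 F3 E1 F3,
     W E1 F1 E2 F3 E2 F3 E1 F4,
     W E1 F1 E2 F2 E2 F3 E1 F3,
     W E1 F1 E2 F3 E2 F3 E3 F4,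
     W E1 F2 E1 F3 E1 F3 E2 F4,
     W E1 F1 E2 F3 E3 F3 E3 F4,
     W E1 F1 E1 F3 E2 F3 E2 F4,
     W E1 F1 E2 F3 E2 F3 E3 F5,
     W E1 F1 E2 F2 E2 F3 E2 F3,
     W E1 F1 E1 F2 E2 F3 E1 F3,
     W E1 F2 E1 F3 E2 F3 E2 F4,
     W E1 F1 E1 F2 E2 F3 E2 F3,
     W E1 F1 E2 F2 E3 F3 E1 F3,
     W E1 F1 E2 F2 E3 F3 E3 F3,
     W E1 F1 E1 F3 E1 F3 E1 F5,
     W E1 F2 E1 F3 E1 F3 E1 F4,
     W E1 F2 E2 F3 E2 F3 E2 F4,
     W E1 F1 E2 F3 E2 F3 E2 F5,
     W E1 F3 E1 F3 E1 F3 E1 F3,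
     W E1 F3 E1 F3 E2 F3 E2 F3]"
|   "roots (Ty True False) =
    [W E1 F1 E1 F1 E2 F1 E2 F2,
     W E1 F1 E2 F1 E2 F2 E1 F3,
     W E1 F1 E1 F1 E2 F2 E2 F2,
     W E1 F1 E2 F1 E2 F3 E2 F3,
     W E1 F1 E2 F1 E2 F3 E2 F5,
     W E1 F1 E2 F1 E2 F3 E2 F4,
     W E1 F3 E2 F1 E2 F1 E2 F3,
     W E1 F1 E2 F1 E2 F2 E3 F2,
     W E1 F3 E2 F1 E2 F1 E2 F5,
     W E1 F1 E2 F1 E2 F3 E3 F4,
     W E1 F1 E2 F1 E2 F3 E3 F3,
     W E1 F1 E2 F1 E2 F3 E3 F2,
     W E1 F1 E1 F2 E2 F2 E2 F3,
     W E1 F1 E1 F1 E2 F1 E2 F3,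
     W E1 F1 E2 F1 E2 F1 E1 F3,
     W E2 F1 E2 F1 E2 F3 E2 F4,
     W E1 F1 E2 F1 E2 F3 E3 F1,
     W E1 F1 E2 F1 E2 F3 E3 F5,
     W E1 F1 E2 F1 E2 F2 E3 F1,
     W E1 F1 E2 F1 E2 F3 E1 F3,
     W E1 F1 E2 F1 E2 F3 E1 F4,
     W E1 F1 E2 F1 E2 F3 E1 F5,
     W E2 F1 E2 F1 E2 F2 E2 F2,
     W E2 F1 E2 F1 E2 F1 E2 F1]"
|   "roots (Ty False False) =
    [W E1 F1 E1 F1 E2 F2 E3 F3,
     W E1 F1 E1 F1 E2 F1 E2 F2,
     W E1 F1 E1 F1 E2 F3 E1 F3,
     W E1 F1 E1 F1 E2 F3 E3 F2,
     W E1 F1 E1 F1 E2 F2 E2 F3,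
     W E1 F1 E1 F1 E2 F3 E3 F3,
     W E1 F1 E1 F1 E1 F3 E2 F4,
     W E1 F1 E1 F1 E2 F3 E2 F3,
     W E1 F1 E1 F1 E2 F1 E1 F3,
     W E1 F1 E1 F1 E2 F3 E1 F4,
     W E1 F1 E1 F1 E2 F2 E1 F2,
     W E1 F1 E1 F1 E2 F1 E3 F3,
     W E1 F1 E1 F1 E2 F1 E2 F1,
     W E1 F1 E1 F1 E2 F3 E3 F1,
     W E1 F1 E1 F1 E2 F1 E2 F3,
     W E1 F1 E1 F1 E2 F2 E2 F1,
     W E1 F1 E1 F1 E2 F3 E3 F4,
     W E1 F1 E1 F1 E2 F3 E1 F5,
     W E1 F1 E1 F1 E2 F3 E2 F4,
     W E1 F1 E1 F1 E1 F3 E1 F4,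
     W E1 F1 E1 F1 E2 F3 E2 F5,
     W E1 F1 E1 F1 E2 F2 E2 F2,
     W E1 F1 E1 F1 E1 F3 E2 F5,
     W E1 F1 E1 F1 E2 F3 E3 F5,
     W E1 F1 E1 F1 E1 F2 E1 F2,
     W E1 F1 E1 F1 E1 F1 E1 F1]"

text \<open>\<open>Sol k j l\<close>: the table contains the \<open>k\<close>-th base, transformed by the automorphisms with numbers
  \<open>j\<close> and \<open>l\<close>. \<open>Sym k j l\<close>: it contains the transformed \<open>k\<close>-th root, a relator whose branch has been
  searched before. \<open>Br a b c d cs\<close>: split according to the completion of \<open>a b c d\<close>; \<open>cs\<close> has certificates
  for those completions that do not lead to a contradiction at once.\<close>

datatype cert = Sol nat nat nat | Sym nat nat nat | Br ee ff ee ff "cert list"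

definition found :: "ty \<Rightarrow> nat \<Rightarrow> nat \<Rightarrow> wd list \<Rightarrow> tab \<Rightarrow> bool" where
  "found t j l ws T \<longleftrightarrow> j < length (fst (auts t)) \<and> l < length (snd (auts t)) \<and>
     all_in ws (fst (auts t) ! j) (snd (auts t) ! l) T"

function check :: "nat \<Rightarrow> ty \<Rightarrow> cert \<Rightarrow> tab \<Rightarrow> bool"
and kids :: "nat \<Rightarrow> ty \<Rightarrow> wd list \<Rightarrow> cert list \<Rightarrow> tab \<Rightarrow> bool"
and kid :: "state \<Rightarrow> nat \<Rightarrow> ty \<Rightarrow> wd list \<Rightarrow> cert list \<Rightarrow> tab \<Rightarrow> bool" where
  "check m t (Sol k j l) T \<longleftrightarrow> k < length (bases t) \<and> found t j l (bases t ! k) T"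
| "check m t (Sym k j l) T \<longleftrightarrow> k < m \<and> found t j l [roots t ! k] T"
| "check m t (Br a b c d cs) T \<longleftrightarrow> a \<noteq> E0 \<and> b \<noteq> F0 \<and> c \<noteq> E0 \<and> d \<noteq> F0 \<and> kids m t (cands t a b c d T) cs T"
| "kids m t [] cs T \<longleftrightarrow> True"
| "kids m t (w # ws) cs T \<longleftrightarrow> kid (run fuel t (absorb t (Push w End) T End)) m t ws cs T"
| "kid Bad m t ws cs T \<longleftrightarrow> kids m t ws cs T"
| "kid (St T' q) m t ws [] T \<longleftrightarrow> False"
| "kid (St T' q) m t ws (c # cs) T \<longleftrightarrow> check m t c T' \<and> kids m t ws cs T"
  by pat_completeness auto
termination
  \<comment> \<open>The size of the pending certificates decreases. Where none is consumed, in
    passing between \<open>kids\<close> and \<open>kid\<close>, twice the number of candidates does;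
    the odd values belong to \<open>kid\<close>.\<close>
  by (relation "measures [case_sum (\<lambda>(m, t, c, T). size c)
        (case_sum (\<lambda>(m, t, ws, cs, T). size_list size cs) (\<lambda>(s, m, t, ws, cs, T). size_list size cs)),
      case_sum (\<lambda>_. 0)
        (case_sum (\<lambda>(m, t, ws, cs, T). 2 * length ws) (\<lambda>(s, m, t, ws, cs, T). 2 * length ws + 1))]") auto

section \<open>Soundness of the search\<close>

fun nz :: "wd \<Rightarrow> bool" where
  "nz (W a b c d e f g h) \<longleftrightarrow> a \<noteq> E0 \<and> b \<noteq> F0 \<and> c \<noteq> E0 \<and> d \<noteq> F0 \<and> e \<noteq> E0 \<and> f \<noteq> F0 \<and> g \<noteq> E0 \<and> h \<noteq> F0"

definition relators :: "ty \<Rightarrow> wd set \<Rightarrow> bool" where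
  "relators t R \<longleftrightarrow> (\<forall>w \<in> R. nz w \<and> invW t w \<in> R) \<and>
     (\<forall>a b c d e f g h. W a b c d e f g h \<in> R \<longrightarrow> W c d e f g h a b \<in> R) \<and>
     (\<forall>a b c d e f g h d' e' f' g' h'. W a b c d e f g h \<in> R \<longrightarrow> W a b c d' e' f' g' h' \<in> R \<longrightarrow>
        d \<noteq> d' \<longrightarrow> h \<noteq> h' \<longrightarrow>
        W e f g (mulF t h (invF t h')) (invE t g') (invF t f') (invE t e') (mulF t (invF t d') d) \<in> R) \<and>
     (\<forall>a b c d e f g h a' e' f' g' h'. W a b c d e f g h \<in> R \<longrightarrow> W a' b c d e' f' g' h' \<in> R \<longrightarrow>
        a \<noteq> a' \<longrightarrow> e \<noteq> e' \<longrightarrow>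
        W (mulE t (invE t e) e') f' g' h' (mulE t a' (invE t a)) (invF t h) (invE t g) (invF t f) \<in> R)"

text \<open>Existence of completions comes from diameter four. The two uniqueness conditions come
  from girth eight: if the overlap extended by one letter on just one side, a shorter relator would
  remain.\<close>

definition quadrangular :: "ty \<Rightarrow> wd set \<Rightarrow> bool" where
  "quadrangular t R \<longleftrightarrow> relators t R \<and>
     (\<forall>a b c d. a \<noteq> E0 \<longrightarrow> b \<noteq> F0 \<longrightarrow> c \<noteq> E0 \<longrightarrow> d \<noteq> F0 \<longrightarrow> (\<exists>e f g h. W a b c d e f g h \<in> R)) \<and>
     (\<forall>a b c d e f g h d' e' f' g' h'. W a b c d e f g h \<in> R \<longrightarrow> W a b c d' e' f' g' h' \<in> R \<longrightarrow>
        d = d' \<or> h = h' \<longrightarrow> d = d' \<and> e = e' \<and> f = f' \<and> g = g' \<and> h = h') \<and>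
     (\<forall>a b c d e f g h a' e' f' g' h'. W a b c d e f g h \<in> R \<longrightarrow> W a' b c d e' f' g' h' \<in> R \<longrightarrow>
        a = a' \<or> e = e' \<longrightarrow> a = a' \<and> e = e' \<and> f = f' \<and> g = g' \<and> h = h')"

lemma relatorsD:
  assumes "relators t R"
  shows "w \<in> R \<Longrightarrow> nz w" and "w \<in> R \<Longrightarrow> invW t w \<in> R"
    and "W a b c d e f g h \<in> R \<Longrightarrow> W c d e f g h a b \<in> R"
    and "W a b c d e f g h \<in> R \<Longrightarrow> W a b c d' e' f' g' h' \<in> R \<Longrightarrow> d \<noteq> d' \<Longrightarrow> h \<noteq> h' \<Longrightarrow>
        W e f g (mulF t h (invF t h')) (invE t g') (invF t f') (invE t e') (mulF t (invF t d') d) \<in> R"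
    and "W a b c d e f g h \<in> R \<Longrightarrow> W a' b c d e' f' g' h' \<in> R \<Longrightarrow> a \<noteq> a' \<Longrightarrow> e \<noteq> e' \<Longrightarrow>
        W (mulE t (invE t e) e') f' g' h' (mulE t a' (invE t a)) (invF t h) (invE t g) (invF t f) \<in> R"
proof -
  note * = assms[unfolded relators_def]
  note 1 = conjunct1[OF *] and 2 = conjunct2[OF *]
  note 3 = conjunct2[OF 2]
  show "w \<in> R \<Longrightarrow> nz w" "w \<in> R \<Longrightarrow> invW t w \<in> R" using 1 by simp_all
  show "W a b c d e f g h \<in> R \<Longrightarrow> W c d e f g h a b \<in> R" using conjunct1[OF 2] by simp
  show "W a b c d e f g h \<in> R \<Longrightarrow> W a b c d' e' f' g' h' \<in> R \<Longrightarrow> d \<noteq> d' \<Longrightarrow> h \<noteq> h' \<Longrightarrow>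
        W e f g (mulF t h (invF t h')) (invE t g') (invF t f') (invE t e') (mulF t (invF t d') d) \<in> R"
    by (rule conjunct1[OF 3, rule_format])
  show "W a b c d e f g h \<in> R \<Longrightarrow> W a' b c d e' f' g' h' \<in> R \<Longrightarrow> a \<noteq> a' \<Longrightarrow> e \<noteq> e' \<Longrightarrow>
        W (mulE t (invE t e) e') f' g' h' (mulE t a' (invE t a)) (invF t h) (invE t g) (invF t f) \<in> R"
    by (rule conjunct2[OF 3, rule_format])
qed

lemma quadrangularD:
  assumes "quadrangular t R"
  shows "relators t R"
    and "a \<noteq> E0 \<Longrightarrow> b \<noteq> F0 \<Longrightarrow> c \<noteq> E0 \<Longrightarrow> d \<noteq> F0 \<Longrightarrow> \<exists>e f g h. W a b c d e f g h \<in> R"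
    and "W a b c d e f g h \<in> R \<Longrightarrow> W a b c d' e' f' g' h' \<in> R \<Longrightarrow> d = d' \<or> h = h' \<Longrightarrow>
        d = d' \<and> e = e' \<and> f = f' \<and> g = g' \<and> h = h'"
    and "W a b c d e f g h \<in> R \<Longrightarrow> W a' b c d e' f' g' h' \<in> R \<Longrightarrow> a = a' \<or> e = e' \<Longrightarrow>
        a = a' \<and> e = e' \<and> f = f' \<and> g = g' \<and> h = h'"
proof -
  note * = assms[unfolded quadrangular_def]
  note 1 = conjunct1[OF *] and 2 = conjunct2[OF *]
  note 3 = conjunct2[OF 2]
  show "relators t R" by (rule 1)
  show "a \<noteq> E0 \<Longrightarrow> b \<noteq> F0 \<Longrightarrow> c \<noteq> E0 \<Longrightarrow> d \<noteq> F0 \<Longrightarrow> \<exists>e f g h. W a b c d e f g h \<in> R"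
    by (rule conjunct1[OF 2, rule_format])
  show "W a b c d e f g h \<in> R \<Longrightarrow> W a b c d' e' f' g' h' \<in> R \<Longrightarrow> d = d' \<or> h = h' \<Longrightarrow>
        d = d' \<and> e = e' \<and> f = f' \<and> g = g' \<and> h = h'"
    by (rule conjunct1[OF 3, rule_format])
  show "W a b c d e f g h \<in> R \<Longrightarrow> W a' b c d e' f' g' h' \<in> R \<Longrightarrow> a = a' \<or> e = e' \<Longrightarrow>
        a = a' \<and> e = e' \<and> f = f' \<and> g = g' \<and> h = h'"
    by (rule conjunct2[OF 3, rule_format])
qed

definition tab_ok :: "wd set \<Rightarrow> tab \<Rightarrow> bool" where
  "tab_ok R T \<longleftrightarrow> (\<forall>a b c d e f g h. a \<noteq> E0 \<longrightarrow> b \<noteq> F0 \<longrightarrow> c \<noteq> E0 \<longrightarrow> d \<noteq> F0 \<longrightarrow>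
     look a b c d T = V e f g h \<longrightarrow> W a b c d e f g h \<in> R)"

text \<open>A clash refutes \<open>quadrangular\<close>, not \<open>relators\<close>. Validity is
  therefore preserved under \<open>relators\<close> alone, and this is what makes tables in
  \<open>L i\<close> trustworthy.\<close>

fun queue_ok :: "ty \<Rightarrow> wd set \<Rightarrow> queue \<Rightarrow> bool" where
  "queue_ok t R Clash \<longleftrightarrow> \<not> quadrangular t R"
| "queue_ok t R End \<longleftrightarrow> True"
| "queue_ok t R (Push w q) \<longleftrightarrow> w \<in> R \<and> queue_ok t R q"

fun state_ok :: "ty \<Rightarrow> wd set \<Rightarrow> state \<Rightarrow> bool" where
  "state_ok t R Bad \<longleftrightarrow> \<not> quadrangular t R"
| "state_ok t R (St T q) \<longleftrightarrow> tab_ok R T \<and> queue_ok t R q"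

lemma getE_updE: "a \<noteq> E0 \<Longrightarrow> a' \<noteq> E0 \<Longrightarrow> getE a (updE a' k x) = (if a = a' then k (getE a x) else getE a x)"
  by (cases x; cases a; cases a'; simp)

lemma getF_updF: "b \<noteq> F0 \<Longrightarrow> b' \<noteq> F0 \<Longrightarrow> getF b (updF b' k x) = (if b = b' then k (getF b x) else getF b x)"
  by (cases x; cases b; cases b'; simp)

lemma look_put:
  assumes "a \<noteq> E0" "b \<noteq> F0" "c \<noteq> E0" "d \<noteq> F0" "a' \<noteq> E0" "b' \<noteq> F0" "c' \<noteq> E0" "d' \<noteq> F0"
  shows "look a b c d (put a' b' c' d' v T) =
    (if a = a' \<and> b = b' \<and> c = c' \<and> d = d' then keep v (look a b c d T) else look a b c d T)"
  using assms by (simp add: look_def put_def getE_updE getF_updF)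

lemma tab_ok_put:
  assumes "tab_ok R T" "nz (W a b c d e f g h)" "W a b c d e f g h \<in> R"
  shows "tab_ok R (put a b c d (V e f g h) T)"
proof -
  have "W a' b' c' d' e' f' g' h' \<in> R"
    if nz': "a' \<noteq> E0" "b' \<noteq> F0" "c' \<noteq> E0" "d' \<noteq> F0"
      and l: "look a' b' c' d' (put a b c d (V e f g h) T) = V e' f' g' h'" for a' b' c' d' e' f' g' h'
  proof (cases "a' = a \<and> b' = b \<and> c' = c \<and> d' = d")
    case True
    then have "keep (V e f g h) (look a b c d T) = V e' f' g' h'"
      using l nz' by (simp add: look_put)
    then show ?thesis
      using True assms nz' by (cases "look a b c d T") (auto simp: tab_ok_def)
  next
    case False
    then have "look a' b' c' d' T = V e' f' g' h'"
      using l nz' assms(2) by (auto simp: look_put split: if_splits)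
    then show ?thesis using assms(1) nz' by (simp add: tab_ok_def)
  qed
  then show ?thesis unfolding tab_ok_def by blast
qed

lemma tab_ok_ins4:
  assumes R: "relators t R" and T: "tab_ok R T" and w: "w \<in> R"
  shows "tab_ok R (ins4 w T)"
proof -
  obtain a b c d e f g h where [simp]: "w = W a b c d e f g h" by (cases w)
  have 1: "W a b c d e f g h \<in> R" using w by simp
  have 2: "W c d e f g h a b \<in> R" using relatorsD(3)[OF R 1] .
  have 3: "W e f g h a b c d \<in> R" using relatorsD(3)[OF R 2] .
  have 4: "W g h a b c d e f \<in> R" using relatorsD(3)[OF R 3] .
  show ?thesis
    using T 1 2 3 4 relatorsD(1)[OF R] by (simp only: \<open>w = _\<close> ins4.simps tab_ok_put)
qed

lemma tab_ok_ins: "relators t R \<Longrightarrow> tab_ok R T \<Longrightarrow> w \<in> R \<Longrightarrow> tab_ok R (ins t w T)"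
  unfolding ins_def by (intro tab_ok_ins4 relatorsD(2)) auto

lemma tab_ok_empty: "tab_ok R empty_tab"
proof -
  have [simp]: "a \<noteq> E0 \<Longrightarrow> getE a (TE x x x) = x" "b \<noteq> F0 \<Longrightarrow> getF b (TF y y y y y) = y"
    for a b and x :: 'x and y :: 'y by (cases a; simp) (cases b; simp)
  show ?thesis by (simp add: tab_ok_def look_def empty_tab_def Let_def)
qed

lemma queue_ok_push: "w \<in> R \<Longrightarrow> queue_ok t R q \<Longrightarrow> queue_ok t R (push w q)"
  by (cases q) auto

lemma verdict_iff: "verdict p = Old \<longleftrightarrow> p" "verdict p = Diff \<longleftrightarrow> \<not> p" "verdict p \<noteq> New"
  by (cases p; simp)+

lemma cmp_Diff: "v \<noteq> N \<Longrightarrow> cmp u v = Diff \<longleftrightarrow> u \<noteq> N \<and> u \<noteq> v"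
  by (cases u; cases v) (auto simp: verdict_iff)

lemma queue_ok_own:
  assumes "quadrangular t R \<Longrightarrow> v = v'" "v \<noteq> N" "v' \<noteq> N" "queue_ok t R q"
  shows "queue_ok t R (own (cmp v v') q)"
  using assms cmp_Diff[of v' v] by (cases "cmp v v'") auto

context
  fixes t R T
  assumes R: "relators t R" and T: "tab_ok R T"
begin

lemma look_in: "nz (W a b c d e f g h) \<Longrightarrow> look a b c d T = V e' f' g' h' \<Longrightarrow> W a b c d e' f' g' h' \<in> R"
  using T by (simp add: tab_ok_def)

lemma queue_ok_ovE:
  assumes "W a b c d e f g h \<in> R" "d' \<noteq> F0" "v' = look a b c d' T" "queue_ok t R q"
  shows "queue_ok t R (ovE t d (V e f g h) d' v' q)"
proof (cases v')
  case (V e' f' g' h')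
  have nz: "nz (W a b c d e f g h)" using relatorsD(1)[OF R assms(1)] .
  have *: "W a b c d' e' f' g' h' \<in> R" using look_in[of a b c d' e f g h] nz assms V by simp
  show ?thesis
  proof (cases "d = d'")
    case True
    then show ?thesis
      using quadrangularD(3)[OF _ assms(1) *] assms(4) V by (auto simp del: cmp.simps intro!: queue_ok_own)
  next
    case False
    note d = this
    show ?thesis
    proof (cases "h = h'")
      case True
      then show ?thesis using quadrangularD(3)[OF _ assms(1) *] d V by auto
    next
      case False
      then show ?thesis
        using relatorsD(4)[OF R assms(1) * d False] d assms(4) V by (auto intro: queue_ok_push)
    qed
  qed
qed (use assms in simp)

lemma queue_ok_ovF:
  assumes "W a b c d e f g h \<in> R" "a' \<noteq> E0" "v' = look a' b c d T" "queue_ok t R q"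
  shows "queue_ok t R (ovF t a (V e f g h) a' v' q)"
proof (cases v')
  case (V e' f' g' h')
  have nz: "nz (W a b c d e f g h)" using relatorsD(1)[OF R assms(1)] .
  have *: "W a' b c d e' f' g' h' \<in> R" using look_in[of a' b c d e f g h] nz assms V by simp
  show ?thesis
  proof (cases "a = a'")
    case True
    then show ?thesis
      using quadrangularD(4)[OF _ assms(1) *] assms(4) V by (auto simp del: cmp.simps intro!: queue_ok_own)
  next
    case False
    note d = this
    show ?thesis
    proof (cases "e = e'")
      case True
      then show ?thesis using quadrangularD(4)[OF _ assms(1) *] d V by auto
    next
      case False
      then show ?thesis
        using relatorsD(5)[OF R assms(1) * d False] d assms(4) V by (auto intro: queue_ok_push)
    qed
  qed
qed (use assms in simp)

lemma queue_ok_row: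
  assumes w: "W a b c d e f g h \<in> R" and q: "queue_ok t R q"
  shows "queue_ok t R (row t a b c d (V e f g h) T q)"
proof -
  have 1: "queue_ok t R (rowF t a b c d v T q)" if v: "v = V e f g h" for v
  proof -
    obtain x y z where xyz: "T = TE x y z" by (cases T)
    have "rowF t a b c d v T q =
        ovF t a v E3 (look E3 b c d T) (ovF t a v E2 (look E2 b c d T) (ovF t a v E1 (look E1 b c d T) q))"
      by (simp add: look3_def look_def xyz)
    then show ?thesis
      unfolding v by (auto intro!: queue_ok_ovF[OF w] q)
  qed
  obtain x y z u s where row: "getE c (getF b (getE a T)) = TF x y z u s" by (cases "getE c (getF b (getE a T))")
  have "x = look a b c F1 T" "y = look a b c F2 T" "z = look a b c F3 T" "u = look a b c F4 T" "s = look a b c F5 T"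
    by (simp_all add: look_def row)
  then show ?thesis
    unfolding row_def row rowE.simps by (intro queue_ok_ovE[OF w] 1) auto
qed

lemma queue_ok_deduce:
  assumes "w \<in> R" shows "queue_ok t R (deduce t w T)"
proof -
  obtain a b c d e f g h where w: "w = W a b c d e f g h" by (cases w)
  have 1: "W a b c d e f g h \<in> R" using assms w by simp
  have 2: "W c d e f g h a b \<in> R" using relatorsD(3)[OF R 1] .
  have 3: "W e f g h a b c d \<in> R" using relatorsD(3)[OF R 2] .
  have 4: "W g h a b c d e f \<in> R" using relatorsD(3)[OF R 3] .
  show ?thesis
    unfolding w deduce.simps by (intro queue_ok_row 1 2 3 4) simp
qed

end

lemma seek_Diff:
  assumes "quadrangular t R" "tab_ok R T" "w \<in> R" shows "seek w T \<noteq> Diff"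
proof
  assume D: "seek w T = Diff"
  obtain a b c d e f g h where w: "w = W a b c d e f g h" by (cases w)
  have "nz w" using relatorsD(1) quadrangularD(1) assms by blast
  obtain e' f' g' h' where v: "look a b c d T = V e' f' g' h'"
    using D by (cases "look a b c d T") (auto simp: w)
  then have "W a b c d e' f' g' h' \<in> R" using assms(2) \<open>nz w\<close> by (simp add: tab_ok_def w)
  then show False using quadrangularD(3)[OF assms(1), of a b c d e' f' g' h' d e f g h] assms(3) D v by (auto simp: w)
qed

lemma state_ok_absorb:
  shows "relators t R \<Longrightarrow> tab_ok R T \<Longrightarrow> queue_ok t R D \<Longrightarrow> queue_ok t R q \<Longrightarrow> state_ok t R (absorb t D T q)"
    and "relators t R \<Longrightarrow> tab_ok R T \<Longrightarrow> queue_ok t R D \<Longrightarrow> queue_ok t R q \<Longrightarrow> w \<in> R \<Longrightarrow>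
      (s = Diff \<Longrightarrow> \<not> quadrangular t R) \<Longrightarrow> state_ok t R (absorb2 s t w D T q)"
proof (induction t D T q and s t w D T q rule: absorb_absorb2.induct)
  case (3 t w D T q)
  then show ?case using seek_Diff by (auto simp del: seek.simps)
qed (auto intro: tab_ok_ins)

lemma state_ok_run: "relators t R \<Longrightarrow> state_ok t R s \<Longrightarrow> state_ok t R (run n t s)"
proof (induction n t s rule: run.induct)
  case (5 n t T w q)
  then show ?case by (auto intro!: state_ok_absorb queue_ok_deduce)
qed auto

lemma state_ok_start:
  assumes "relators t R" "tab_ok R T" "w \<in> R"
  shows "state_ok t R (run fuel t (absorb t (Push w End) T End))"
  using assms by (intro state_ok_run state_ok_absorb) auto

text \<open>Completions in \<open>R\<close> are unique, so a valid table can only be silent about a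
  relator of \<open>R\<close> or contain that very relator. Every lookup in the generation of
  candidates is decided by this alternative.\<close>

lemma look_cases:
  assumes "quadrangular t R" "tab_ok R T" "W a b c d e f g h \<in> R"
  obtains "look a b c d T = N" | "look a b c d T = V e f g h"
proof -
  have "nz (W a b c d e f g h)" using assms(3) relatorsD(1) quadrangularD(1)[OF assms(1)] by blast
  then have "look a b c d T = V e' f' g' h' \<Longrightarrow> W a b c d e' f' g' h' \<in> R" for e' f' g' h'
    using assms(2) by (simp add: tab_ok_def)
  then show ?thesis
    using that quadrangularD(3)[OF assms(1) _ assms(3), of d] by (cases "look a b c d T") blast+
qed

lemma invE_invE [simp]: "invE t (invE t x) = x" and invF_invF [simp]: "invF t (invF t y) = y"
proof -
  obtain p q where t: "t = Ty p q" by (cases t)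
  show "invE t (invE t x) = x" unfolding t by (cases p; cases x; simp)
  show "invF t (invF t y) = y" unfolding t by (cases q; cases y; simp)
qed

lemma fits_cmp: "u = N \<or> u = v \<Longrightarrow> v \<noteq> N \<Longrightarrow> fits (cmp u v)"
  by (cases v) auto

lemma cnd_in: "p \<Longrightarrow> w \<in> set (cnd p w ws)"
  by simp

lemma cnd_mono: "x \<in> set ws \<Longrightarrow> x \<in> set (cnd p w ws)"
  by (cases p) auto

lemma candH_mono: "x \<in> set ws \<Longrightarrow> x \<in> set (candH t a b c d e f g T h ws)"
  by (simp add: cnd_mono)

lemma candG_mono: "x \<in> set ws \<Longrightarrow> x \<in> set (candG t a b c d e f T g ws)"
  unfolding candG_def
  by (cases "look (invE t g) (invF t f) (invE t e) (invF t d) T")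
    (simp_all add: candH_mono cnd_mono del: candH.simps)

lemma candF_mono: "x \<in> set ws \<Longrightarrow> x \<in> set (candF t a b c d e T f ws)"
  unfolding candF_def by (cases "look c d e f T") (simp_all add: candG_mono cnd_mono)

lemma candE_mono: "x \<in> set ws \<Longrightarrow> x \<in> set (candE t a b c d T e ws)"
  unfolding candE_def
  by (cases "look (invE t e) (invF t d) (invE t c) (invF t b) T") (simp_all add: candF_mono cnd_mono)

context
  fixes t R T a b c d e f g h
  assumes R: "quadrangular t R" and T: "tab_ok R T" and w: "W a b c d e f g h \<in> R"
begin

text \<open>The readings whose first halves are the keys consulted in \<open>candF\<close>, twice in
  \<open>candH\<close>, in \<open>candG\<close> and in \<open>candE\<close>, in this order.\<close>

private lemma rotations:
  "W c d e f g h a b \<in> R" "W e f g h a b c d \<in> R" "W g h a b c d e f \<in> R"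
  "W (invE t g) (invF t f) (invE t e) (invF t d) (invE t c) (invF t b) (invE t a) (invF t h) \<in> R"
  "W (invE t e) (invF t d) (invE t c) (invF t b) (invE t a) (invF t h) (invE t g) (invF t f) \<in> R"
proof -
  note * = relatorsD(2,3)[OF quadrangularD(1)[OF R]]
  show 1: "W c d e f g h a b \<in> R" by (rule *(2)[OF w])
  show 2: "W e f g h a b c d \<in> R" by (rule *(2)[OF 1])
  show 3: "W g h a b c d e f \<in> R" by (rule *(2)[OF 2])
  show 4: "W (invE t g) (invF t f) (invE t e) (invF t d) (invE t c) (invF t b) (invE t a) (invF t h) \<in> R"
    using *(1)[OF w] by simp
  show "W (invE t e) (invF t d) (invE t c) (invF t b) (invE t a) (invF t h) (invE t g) (invF t f) \<in> R"
    by (rule *(2)[OF 4])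
qed

private lemma letters: "e \<noteq> E0" "f \<noteq> F0" "g \<noteq> E0" "h \<noteq> F0"
  using relatorsD(1)[OF quadrangularD(1)[OF R] w] by simp_all

lemma candH_in: "W a b c d e f g h \<in> set (candH t a b c d e f g T h ws)"
proof -
  have "fits (cmp (look e f g h T) (V a b c d))" "fits (cmp (look g h a b T) (V c d e f))"
    by (rule look_cases[OF R T rotations(2)]; simp add: fits_cmp)
      (rule look_cases[OF R T rotations(3)]; simp add: fits_cmp)
  then show ?thesis by (auto intro: cnd_in)
qed

lemma candG_in: "W a b c d e f g h \<in> set (candG t a b c d e f T g ws)"
proof (rule look_cases[OF R T rotations(4)])
  assume N: "look (invE t g) (invF t f) (invE t e) (invF t d) T = N"
  have "\<And>ws. W a b c d e f g h \<in> set (candH t a b c d e f g T h ws)" by (rule candH_in)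
  then show ?thesis
    using letters(4) unfolding candG_def N candG2.simps
    by (cases h) (simp_all add: candH_mono del: candH.simps)
qed (auto simp: candG_def intro: cnd_in)

lemma candF_in: "W a b c d e f g h \<in> set (candF t a b c d e T f ws)"
proof (rule look_cases[OF R T rotations(1)])
  assume N: "look c d e f T = N"
  have "\<And>ws. W a b c d e f g h \<in> set (candG t a b c d e f T g ws)" by (rule candG_in)
  then show ?thesis
    using letters(3) unfolding candF_def N candF2.simps by (cases g) (simp_all add: candG_mono)
qed (auto simp: candF_def intro: cnd_in)

lemma candE_in: "W a b c d e f g h \<in> set (candE t a b c d T e ws)"
proof (rule look_cases[OF R T rotations(5)])
  assume N: "look (invE t e) (invF t d) (invE t c) (invF t b) T = N"
  have "\<And>ws. W a b c d e f g h \<in> set (candF t a b c d e T f ws)" by (rule candF_in)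
  then show ?thesis
    using letters(2) unfolding candE_def N candE2.simps by (cases f) (simp_all add: candF_mono)
qed (auto simp: candE_def intro: cnd_in)

text \<open>Completeness of the split in \<open>Br\<close>: letters are guessed one at a time, one
  choice always follows the relator, and by \<open>look_cases\<close> no lookup on the way can
  discard it.\<close>

lemma cands_in: "W a b c d e f g h \<in> set (cands t a b c d T)"
proof -
  have "\<And>ws. W a b c d e f g h \<in> set (candE t a b c d T e ws)" by (rule candE_in)
  then show ?thesis
    using letters(1) unfolding cands_def by (cases e) (simp_all add: candE_mono)
qed

end

text \<open>The inverse image of \<open>R\<close> under a change of coordinates. For the relators of
  a group these are the relators with respect to the identifications composed with the
  automorphisms, see \<open>quadrangle_twist\<close>.\<close>

definition twist :: "ee te \<Rightarrow> ff tf \<Rightarrow> wd set \<Rightarrow> wd set" where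
  "twist x y R = {w. nz w \<and> mapW x y w \<in> R}"

lemma all_in_twist:
  assumes "quadrangular t R" "tab_ok R T" "all_in ws x y T" "\<forall>w \<in> set ws. nz w \<and> nz (mapW x y w)"
  shows "set ws \<subseteq> twist x y R"
  using assms(3,4)
proof (induction ws)
  case (Cons w ws)
  obtain a b c d e f g h where m: "mapW x y w = W a b c d e f g h" by (cases "mapW x y w")
  have "seek (mapW x y w) T = Old"
    using Cons.prems(1) by (cases "seek (mapW x y w) T") auto
  then have "look a b c d T = V e f g h"
    unfolding m by (cases "look a b c d T") (auto simp: verdict_iff)
  then have "mapW x y w \<in> R"
    using assms(2) Cons.prems(2) unfolding m by (auto simp: tab_ok_def m)
  then show ?case using Cons by (auto simp: twist_def)
qed simp

text \<open>The goal \<open>C\<close> is left open; in the application it says that the group is one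
  of the \<open>L i\<close>. The assumption \<open>base\<close> is the recognition of a group from
  its relators, and \<open>root\<close> carries the induction hypothesis for the earlier
  roots.\<close>

locale search =
  fixes t :: ty and \<R> :: "wd set set" and C :: bool and m :: nat
  assumes quad: "R \<in> \<R> \<Longrightarrow> quadrangular t R"
    and twist: "R \<in> \<R> \<Longrightarrow> x \<in> set (fst (auts t)) \<Longrightarrow> y \<in> set (snd (auts t)) \<Longrightarrow> twist x y R \<in> \<R>"
    and base: "R \<in> \<R> \<Longrightarrow> k < length (bases t) \<Longrightarrow> set (bases t ! k) \<subseteq> R \<Longrightarrow> C"
    and root: "R \<in> \<R> \<Longrightarrow> k < m \<Longrightarrow> roots t ! k \<in> R \<Longrightarrow> C"
    and m: "m \<le> length (roots t)"
begin

lemma nz_mapW: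
  assumes "x \<in> set (fst (auts t))" "y \<in> set (snd (auts t))" "nz w"
  shows "nz (mapW x y w)"
proof -
  obtain p q where t: "t = Ty p q" by (cases t)
  have "getE a x \<noteq> E0" if "a \<noteq> E0" for a
    using assms(1) that unfolding t by (cases a) (auto split: if_splits)
  moreover have "getF b y \<noteq> F0" if "b \<noteq> F0" for b
    using assms(2) that unfolding t by (cases b) (auto split: if_splits)
  ultimately show ?thesis using assms(3) by (cases w) auto
qed

lemma found_twist:
  assumes "R \<in> \<R>" "tab_ok R T" "found t j l ws T" "\<forall>w \<in> set ws. nz w"
  obtains x y where "twist x y R \<in> \<R>" "set ws \<subseteq> twist x y R"
proof
  let ?x = "fst (auts t) ! j" and ?y = "snd (auts t) ! l"
  have xy: "?x \<in> set (fst (auts t))" "?y \<in> set (snd (auts t))"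
    using assms(3) by (auto simp: found_def simp del: auts.simps)
  show "twist ?x ?y R \<in> \<R>" by (rule twist[OF assms(1) xy])
  show "set ws \<subseteq> twist ?x ?y R"
    using assms(3,4) nz_mapW[OF xy] all_in_twist[OF quad[OF assms(1)] assms(2)] by (auto simp: found_def simp del: auts.simps)
qed

lemma nz_bases: "k < length (bases t) \<Longrightarrow> \<forall>w \<in> set (bases t ! k). nz w"
  and nz_roots: "k < length (roots t) \<Longrightarrow> nz (roots t ! k)"
proof -
  obtain p q where t: "t = Ty p q" by (cases t)
  have "\<forall>ws \<in> set (bases t). \<forall>w \<in> set ws. nz w" unfolding t by (cases p; cases q; simp)
  then show "k < length (bases t) \<Longrightarrow> \<forall>w \<in> set (bases t ! k). nz w" using nth_mem by blast
  have "\<forall>w \<in> set (roots t). nz w" unfolding t by (cases p; cases q; simp)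
  then show "k < length (roots t) \<Longrightarrow> nz (roots t ! k)" using nth_mem by blast
qed

text \<open>In the clause for \<open>kid\<close> the disjunction locates the relator of
  \<open>R\<close>: it is among the remaining candidates, or it is the one just inserted, and then
  the computed state is valid. For \<open>Bad\<close> the second case is impossible, as
  \<open>R\<close> is quadrangular. The variables \<open>n\<close> and \<open>s\<close> stand for
  the fixed \<open>m\<close> and \<open>t\<close> because the induction rule of the functions varies
  them.\<close>

lemma check_sound:
  shows "n = m \<Longrightarrow> s = t \<Longrightarrow> check n s c T \<Longrightarrow> R \<in> \<R> \<Longrightarrow> tab_ok R T \<Longrightarrow> C"
    and "n = m \<Longrightarrow> s = t \<Longrightarrow> kids n s ws cs T \<Longrightarrow> R \<in> \<R> \<Longrightarrow> tab_ok R T \<Longrightarrow> \<exists>w \<in> set ws. w \<in> R \<Longrightarrow> C"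
    and "n = m \<Longrightarrow> s = t \<Longrightarrow> kid st n s ws cs T \<Longrightarrow> R \<in> \<R> \<Longrightarrow> tab_ok R T \<Longrightarrow>
      (\<exists>w \<in> set ws. w \<in> R) \<or> state_ok t R st \<Longrightarrow> C"
proof (induction n s c T and n s ws cs T and st n s ws cs T rule: check_kids_kid.induct)
  case (1 n s k j l T)
  then show ?case
    using nz_bases[of k] by (auto elim!: found_twist[of R T j l "bases t ! k"] intro: base simp del: bases.simps)
next
  case (2 n s k j l T)
  then show ?case
    using nz_roots[of k] m by (auto elim!: found_twist[of R T j l "[roots t ! k]"] intro: root simp del: roots.simps)
next
  case (3 n s a b c d cs T)
  from 3 have nz: "a \<noteq> E0" "b \<noteq> F0" "c \<noteq> E0" "d \<noteq> F0" and *: "kids n s (cands s a b c d T) cs T" by auto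
  from quadrangularD(2)[OF quad[OF 3(5)] nz] obtain e f g h where w: "W a b c d e f g h \<in> R" by blast
  show ?case
    using 3(1)[OF 3(2,3) * 3(5,6)] cands_in[OF quad[OF 3(5)] 3(6) w] 3(3) w by blast
next
  case (5 n s w' ws cs T)
  then show ?case
    using state_ok_start[OF quadrangularD(1)[OF quad]] by (auto simp del: kid.simps)
next
  case (6 n s ws cs T)
  then show ?case using quad by auto
qed (auto simp del: check.simps)

end

section \<open>Amalgams of two finite groups\<close>

datatype sy = SE ee | SF ff

text \<open>Left multiplication by a syllable on reduced words of the free product of the two model
  groups.\<close>

fun cons :: "ty \<Rightarrow> sy \<Rightarrow> sy list \<Rightarrow> sy list" where
  "cons t (SE x) (SE y # s) = (if mulE t x y = E0 then s else SE (mulE t x y) # s)"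
| "cons t (SF x) (SF y # s) = (if mulF t x y = F0 then s else SF (mulF t x y) # s)"
| "cons t (SE x) s = (if x = E0 then s else SE x # s)"
| "cons t (SF x) s = (if x = F0 then s else SF x # s)"

fun is_SE :: "sy \<Rightarrow> bool" where "is_SE (SE x) = True" | "is_SE (SF y) = False"
fun nonunit :: "sy \<Rightarrow> bool" where "nonunit (SE x) = (x \<noteq> E0)" | "nonunit (SF y) = (y \<noteq> F0)"

definition alt :: "sy list \<Rightarrow> bool" where
  "alt s \<longleftrightarrow> (\<forall>x \<in> set s. nonunit x) \<and> successively (\<lambda>x y. is_SE x \<noteq> is_SE y) s"

fun syinv :: "ty \<Rightarrow> sy \<Rightarrow> sy" where
  "syinv t (SE x) = SE (invE t x)" | "syinv t (SF y) = SF (invF t y)"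

lemma alt_Nil [simp]: "alt []" by (simp add: alt_def)

lemma alt_Cons: "alt (x # s) \<longleftrightarrow> nonunit x \<and> (s = [] \<or> is_SE x \<noteq> is_SE (hd s)) \<and> alt s"
  by (cases s) (auto simp: alt_def)

lemma alt_append: "alt (s @ u) \<longleftrightarrow> alt s \<and> alt u \<and> (s = [] \<or> u = [] \<or> is_SE (last s) \<noteq> is_SE (hd u))"
  by (auto simp: alt_def successively_append_iff)

lemma invE_eq_E0 [simp]: "invE t x = E0 \<longleftrightarrow> x = E0" and invF_eq_F0 [simp]: "invF t y = F0 \<longleftrightarrow> y = F0"
proof -
  obtain p q where t: "t = Ty p q" by (cases t)
  show "invE t x = E0 \<longleftrightarrow> x = E0" unfolding t by (cases p; cases x; simp)
  show "invF t y = F0 \<longleftrightarrow> y = F0" unfolding t by (cases q; cases y; simp)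
qed

lemma invE_inject [simp]: "invE t x = invE t y \<longleftrightarrow> x = y" and invF_inject [simp]: "invF t u = invF t v \<longleftrightarrow> u = v"
  by (metis invE_invE) (metis invF_invF)

lemma mulE_eq_E0: "mulE t x y = E0 \<longleftrightarrow> x = invE t y" and mulF_eq_F0: "mulF t u v = F0 \<longleftrightarrow> u = invF t v"
proof -
  obtain p q where t: "t = Ty p q" by (cases t)
  show "mulE t x y = E0 \<longleftrightarrow> x = invE t y" unfolding t by (cases p; cases x; cases y; simp)
  show "mulF t u v = F0 \<longleftrightarrow> u = invF t v" unfolding t by (cases q; cases u; cases v; simp)
qed

lemma mulE_E0 [simp]: "mulE t E0 x = x" "mulE t x E0 = x" and mulF_F0 [simp]: "mulF t F0 y = y" "mulF t y F0 = y"
proof -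
  obtain p q where t: "t = Ty p q" by (cases t)
  show "mulE t E0 x = x" "mulE t x E0 = x" unfolding t by (cases p; cases x; simp)+
  show "mulF t F0 y = y" "mulF t y F0 = y" unfolding t by (cases q; cases y; simp)+
qed

lemma nonunit_syinv [simp]: "nonunit (syinv t x) \<longleftrightarrow> nonunit x" and is_SE_syinv [simp]: "is_SE (syinv t x) \<longleftrightarrow> is_SE x"
  by (cases x; simp)+

lemma alt_inverse: "alt s \<Longrightarrow> alt (rev (map (syinv t) s))"
  by (induction s) (auto simp: alt_Cons alt_append last_rev hd_map)

lemma alt_cons: "alt s \<Longrightarrow> alt (cons t x s)"
  by (cases s; cases x; cases "hd s") (auto simp: alt_Cons)

lemma length_cons: "length (cons t x s) \<le> Suc (length s)"
  by (cases s; cases x; cases "hd s") auto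

fun sylls :: "wd \<Rightarrow> sy list" where
  "sylls (W a b c d e f g h) = [SE a, SF b, SE c, SF d, SE e, SF f, SE g, SF h]"

text \<open>The maps are homomorphisms, not embeddings: the groups \<open>L i\<close> are studied in
  this locale before the orders of their two subgroups are known.\<close>

locale amalgam = group H for H (structure) +
  fixes t :: ty and \<epsilon> :: "ee \<Rightarrow> 'a" and \<phi> :: "ff \<Rightarrow> 'a"
  assumes E_closed [simp]: "\<epsilon> x \<in> carrier H" and F_closed [simp]: "\<phi> y \<in> carrier H"
    and E_mult: "\<epsilon> (mulE t x x') = \<epsilon> x \<otimes> \<epsilon> x'"
    and F_mult: "\<phi> (mulF t y y') = \<phi> y \<otimes> \<phi> y'"
begin

fun val :: "sy \<Rightarrow> 'a" where "val (SE x) = \<epsilon> x" | "val (SF y) = \<phi> y"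

fun evalS :: "sy list \<Rightarrow> 'a" where "evalS [] = \<one>" | "evalS (x # s) = val x \<otimes> evalS s"

lemma E_one [simp]: "\<epsilon> E0 = \<one>"
  using E_mult[of E0 E0] by (simp add: l_cancel_one')

lemma F_one [simp]: "\<phi> F0 = \<one>"
  using F_mult[of F0 F0] by (simp add: l_cancel_one')

lemma E_inv: "\<epsilon> (invE t x) = inv \<epsilon> x"
  using E_mult[of "invE t x" x] by (intro inv_equality[symmetric]) (auto simp: mulE_eq_E0[THEN iffD2])

lemma F_inv: "\<phi> (invF t y) = inv \<phi> y"
  using F_mult[of "invF t y" y] by (intro inv_equality[symmetric]) (auto simp: mulF_eq_F0[THEN iffD2])

lemma val_closed [simp]: "val x \<in> carrier H" by (cases x) auto
lemma evalS_closed [simp]: "evalS s \<in> carrier H" by (induction s) auto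
lemma val_inv: "val (syinv t x) = inv val x" by (cases x) (auto simp: E_inv F_inv)

lemma evalS_append: "evalS (s @ u) = evalS s \<otimes> evalS u"
  by (induction s) (auto simp: m_assoc)

lemma evalS_inverse: "evalS (rev (map (syinv t) s)) = inv evalS s"
  by (induction s) (auto simp: evalS_append val_inv inv_mult_group)

lemma evalS_cons: "evalS (cons t x s) = val x \<otimes> evalS s"
proof (cases "\<exists>a b u. x = SE a \<and> s = SE b # u \<or> (\<exists>a' b'. x = SF a' \<and> s = SF b' # u)")
  case True
  then show ?thesis
    using E_mult F_mult E_one F_one
    by (auto simp: m_assoc[symmetric] simp flip: E_mult F_mult)
next
  case False
  then show ?thesis by (cases x; cases s; cases "hd s") auto
qed

lemma rotate_eq_one: "x \<in> carrier H \<Longrightarrow> y \<in> carrier H \<Longrightarrow> x \<otimes> y = \<one> \<longleftrightarrow> y \<otimes> x = \<one>"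
  by (metis inv_equality r_inv l_inv)

definition Rel :: "wd set" where "Rel = {w. nz w \<and> evalS (sylls w) = \<one>}"

lemma left_one_unique:
  assumes "x \<in> carrier H" "u \<in> carrier H" "v \<in> carrier H" "x \<otimes> u = \<one>" "x \<otimes> v = \<one>"
  shows "u = v"
proof -
  have "u \<otimes> x = \<one>" "v \<otimes> x = \<one>"
    using assms rotate_eq_one[of x u] rotate_eq_one[of x v] by simp_all
  then have "inv x = u" "inv x = v" using assms(1-3) by - (rule inv_equality; assumption)+
  then show ?thesis by simp
qed

lemma cancel_inv: "x \<in> carrier H \<Longrightarrow> y \<in> carrier H \<Longrightarrow> x \<otimes> (inv x \<otimes> y) = y"
  by (simp add: m_assoc[symmetric])

lemma cancel_inv': "x \<in> carrier H \<Longrightarrow> y \<in> carrier H \<Longrightarrow> inv x \<otimes> (x \<otimes> y) = y"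
  by (simp add: m_assoc[symmetric])

text \<open>Both \<open>d u h\<close> and \<open>d' u' h'\<close> are the inverse of
  \<open>x\<close>; equating them and conjugating by \<open>d\<close> gives the relation. With
  arbitrary elements in place of syllables, the computation serves both kinds of overlap.\<close>

lemma overlap:
  assumes c: "x \<in> carrier H" "d \<in> carrier H" "u \<in> carrier H" "h \<in> carrier H" "d' \<in> carrier H" "u' \<in> carrier H" "h' \<in> carrier H"
    and 1: "x \<otimes> (d \<otimes> (u \<otimes> h)) = \<one>" and 2: "x \<otimes> (d' \<otimes> (u' \<otimes> h')) = \<one>"
  shows "u \<otimes> ((h \<otimes> inv h') \<otimes> (inv u' \<otimes> (inv d' \<otimes> d))) = \<one>"
proof -
  have "d \<otimes> (u \<otimes> h) = d' \<otimes> (u' \<otimes> h')"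
    using 1 2 c by (metis inv_equality inv_inv m_closed rotate_eq_one)
  then have "u \<otimes> h = inv d \<otimes> (d' \<otimes> (u' \<otimes> h'))"
    using c by (metis inv_solve_left m_closed)
  then have "u \<otimes> ((h \<otimes> inv h') \<otimes> (inv u' \<otimes> (inv d' \<otimes> d))) =
      inv d \<otimes> (d' \<otimes> (u' \<otimes> h')) \<otimes> (inv h' \<otimes> (inv u' \<otimes> (inv d' \<otimes> d)))"
    using c by (simp add: m_assoc[symmetric])
  also have "\<dots> = \<one>"
    using c by (simp add: m_assoc cancel_inv)
  finally show ?thesis .
qed

text \<open>Only rotation, inversion and cancellation in a group are involved. The conditions that
  letters differ guarantee that the two merged letters of the new word are nonunits.\<close>

lemma relators_Rel: "relators t Rel"
  unfolding relators_def
proof (intro conjI ballI allI impI)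
  show "nz w" if "w \<in> Rel" for w using that by (simp add: Rel_def)
  show rot: "W c d e f g h a b \<in> Rel" if "W a b c d e f g h \<in> Rel" for a b c d e f g h
  proof -
    have "evalS ([SE a, SF b] @ [SE c, SF d, SE e, SF f, SE g, SF h]) = \<one>" using that by (simp add: Rel_def)
    then have "evalS ([SE c, SF d, SE e, SF f, SE g, SF h] @ [SE a, SF b]) = \<one>"
      unfolding evalS_append by (subst rotate_eq_one) auto
    then show ?thesis using that by (simp add: Rel_def)
  qed
  show "invW t w \<in> Rel" if "w \<in> Rel" for w
  proof -
    obtain a b c d e f g h where w: "w = W a b c d e f g h" by (cases w)
    have "evalS (rev (map (syinv t) (sylls w))) = \<one>" using that by (simp add: evalS_inverse Rel_def)
    then have "evalS ([SF (invF t h)] @ [SE (invE t g), SF (invF t f), SE (invE t e), SF (invF t d),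
        SE (invE t c), SF (invF t b), SE (invE t a)]) = \<one>"
      by (simp add: w)
    then have "evalS ([SE (invE t g), SF (invF t f), SE (invE t e), SF (invF t d),
        SE (invE t c), SF (invF t b), SE (invE t a)] @ [SF (invF t h)]) = \<one>"
      unfolding evalS_append by (subst rotate_eq_one) auto
    then show ?thesis using that by (simp add: Rel_def w)
  qed
  show "W e f g (mulF t h (invF t h')) (invE t g') (invF t f') (invE t e') (mulF t (invF t d') d) \<in> Rel"
    if 1: "W a b c d e f g h \<in> Rel" and 2: "W a b c d' e' f' g' h' \<in> Rel" and ne: "d \<noteq> d'" "h \<noteq> h'"
    for a b c d e f g h d' e' f' g' h'
  proof -
    have "evalS [SE e, SF f, SE g] \<otimes> ((\<phi> h \<otimes> inv \<phi> h') \<otimes> (inv evalS [SE e', SF f', SE g'] \<otimes> (inv \<phi> d' \<otimes> \<phi> d))) = \<one>"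
      by (rule overlap[of "evalS [SE a, SF b, SE c]"]) (use 1 2 in \<open>auto simp: Rel_def m_assoc\<close>)
    then have "evalS (sylls (W e f g (mulF t h (invF t h')) (invE t g') (invF t f') (invE t e') (mulF t (invF t d') d))) = \<one>"
      unfolding evalS_inverse[symmetric] by (simp add: m_assoc F_mult F_inv)
    then show ?thesis using 1 2 ne by (auto simp: Rel_def mulF_eq_F0)
  qed
  show "W (mulE t (invE t e) e') f' g' h' (mulE t a' (invE t a)) (invF t h) (invE t g) (invF t f) \<in> Rel"
    if 1: "W a b c d e f g h \<in> Rel" and 2: "W a' b c d e' f' g' h' \<in> Rel" and ne: "a \<noteq> a'" "e \<noteq> e'"
    for a b c d e f g h a' e' f' g' h'
  proof -
    \<comment> \<open>A common middle part \<open>b c d\<close> becomes a common prefix when the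
      leading letter is rotated to the end; \<open>overlap\<close> then applies as before.\<close>
    have *: "evalS [SF b, SE c, SF d] \<otimes> (\<epsilon> x \<otimes> (evalS [SF k, SE l, SF m] \<otimes> \<epsilon> y)) = \<one>"
      if "W y b c d x k l m \<in> Rel" for x y k l m
    proof -
      have "evalS ([SE y] @ [SF b, SE c, SF d, SE x, SF k, SE l, SF m]) = \<one>" using that by (simp add: Rel_def)
      then have "evalS ([SF b, SE c, SF d, SE x, SF k, SE l, SF m] @ [SE y]) = \<one>"
        unfolding evalS_append by (subst rotate_eq_one) auto
      then show ?thesis by (simp add: m_assoc)
    qed
    have "evalS [SF f', SE g', SF h'] \<otimes> ((\<epsilon> a' \<otimes> inv \<epsilon> a) \<otimes> (inv evalS [SF f, SE g, SF h] \<otimes> (inv \<epsilon> e \<otimes> \<epsilon> e'))) = \<one>"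
      by (rule overlap[OF _ _ _ _ _ _ _ *[OF 2] *[OF 1]]) auto
    then have "evalS ([SF f', SE g', SF h', SE (mulE t a' (invE t a)), SF (invF t h), SE (invE t g), SF (invF t f)] @ [SE (mulE t (invE t e) e')]) = \<one>"
      unfolding evalS_inverse[symmetric] by (simp add: m_assoc E_mult E_inv)
    then have "evalS ([SE (mulE t (invE t e) e')] @ [SF f', SE g', SF h', SE (mulE t a' (invE t a)), SF (invF t h), SE (invE t g), SF (invF t f)]) = \<one>"
      unfolding evalS_append by (subst rotate_eq_one) auto
    then show ?thesis using 1 2 ne by (auto simp: Rel_def mulE_eq_E0)
  qed
qed

lemma Rel_eq:
  "nz (W a b c d e f g h) \<Longrightarrow> W a b c d e f g h \<in> Rel \<longleftrightarrow>
    evalS [SE a, SF b, SE c, SF d] = evalS [SF (invF t h), SE (invE t g), SF (invF t f), SE (invE t e)]"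
proof -
  assume nz: "nz (W a b c d e f g h)"
  let ?u = "evalS [SE a, SF b, SE c, SF d]" and ?v = "evalS [SE e, SF f, SE g, SF h]"
  have "evalS [SF (invF t h), SE (invE t g), SF (invF t f), SE (invE t e)] = inv ?v"
    using evalS_inverse[of "[SE e, SF f, SE g, SF h]"] by simp
  moreover have "evalS (sylls (W a b c d e f g h)) = ?u \<otimes> ?v"
    using evalS_append[of "[SE a, SF b, SE c, SF d]" "[SE e, SF f, SE g, SF h]"] by simp
  moreover have "?u \<otimes> ?v = \<one> \<longleftrightarrow> ?u = inv ?v"
    by (metis evalS_closed inv_equality inv_closed l_inv)
  ultimately show ?thesis using nz by (simp add: Rel_def del: evalS.simps sylls.simps)
qed

end

text \<open>The two conditions say that the coset graph has diameter 4 and girth 8.\<close>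

locale quadrangle_amalgam = amalgam +
  assumes cover: "x \<in> carrier H \<Longrightarrow> \<exists>f e f' e'. x = \<phi> f \<otimes> \<epsilon> e \<otimes> \<phi> f' \<otimes> \<epsilon> e'"
    and girth: "alt s \<Longrightarrow> s \<noteq> [] \<Longrightarrow> length s \<le> 7 \<Longrightarrow> evalS s \<noteq> \<one>"
begin

text \<open>After removal of the common prefix the first syllables differ. The inverse of one word
  followed by the other is then alternating, if need be after merging the two first syllables into
  one nontrivial syllable, and it has at most seven letters and value one.\<close>

lemma alt_unique:
  assumes "alt s" "alt u" "length s + length u \<le> 7" "evalS s = evalS u"
  shows "s = u"
  using assms
proof (induction s arbitrary: u)
  case Nil
  then show ?case using girth[of u] by auto
next
  case (Cons x s)
  have *: "evalS (rev (map (syinv t) (x # s)) @ u) = \<one>"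
    using Cons.prems(4) by (simp only: evalS_append evalS_inverse) simp
  show ?case
  proof (cases u)
    case Nil
    then show ?thesis using girth[of "x # s"] Cons.prems by auto
  next
    case (Cons y u')
    note u = this
    show ?thesis
    proof (cases "is_SE x = is_SE y")
      case False
      have "alt (rev (map (syinv t) (x # s)) @ u)"
        using alt_inverse[OF Cons.prems(1), of t] Cons.prems(2) False by (auto simp: alt_append alt_Cons u)
      then show ?thesis using girth[OF _ _ _] * Cons.prems(3) u by fastforce
    next
      case True
      show ?thesis
      proof (cases "x = y")
        case True
        then have "evalS s = evalS u'" using Cons.prems(4) u by simp
        then show ?thesis using Cons.IH[of u'] Cons.prems True u by (auto simp: alt_Cons)
      next
        case False
        obtain z where z: "val z = inv val x \<otimes> val y" "nonunit z" "is_SE z = is_SE y"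
        proof (cases x)
          case (SE a)
          then obtain b where "y = SE b" using True by (cases y) auto
          then show ?thesis
            using that[of "SE (mulE t (invE t a) b)"] SE False by (auto simp: E_mult E_inv mulE_eq_E0 dest: arg_cong[of _ _ "invE t"])
        next
          case (SF a)
          then obtain b where "y = SF b" using True by (cases y) auto
          then show ?thesis
            using that[of "SF (mulF t (invF t a) b)"] SF False by (auto simp: F_mult F_inv mulF_eq_F0 dest: arg_cong[of _ _ "invF t"])
        qed
        let ?w = "rev (map (syinv t) s) @ z # u'"
        have "alt s" using Cons.prems(1) by (simp add: alt_Cons)
        have "alt ?w"
          using alt_inverse[OF \<open>alt s\<close>, of t] Cons.prems(1,2) z(2,3) True
          by (auto simp: alt_append alt_Cons u last_rev hd_map)
        moreover have "evalS ?w = \<one>"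
          using * z(1) by (simp add: u evalS_append m_assoc val_inv)
        ultimately show ?thesis using girth[of ?w] Cons.prems(3) u by simp
      qed
    qed
  qed
qed

lemma quadrangular_Rel: "quadrangular t Rel"
proof -
  have ex: "\<exists>e f g h. W a b c d e f g h \<in> Rel" if nz: "a \<noteq> E0" "b \<noteq> F0" "c \<noteq> E0" "d \<noteq> F0" for a b c d
  proof -
    obtain f e f' e' where "evalS [SE a, SF b, SE c, SF d] = \<phi> f \<otimes> \<epsilon> e \<otimes> \<phi> f' \<otimes> \<epsilon> e'"
      using cover[of "evalS [SE a, SF b, SE c, SF d]"] by auto
    then have 1: "evalS [SE a, SF b, SE c, SF d] = evalS [SF f, SE e, SF f', SE e']"
      by (simp add: m_assoc)
    let ?s = "cons t (SF f) (cons t (SE e) (cons t (SF f') (cons t (SE e') [])))"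
    have 2: "evalS [SE a, SF b, SE c, SF d] = evalS ?s"
      unfolding 1 evalS_cons by simp
    have alt: "alt [SE a, SF b, SE c, SF d]" using nz by (simp add: alt_Cons)
    \<comment> \<open>A unit among the four letters would shorten the reduced word to at most three
      syllables, and 4 + 3 is just within the bound of \<open>alt_unique\<close>.\<close>
    have nz': "f \<noteq> F0 \<and> e \<noteq> E0 \<and> f' \<noteq> F0 \<and> e' \<noteq> E0"
    proof (rule ccontr)
      assume *: "\<not> ?thesis"
      have zero: "length (cons t (SF F0) s) \<le> length s" "length (cons t (SE E0) s) \<le> length s" for s
        by (cases s; cases "hd s"; simp)+
      have "length ?s \<le> 3"
        using * zero(1)[of "cons t (SE e) (cons t (SF f') (cons t (SE e') []))"]
          zero(2)[of "cons t (SF f') (cons t (SE e') [])"] zero(1)[of "cons t (SE e') []"] zero(2)[of "[]"]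
          length_cons[of t "SF f" "cons t (SE e) (cons t (SF f') (cons t (SE e') []))"]
          length_cons[of t "SE e" "cons t (SF f') (cons t (SE e') [])"]
          length_cons[of t "SF f'" "cons t (SE e') []"] length_cons[of t "SE e'" "[]"]
        by (elim disjE[of "f = F0"] disjE[of "e = E0"] disjE[of "f' = F0"] disjE[of "e' = E0"] | auto)
      then have "[SE a, SF b, SE c, SF d] = ?s"
        by (intro alt_unique[OF alt _ _ 2] alt_cons) auto
      then have "length [SE a, SF b, SE c, SF d] = length ?s" by (rule arg_cong)
      then show False using \<open>length ?s \<le> 3\<close> by simp
    qed
    have "W a b c d (invE t e') (invF t f') (invE t e) (invF t f) \<in> Rel"
      using 1 nz nz' by (subst Rel_eq) auto
    then show ?thesis by blast
  qed
  have main: "e = e' \<and> f = f' \<and> g = g' \<and> h = h'"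
    if 1: "W a b c d e f g h \<in> Rel" and 2: "W a b c d e' f' g' h' \<in> Rel" for a b c d e f g h e' f' g' h'
  proof -
    have nz: "nz (W a b c d e f g h)" "nz (W a b c d e' f' g' h')"
      using 1 2 by (simp_all add: Rel_def)
    have "inv evalS [SF (invF t h), SE (invE t g), SF (invF t f), SE (invE t e)] =
        inv evalS [SF (invF t h'), SE (invE t g'), SF (invF t f'), SE (invE t e')]"
      using 1 2 Rel_eq[OF nz(1)] Rel_eq[OF nz(2)] by simp
    then have *: "evalS [SE e, SF f, SE g, SF h] = evalS [SE e', SF f', SE g', SF h']"
      unfolding evalS_inverse[symmetric] by simp
    \<comment> \<open>Two words with four letters each exceed the bound of
      \<open>alt_unique\<close>; moving \<open>h'\<close> to the other side leaves four against
      three. The same device is used in \<open>uniqE\<close> and \<open>uniqF\<close>.\<close>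
    have **: "evalS [SE e, SF f, SE g, SF (mulF t h (invF t h'))] = evalS [SE e', SF f', SE g']"
    proof -
      have "evalS [SE e, SF f, SE g, SF (mulF t h (invF t h'))] = evalS [SE e, SF f, SE g, SF h] \<otimes> inv \<phi> h'"
        by (simp add: m_assoc F_mult F_inv)
      also have "\<dots> = evalS [SE e', SF f', SE g']" unfolding * by (simp add: m_assoc)
      finally show ?thesis .
    qed
    have h: "h = h'"
    proof (rule ccontr)
      assume "h \<noteq> h'"
      then have "[SE e, SF f, SE g, SF (mulF t h (invF t h'))] = [SE e', SF f', SE g']"
        using nz by (intro alt_unique[OF _ _ _ **]) (auto simp: alt_Cons mulF_eq_F0)
      then show False by simp
    qed
    then have "evalS [SE e, SF f, SE g] = evalS [SE e', SF f', SE g']"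
      using ** by (simp add: mulF_eq_F0[THEN iffD2])
    then have "[SE e, SF f, SE g] = [SE e', SF f', SE g']"
      using nz by (intro alt_unique) (auto simp: alt_Cons)
    then show ?thesis using h by simp
  qed
  have uniqE: "d = d' \<and> e = e' \<and> f = f' \<and> g = g' \<and> h = h'"
    if "W a b c d e f g h \<in> Rel" "W a b c d' e' f' g' h' \<in> Rel" "d = d' \<or> h = h'"
    for a b c d e f g h d' e' f' g' h'
  proof (cases "d = d'")
    case True
    then show ?thesis using main that by blast
  next
    case False
    have h: "h = h'" using that(3) False by simp
    have "evalS [SE a, SF b, SE c] \<otimes> (\<phi> d \<otimes> evalS [SE e, SF f, SE g] \<otimes> \<phi> h) = \<one>"
      "evalS [SE a, SF b, SE c] \<otimes> (\<phi> d' \<otimes> evalS [SE e', SF f', SE g'] \<otimes> \<phi> h) = \<one>"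
      using that(1,2) h by (simp_all add: Rel_def m_assoc)
    then have "\<phi> d \<otimes> evalS [SE e, SF f, SE g] \<otimes> \<phi> h = \<phi> d' \<otimes> evalS [SE e', SF f', SE g'] \<otimes> \<phi> h"
      by (rule left_one_unique[of "evalS [SE a, SF b, SE c]", rotated -2])
        (simp_all only: m_closed evalS_closed F_closed)
    then have eq: "\<phi> d \<otimes> evalS [SE e, SF f, SE g] = \<phi> d' \<otimes> evalS [SE e', SF f', SE g']"
      by (subst (asm) right_cancel) auto
    have "inv \<phi> d' \<otimes> (\<phi> d \<otimes> evalS [SE e, SF f, SE g]) = evalS [SE e', SF f', SE g']"
      unfolding eq by (rule cancel_inv') auto
    then have "evalS [SF (mulF t (invF t d') d), SE e, SF f, SE g] = evalS [SE e', SF f', SE g']"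
      by (simp add: F_mult F_inv m_assoc)
    then have "[SF (mulF t (invF t d') d), SE e, SF f, SE g] = [SE e', SF f', SE g']"
      using that(1,2) False by (intro alt_unique) (auto simp: alt_Cons Rel_def mulF_eq_F0)
    then show ?thesis by simp
  qed
  have uniqF: "a = a' \<and> e = e' \<and> f = f' \<and> g = g' \<and> h = h'"
    if "W a b c d e f g h \<in> Rel" "W a' b c d e' f' g' h' \<in> Rel" "a = a' \<or> e = e'"
    for a b c d e f g h a' e' f' g' h'
  proof (cases "a = a'")
    case True
    then show ?thesis using main that by blast
  next
    case False
    have e: "e = e'" using that(3) False by simp
    have *: "(evalS [SF b, SE c, SF d] \<otimes> \<epsilon> e) \<otimes> (evalS [SF k, SE l, SF m] \<otimes> \<epsilon> y) = \<one>"
      if "W y b c d e k l m \<in> Rel" for y k l m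
    proof -
      have "\<epsilon> y \<otimes> (evalS [SF b, SE c, SF d] \<otimes> \<epsilon> e \<otimes> evalS [SF k, SE l, SF m]) = \<one>"
        using that by (simp add: Rel_def m_assoc)
      then have "(evalS [SF b, SE c, SF d] \<otimes> \<epsilon> e \<otimes> evalS [SF k, SE l, SF m]) \<otimes> \<epsilon> y = \<one>"
        by (subst rotate_eq_one) auto
      then show ?thesis by (simp add: m_assoc)
    qed
    have eq: "evalS [SF f, SE g, SF h] \<otimes> \<epsilon> a = evalS [SF f', SE g', SF h'] \<otimes> \<epsilon> a'"
      by (rule left_one_unique[OF _ _ _ *[OF that(1)] *[OF that(2)[folded e]]])
        (simp_all only: m_closed evalS_closed E_closed)
    have "evalS [SF f, SE g, SF h] \<otimes> \<epsilon> a \<otimes> inv \<epsilon> a' = evalS [SF f', SE g', SF h']"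
      unfolding eq by (simp only: m_assoc r_inv r_one inv_closed evalS_closed E_closed)
    then have "evalS [SF f, SE g, SF h, SE (mulE t a (invE t a'))] = evalS [SF f', SE g', SF h']"
      by (simp add: E_mult E_inv m_assoc)
    then have "[SF f, SE g, SF h, SE (mulE t a (invE t a'))] = [SF f', SE g', SF h']"
      using that(1,2) False by (intro alt_unique) (auto simp: alt_Cons Rel_def mulE_eq_E0)
    then show ?thesis by simp
  qed
  show ?thesis
    unfolding quadrangular_def
  proof (intro conjI)
    show "relators t Rel" by (rule relators_Rel)
    show "\<forall>a b c d. a \<noteq> E0 \<longrightarrow> b \<noteq> F0 \<longrightarrow> c \<noteq> E0 \<longrightarrow> d \<noteq> F0 \<longrightarrow> (\<exists>e f g h. W a b c d e f g h \<in> Rel)"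
      by (intro allI impI) (rule ex; assumption)
    show "\<forall>a b c d e f g h d' e' f' g' h'. W a b c d e f g h \<in> Rel \<longrightarrow> W a b c d' e' f' g' h' \<in> Rel \<longrightarrow>
        d = d' \<or> h = h' \<longrightarrow> d = d' \<and> e = e' \<and> f = f' \<and> g = g' \<and> h = h'"
      by (intro allI impI) (rule uniqE; assumption)
    show "\<forall>a b c d e f g h a' e' f' g' h'. W a b c d e f g h \<in> Rel \<longrightarrow> W a' b c d e' f' g' h' \<in> Rel \<longrightarrow>
        a = a' \<or> e = e' \<longrightarrow> a = a' \<and> e = e' \<and> f = f' \<and> g = g' \<and> h = h'"
      by (intro allI impI) (rule uniqF; assumption)
  qed
qed

end

section \<open>Growing a table from given relators\<close>

fun own_status :: "slot \<Rightarrow> status" where "own_status N = New" | "own_status (V a b c d) = Old"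

text \<open>The relators are fed in one by one from the end of the list, with a closure after each.
  A queue left over from the previous stage is dropped, which can only lose entries; that enough
  were found is certified by \<open>full\<close>.\<close>

definition grow :: "ty \<Rightarrow> wd list \<Rightarrow> state" where
  "grow t ws = foldr (\<lambda>w s. case s of Bad \<Rightarrow> Bad
     | St T q \<Rightarrow> run fuel t (absorb t (Push w End) T End)) ws (St empty_tab End)"

definition total :: "tab \<Rightarrow> bool" where
  "total T \<longleftrightarrow> list_all (\<lambda>a. list_all (\<lambda>b. list_all (\<lambda>c. list_all (\<lambda>d. is_old (own_status (look a b c d T)))
     [F1, F2, F3, F4, F5]) [E1, E2, E3]) [F1, F2, F3, F4, F5]) [E1, E2, E3]"

fun full :: "state \<Rightarrow> bool" where "full Bad = False" | "full (St T q) = total T"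

section \<open>Homomorphisms from presented groups\<close>

definition word_val :: "('h, 'm) monoid_scheme \<Rightarrow> ('x \<Rightarrow> 'h) \<Rightarrow> 'x word \<Rightarrow> 'h" where
  "word_val H v w = foldr (\<lambda>(x, e) y. (if e then v x else inv\<^bsub>H\<^esub> v x) \<otimes>\<^bsub>H\<^esub> y) w \<one>\<^bsub>H\<^esub>"

lemma word_val_simps [simp]:
  "word_val H v [] = \<one>\<^bsub>H\<^esub>"
  "word_val H v ((x, e) # w) = (if e then v x else inv\<^bsub>H\<^esub> v x) \<otimes>\<^bsub>H\<^esub> word_val H v w"
  by (simp_all add: word_val_def)

text \<open>The value of an arbitrary representative; by \<open>lift_class\<close> it is independent
  of the choice once the relators are trivial under \<open>v\<close>.\<close>

definition lift :: "('h, 'm) monoid_scheme \<Rightarrow> ('x \<Rightarrow> 'h) \<Rightarrow> 'x word set \<Rightarrow> 'h" where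
  "lift H v A = word_val H v (SOME w. w \<in> A)"

context group
begin

lemma word_val_closed: "v ` S \<subseteq> carrier G \<Longrightarrow> w \<in> words S \<Longrightarrow> word_val G v w \<in> carrier G"
  by (induction w) auto

lemma word_val_append:
  "v ` S \<subseteq> carrier G \<Longrightarrow> u \<in> words S \<Longrightarrow> w \<in> words S \<Longrightarrow> word_val G v (u @ w) = word_val G v u \<otimes> word_val G v w"
proof (induction u)
  case Nil
  then show ?case by (simp add: word_val_closed)
next
  case (Cons a u)
  obtain x e where a: "a = (x, e)" by (cases a)
  then have "u \<in> words S" "v x \<in> carrier G" using Cons.prems by auto
  moreover have "word_val G v u \<in> carrier G" "word_val G v w \<in> carrier G"
    using Cons.prems \<open>u \<in> words S\<close> by (simp_all only: word_val_closed)
  ultimately show ?case using Cons.IH[OF Cons.prems(1) _ Cons.prems(3)] by (cases e) (simp_all add: m_assoc a)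
qed

lemma word_val_pres_eq:
  assumes "pres_eq S R u w" "v ` S \<subseteq> carrier G" "\<And>r. r \<in> R \<Longrightarrow> r \<in> words S \<Longrightarrow> word_val G v r = \<one>"
  shows "word_val G v u = word_val G v w"
  using assms(1)
proof (induction rule: pres_eq.induct)
  case (append u u' w w')
  then show ?case using pres_eq_words[of S R] assms(2) by (simp add: word_val_append)
next
  case (cancel x e)
  then show ?case using assms(2) by (cases e) auto
qed (use assms(3) in auto)

lemma lift_class:
  assumes "v ` S \<subseteq> carrier G" "\<And>r. r \<in> R \<Longrightarrow> r \<in> words S \<Longrightarrow> word_val G v r = \<one>" "w \<in> words S"
  shows "lift G v (word_class S R w) = word_val G v w"
proof -
  have "w \<in> word_class S R w" using assms(3) by (simp add: word_class_def pres_eq.refl)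
  then have "(SOME u. u \<in> word_class S R w) \<in> word_class S R w" by (rule someI)
  then have "pres_eq S R w (SOME u. u \<in> word_class S R w)" by (simp add: word_class_def)
  from word_val_pres_eq[OF this assms(1,2)] show ?thesis by (simp add: lift_def)
qed

lemma lift_hom:
  assumes "v ` S \<subseteq> carrier G" "\<And>r. r \<in> R \<Longrightarrow> r \<in> words S \<Longrightarrow> word_val G v r = \<one>"
  shows "lift G v \<in> hom (presented_group S R) G"
proof (rule homI)
  have car: "carrier (presented_group S R) = word_class S R ` words S" by (simp add: presented_group_def)
  fix A B assume "A \<in> carrier (presented_group S R)" "B \<in> carrier (presented_group S R)"
  then obtain u w where uw: "u \<in> words S" "w \<in> words S" "A = word_class S R u" "B = word_class S R w"
    by (auto simp: car)
  show "lift G v A \<in> carrier G"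
    using uw lift_class[OF assms] word_val_closed[OF assms(1)] by simp
  have "u @ w \<in> words S" using uw by simp
  then show "lift G v (A \<otimes>\<^bsub>presented_group S R\<^esub> B) = lift G v A \<otimes> lift G v B"
    using uw assms by (simp add: presented_group_mult lift_class word_val_append)
qed

end

lemma word_val_presented:
  assumes "w \<in> words S"
  shows "word_val (presented_group S R) (\<lambda>x. word_class S R [(x, True)]) w = word_class S R w"
  using assms
proof (induction w)
  case Nil
  then show ?case by (simp add: presented_group_def)
next
  case (Cons a w)
  interpret P: group "presented_group S R" by (rule group_presented_group)
  obtain x e where a: "a = (x, e)" by (cases a)
  with Cons have x: "x \<in> S" and w: "w \<in> words S" by auto
  have car: "word_class S R [(x, e)] \<in> carrier (presented_group S R)" for e
    using x by (auto simp: presented_group_def)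
  have "word_class S R [(x, False)] \<otimes>\<^bsub>presented_group S R\<^esub> word_class S R [(x, True)] = \<one>\<^bsub>presented_group S R\<^esub>"
    using x word_class_eqI[OF pres_eq.cancel[of x S R False]]
    by (simp add: presented_group_mult) (simp add: presented_group_def)
  then have "inv\<^bsub>presented_group S R\<^esub> word_class S R [(x, True)] = word_class S R [(x, False)]"
    by (rule P.inv_equality) (use car in auto)
  then have "(if e then word_class S R [(x, True)] else inv\<^bsub>presented_group S R\<^esub> word_class S R [(x, True)]) =
      word_class S R [(x, e)]"
    by simp
  then have "word_val (presented_group S R) (\<lambda>x. word_class S R [(x, True)]) ((x, e) # w) =
      word_class S R [(x, e)] \<otimes>\<^bsub>presented_group S R\<^esub> word_class S R w"
    unfolding word_val_simps Cons.IH by (rule arg_cong)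
  also have "\<dots> = word_class S R ([(x, e)] @ w)"
    using x w by (intro presented_group_mult) auto
  finally show ?case by (simp add: a)
qed

section \<open>Amalgams from generators\<close>

fun eps :: "('h, 'm) monoid_scheme \<Rightarrow> ty \<Rightarrow> (gen \<Rightarrow> 'h) \<Rightarrow> ee \<Rightarrow> 'h" where
  "eps H (Ty p q) v x = pickE x \<one>\<^bsub>H\<^esub> (v A1) (if p then v A1 \<otimes>\<^bsub>H\<^esub> v A1 else v A2)
     (if p then v A1 \<otimes>\<^bsub>H\<^esub> (v A1 \<otimes>\<^bsub>H\<^esub> v A1) else v A1 \<otimes>\<^bsub>H\<^esub> v A2)"

fun phi :: "('h, 'm) monoid_scheme \<Rightarrow> ty \<Rightarrow> (gen \<Rightarrow> 'h) \<Rightarrow> ff \<Rightarrow> 'h" where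
  "phi H (Ty p q) v y =
    (if q then pickF y \<one>\<^bsub>H\<^esub> (v B1) (v B1 \<otimes>\<^bsub>H\<^esub> v B1) (v B1 \<otimes>\<^bsub>H\<^esub> (v B1 \<otimes>\<^bsub>H\<^esub> v B1))
        (v B1 \<otimes>\<^bsub>H\<^esub> (v B1 \<otimes>\<^bsub>H\<^esub> (v B1 \<otimes>\<^bsub>H\<^esub> v B1)))
        (v B1 \<otimes>\<^bsub>H\<^esub> (v B1 \<otimes>\<^bsub>H\<^esub> (v B1 \<otimes>\<^bsub>H\<^esub> (v B1 \<otimes>\<^bsub>H\<^esub> v B1))))
     else pickF y \<one>\<^bsub>H\<^esub> (v B2) (v B2 \<otimes>\<^bsub>H\<^esub> v B2) (v B1) (v B2 \<otimes>\<^bsub>H\<^esub> v B1) (v B2 \<otimes>\<^bsub>H\<^esub> (v B2 \<otimes>\<^bsub>H\<^esub> v B1)))"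

fun relE :: "('h, 'm) monoid_scheme \<Rightarrow> ty \<Rightarrow> (gen \<Rightarrow> 'h) \<Rightarrow> bool" where
  "relE H (Ty p q) v \<longleftrightarrow> v A1 \<in> carrier H \<and>
     (if p then v A1 \<otimes>\<^bsub>H\<^esub> (v A1 \<otimes>\<^bsub>H\<^esub> (v A1 \<otimes>\<^bsub>H\<^esub> v A1)) = \<one>\<^bsub>H\<^esub>
      else v A2 \<in> carrier H \<and> v A1 \<otimes>\<^bsub>H\<^esub> v A1 = \<one>\<^bsub>H\<^esub> \<and> v A2 \<otimes>\<^bsub>H\<^esub> v A2 = \<one>\<^bsub>H\<^esub> \<and>
        v A1 \<otimes>\<^bsub>H\<^esub> (v A2 \<otimes>\<^bsub>H\<^esub> (v A1 \<otimes>\<^bsub>H\<^esub> v A2)) = \<one>\<^bsub>H\<^esub>)"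

fun relF :: "('h, 'm) monoid_scheme \<Rightarrow> ty \<Rightarrow> (gen \<Rightarrow> 'h) \<Rightarrow> bool" where
  "relF H (Ty p q) v \<longleftrightarrow> v B1 \<in> carrier H \<and>
     (if q then v B1 \<otimes>\<^bsub>H\<^esub> (v B1 \<otimes>\<^bsub>H\<^esub> (v B1 \<otimes>\<^bsub>H\<^esub> (v B1 \<otimes>\<^bsub>H\<^esub> (v B1 \<otimes>\<^bsub>H\<^esub> v B1)))) = \<one>\<^bsub>H\<^esub>
      else v B2 \<in> carrier H \<and> v B1 \<otimes>\<^bsub>H\<^esub> v B1 = \<one>\<^bsub>H\<^esub> \<and> v B2 \<otimes>\<^bsub>H\<^esub> (v B2 \<otimes>\<^bsub>H\<^esub> v B2) = \<one>\<^bsub>H\<^esub> \<and>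
        v B1 \<otimes>\<^bsub>H\<^esub> (v B2 \<otimes>\<^bsub>H\<^esub> (v B1 \<otimes>\<^bsub>H\<^esub> v B2)) = \<one>\<^bsub>H\<^esub>)"

text \<open>The defining relations are oriented into rewrite rules, with a further version of each
  for a product continued by \<open>z\<close>; simplification then brings all products to normal
  form. The same method proves \<open>phi_mult\<close>.\<close>

lemma (in group) eps_mult:
  assumes "relE G t v"
  shows "eps G t v x \<in> carrier G" and "eps G t v (mulE t x y) = eps G t v x \<otimes> eps G t v y"
proof -
  obtain p q where t: "t = Ty p q" by (cases t)
  have "eps G t v x \<in> carrier G \<and> eps G t v (mulE t x y) = eps G t v x \<otimes> eps G t v y"
  proof (cases p)
    case True
    define a where "a = v A1"
    have a: "a \<in> carrier G" "a \<otimes> (a \<otimes> (a \<otimes> a)) = \<one>" using assms by (auto simp: t True a_def)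
    have a': "a \<otimes> (a \<otimes> (a \<otimes> (a \<otimes> z))) = z" if "z \<in> carrier G" for z
    proof -
      have "a \<otimes> (a \<otimes> (a \<otimes> (a \<otimes> z))) = (a \<otimes> (a \<otimes> (a \<otimes> a))) \<otimes> z"
        using a(1) that by (simp add: m_assoc)
      then show ?thesis using a that by simp
    qed
    show ?thesis unfolding t
      using True by (cases x; cases y; simp add: a_def[symmetric] m_assoc a a')
  next
    case False
    define a b where "a = v A1" and "b = v A2"
    have ab: "a \<in> carrier G" "b \<in> carrier G" "a \<otimes> a = \<one>" "b \<otimes> b = \<one>" "a \<otimes> (b \<otimes> (a \<otimes> b)) = \<one>"
      using assms by (auto simp: t False a_def b_def)
    have a': "a \<otimes> (a \<otimes> z) = z" and b': "b \<otimes> (b \<otimes> z) = z" if "z \<in> carrier G" for z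
      using ab that by (simp_all add: m_assoc[symmetric])
    \<comment> \<open>Since \<open>a\<close> and \<open>b\<close> are involutions, the relation says
      that they commute.\<close>
    have "a \<otimes> (a \<otimes> (b \<otimes> (a \<otimes> b))) = a \<otimes> \<one>" unfolding ab(5) ..
    then have "b \<otimes> (a \<otimes> b) = a" using ab(1,2) by (simp add: a')
    then have "(b \<otimes> (a \<otimes> b)) \<otimes> b = a \<otimes> b" by simp
    then have c: "b \<otimes> a = a \<otimes> b" using ab(1,2,4) by (simp add: m_assoc)
    have c': "b \<otimes> (a \<otimes> z) = a \<otimes> (b \<otimes> z)" if "z \<in> carrier G" for z
      using ab(1,2) that c by (simp add: m_assoc[symmetric])
    show ?thesis unfolding t
      using False by (cases x; cases y; simp add: a_def[symmetric] b_def[symmetric] m_assoc ab(1-4) a' b' c c')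
  qed
  then show "eps G t v x \<in> carrier G" "eps G t v (mulE t x y) = eps G t v x \<otimes> eps G t v y" by auto
qed

lemma (in group) phi_mult:
  assumes "relF G t v"
  shows "phi G t v x \<in> carrier G" and "phi G t v (mulF t x y) = phi G t v x \<otimes> phi G t v y"
proof -
  obtain p q where t: "t = Ty p q" by (cases t)
  have "phi G t v x \<in> carrier G \<and> phi G t v (mulF t x y) = phi G t v x \<otimes> phi G t v y"
  proof (cases q)
    case True
    define a where "a = v B1"
    have a: "a \<in> carrier G" "a \<otimes> (a \<otimes> (a \<otimes> (a \<otimes> (a \<otimes> a)))) = \<one>" using assms by (auto simp: t True a_def)
    have a': "a \<otimes> (a \<otimes> (a \<otimes> (a \<otimes> (a \<otimes> (a \<otimes> z))))) = z" if "z \<in> carrier G" for z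
    proof -
      have "a \<otimes> (a \<otimes> (a \<otimes> (a \<otimes> (a \<otimes> (a \<otimes> z))))) = (a \<otimes> (a \<otimes> (a \<otimes> (a \<otimes> (a \<otimes> a))))) \<otimes> z"
        using a(1) that by (simp add: m_assoc)
      then show ?thesis using a that by simp
    qed
    show ?thesis unfolding t
      using True by (cases x; cases y; simp add: a_def[symmetric] m_assoc a a')
  next
    case False
    define s r where "s = v B1" and "r = v B2"
    have sr: "s \<in> carrier G" "r \<in> carrier G" "s \<otimes> s = \<one>" "r \<otimes> (r \<otimes> r) = \<one>" "s \<otimes> (r \<otimes> (s \<otimes> r)) = \<one>"
      using assms by (auto simp: t False s_def r_def)
    have s': "s \<otimes> (s \<otimes> z) = z" if "z \<in> carrier G" for z
      using sr that by (simp add: m_assoc[symmetric])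
    have r': "r \<otimes> (r \<otimes> (r \<otimes> z)) = z" if "z \<in> carrier G" for z
    proof -
      have "r \<otimes> (r \<otimes> (r \<otimes> z)) = (r \<otimes> (r \<otimes> r)) \<otimes> z" using sr(2) that by (simp add: m_assoc)
      then show ?thesis using sr that by simp
    qed
    \<comment> \<open>The relation amounts to \<open>s r = r r s\<close>, which collects all
      \<open>s\<close> on the right.\<close>
    have "s \<otimes> (s \<otimes> (r \<otimes> (s \<otimes> r))) = s \<otimes> \<one>" unfolding sr(5) ..
    then have "r \<otimes> (s \<otimes> r) = s" using sr(1,2) by (simp add: s')
    then have "r \<otimes> (r \<otimes> (r \<otimes> (s \<otimes> r))) = r \<otimes> (r \<otimes> s)" by simp
    then have c: "s \<otimes> r = r \<otimes> (r \<otimes> s)" using sr(1,2) by (simp add: r')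
    have c': "s \<otimes> (r \<otimes> z) = r \<otimes> (r \<otimes> (s \<otimes> z))" if "z \<in> carrier G" for z
    proof -
      have "s \<otimes> (r \<otimes> z) = (s \<otimes> r) \<otimes> z" using sr(1,2) that by (simp add: m_assoc)
      also have "\<dots> = r \<otimes> (r \<otimes> (s \<otimes> z))" unfolding c using sr(1,2) that by (simp add: m_assoc)
      finally show ?thesis .
    qed
    show ?thesis unfolding t
      using False by (cases x; cases y; simp add: s_def[symmetric] r_def[symmetric] m_assoc sr(1-4) s' r' c c')
  qed
  then show "phi G t v x \<in> carrier G" "phi G t v (mulF t x y) = phi G t v x \<otimes> phi G t v y" by auto
qed

lemma (in group) amalgam_gen: "relE G t v \<Longrightarrow> relF G t v \<Longrightarrow> amalgam G t (eps G t v) (phi G t v)"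
  by unfold_locales (auto simp: eps_mult phi_mult)

fun letter :: "ty \<Rightarrow> gen \<Rightarrow> sy" where
  "letter t A1 = SE E1" | "letter t A2 = SE E2"
| "letter (Ty p q) B1 = SF (if q then F1 else F3)" | "letter t B2 = SF F1"

text \<open>The image of a word in the free product of the two model groups, in reduced form.
  Relators that merely express the structure of one subgroup become empty; the others become
  alternating words, comparable with the words \<open>W\<close>.\<close>

fun nf :: "ty \<Rightarrow> gen word \<Rightarrow> sy list" where
  "nf t [] = []"
| "nf t ((x, e) # w) = cons t (if e then letter t x else syinv t (letter t x)) (nf t w)"

context amalgam
begin

lemma word_val_letter: "word_val H (\<lambda>x. val (letter t x)) w = evalS (nf t w)"
  by (induction w) (auto simp: evalS_cons val_inv)

lemma eps_letter: "eps H t (\<lambda>x. val (letter t x)) x = \<epsilon> x"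
proof -
  obtain p q where t: "t = Ty p q" by (cases t)
  show ?thesis
    using E_mult[of E1 E1, symmetric] E_mult[of E1 E2, symmetric] unfolding t
    by (cases p; cases x; simp)
qed

lemma phi_letter: "phi H t (\<lambda>x. val (letter t x)) y = \<phi> y"
proof -
  obtain p q where t: "t = Ty p q" by (cases t)
  show ?thesis
    using F_mult[of F1 F1, symmetric] F_mult[of F1 F2, symmetric] F_mult[of F1 F3, symmetric]
      F_mult[of F1 F4, symmetric] F_mult[of F2 F3, symmetric] unfolding t
    by (cases q; cases y; simp)
qed

end

lemma hom_eps:
  assumes "h \<in> hom G H" "group G" "group H" "relE G t v"
  shows "h (eps G t v x) = eps H t (h \<circ> v) x"
proof -
  interpret G: group G by fact
  interpret H: group H by fact
  obtain p q where t: "t = Ty p q" by (cases t)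
  have "h \<one>\<^bsub>G\<^esub> = \<one>\<^bsub>H\<^esub>" by (rule hom_one[OF assms(1-3)])
  then show ?thesis
    using assms(4) unfolding t by (cases p; cases x; simp add: hom_mult[OF assms(1)])
qed

lemma hom_phi:
  assumes "h \<in> hom G H" "group G" "group H" "relF G t v"
  shows "h (phi G t v x) = phi H t (h \<circ> v) x"
proof -
  interpret G: group G by fact
  interpret H: group H by fact
  obtain p q where t: "t = Ty p q" by (cases t)
  have "h \<one>\<^bsub>G\<^esub> = \<one>\<^bsub>H\<^esub>" by (rule hom_one[OF assms(1-3)])
  then show ?thesis
    using assms(4) unfolding t by (cases q; cases x; simp add: hom_mult[OF assms(1)])
qed

section \<open>The presentations\<close>

definition ltype :: "nat \<Rightarrow> ty" where
  "ltype i = [Ty True True, Ty False False, Ty False True, Ty False False, Ty False True, Ty True False,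
     Ty False True, Ty False True, Ty True False, Ty False False, Ty False False] ! (i - 1)"

text \<open>The list of numbers gives the position of the base of \<open>L i\<close> among the bases
  of its type; groups are numbered from one, hence \<open>i - 1\<close>.\<close>

definition lwords :: "nat \<Rightarrow> wd list" where
  "lwords i = bases (ltype i) ! ([0, 0, 0, 1, 1, 0, 2, 3, 1, 2, 3] ! (i - 1))"

fun gens :: "ty \<Rightarrow> gen set" where
  "gens (Ty p q) = {A1, B1} \<union> (if p then {} else {A2}) \<union> (if q then {} else {B2})"

text \<open>The rotation accounts for relators that begin with a letter of the second subgroup, such
  as the power of \<open>b1 @ a1 @ b1\<up>-1 @ a2\<close> in \<open>pres8\<close>.\<close>

definition matches :: "ty \<Rightarrow> gen word \<Rightarrow> wd \<Rightarrow> bool" where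
  "matches t r w \<longleftrightarrow> nf t r = sylls w \<or> rotate1 (nf t r) = sylls w"

text \<open>The relation between \<open>b1\<close> and \<open>b2\<close> is left to
  \<open>pres_ok\<close>, because \<open>pres6\<close> states it with the inverse of
  \<open>b2\<close>.\<close>

fun genrels :: "ty \<Rightarrow> gen word list" where
  "genrels (Ty p q) =
    (if p then [a1 @ a1 @ a1 @ a1] else [a1 @ a1, a2 @ a2, a1 @ a2 @ a1 @ a2]) @
    (if q then [b1 @ b1 @ b1 @ b1 @ b1 @ b1] else [b1 @ b1, b2 @ b2 @ b2])"

text \<open>By the third and fourth conditions the presentation and \<open>lwords i\<close> express
  the same relations over the free product of the model groups: each relator is trivial there or is
  one of the words, and each word comes from a relator.\<close>

definition pres_ok :: "nat \<Rightarrow> bool" where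
  "pres_ok i \<longleftrightarrow> (let t = ltype i; rs = snd (pres i); ws = lwords i in
     fst (pres i) = gens t \<and>
     list_all (\<lambda>r. list_all (\<lambda>(x, e). x \<in> gens t) r) rs \<and>
     list_all (\<lambda>r. nf t r = [] \<or> list_ex (matches t r) ws) rs \<and>
     list_all (\<lambda>w. nz w \<and> list_ex (\<lambda>r. matches t r w) rs) ws \<and>
     list_all (\<lambda>r. r \<in> set rs) (genrels t) \<and>
     (case t of Ty p q \<Rightarrow> q \<or> b1 @ b2 @ b1 @ b2 \<in> set rs \<or>
        b1 @ [(B2, False)] @ b1 @ [(B2, False)] \<in> set rs) \<and>
     list_ex (\<lambda>v. v = ws) (bases t) \<and> full (grow t ws))"

lemma pres_ok_all: "list_all pres_ok [1, 2, 3, 4, 5, 6, 7, 8, 9, 10, 11]"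
  by code_simp

lemma index_cases:
  assumes "i \<in> {1..11::nat}" shows "i \<in> set [1, 2, 3, 4, 5, 6, 7, 8, 9, 10, 11]"
  using assms by (auto simp: numeral_eq_Suc le_Suc_eq)

lemma pres_ok: "i \<in> {1..11} \<Longrightarrow> pres_ok i"
  using pres_ok_all index_cases unfolding list_all_iff by blast

lemma pres_okD:
  assumes "i \<in> {1..11}"
  shows "fst (pres i) = gens (ltype i)"
    and "r \<in> set (snd (pres i)) \<Longrightarrow> r \<in> words (gens (ltype i))"
    and "r \<in> set (snd (pres i)) \<Longrightarrow> nf (ltype i) r = [] \<or> (\<exists>w \<in> set (lwords i). matches (ltype i) r w)"
    and "w \<in> set (lwords i) \<Longrightarrow> nz w \<and> (\<exists>r \<in> set (snd (pres i)). matches (ltype i) r w)"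
    and "r \<in> set (genrels (ltype i)) \<Longrightarrow> r \<in> set (snd (pres i))"
    and "ltype i = Ty p False \<Longrightarrow> b1 @ b2 @ b1 @ b2 \<in> set (snd (pres i)) \<or>
        b1 @ [(B2, False)] @ b1 @ [(B2, False)] \<in> set (snd (pres i))"
    and "lwords i \<in> set (bases (ltype i))" and "full (grow (ltype i) (lwords i))"
proof -
  note * = pres_ok[OF assms, unfolded pres_ok_def Let_def list_all_iff list_ex_iff]
  show "fst (pres i) = gens (ltype i)" using * by blast
  show "r \<in> words (gens (ltype i))" if "r \<in> set (snd (pres i))"
    using *[THEN conjunct2, THEN conjunct1] that by (force simp del: gens.simps)
  show "nf (ltype i) r = [] \<or> (\<exists>w \<in> set (lwords i). matches (ltype i) r w)" if "r \<in> set (snd (pres i))"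
    using * that by blast
  show "nz w \<and> (\<exists>r \<in> set (snd (pres i)). matches (ltype i) r w)" if "w \<in> set (lwords i)"
    using * that by blast
  show "r \<in> set (snd (pres i))" if "r \<in> set (genrels (ltype i))"
    using * that by blast
  show "b1 @ b2 @ b1 @ b2 \<in> set (snd (pres i)) \<or> b1 @ [(B2, False)] @ b1 @ [(B2, False)] \<in> set (snd (pres i))"
    if "ltype i = Ty p False"
    using * unfolding that by simp
  show "lwords i \<in> set (bases (ltype i))" "full (grow (ltype i) (lwords i))" using * by blast+
qed

lemma totalD:
  assumes "total T" "a \<noteq> E0" "b \<noteq> F0" "c \<noteq> E0" "d \<noteq> F0"
  shows "is_old (own_status (look a b c d T))"
proof -
  have *: "x \<noteq> E0 \<Longrightarrow> x \<in> set [E1, E2, E3]" "y \<noteq> F0 \<Longrightarrow> y \<in> set [F1, F2, F3, F4, F5]" for x y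
    by (cases x; simp) (cases y; simp)
  from *(1)[of a] *(2)[of b] *(1)[of c] *(2)[of d] show ?thesis using assms unfolding total_def list_all_iff by blast
qed

section \<open>Products of the form F E F E in an amalgam\<close>

context amalgam
begin

lemma subgroup_range: "subgroup (range \<epsilon>) H" "subgroup (range \<phi>) H"
proof -
  show "subgroup (range \<epsilon>) H"
  proof (rule subgroupI)
    show "inv a \<in> range \<epsilon>" if "a \<in> range \<epsilon>" for a
      using that by (elim rangeE) (simp only: E_inv[symmetric] rangeI)
    show "a \<otimes> b \<in> range \<epsilon>" if "a \<in> range \<epsilon>" "b \<in> range \<epsilon>" for a b
      using that by (elim rangeE) (simp only: E_mult[symmetric] rangeI)
  qed auto
  show "subgroup (range \<phi>) H"
  proof (rule subgroupI)
    show "inv a \<in> range \<phi>" if "a \<in> range \<phi>" for a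
      using that by (elim rangeE) (simp only: F_inv[symmetric] rangeI)
    show "a \<otimes> b \<in> range \<phi>" if "a \<in> range \<phi>" "b \<in> range \<phi>" for a b
      using that by (elim rangeE) (simp only: F_mult[symmetric] rangeI)
  qed auto
qed

lemma evalS_rotate1: "evalS s = \<one> \<longleftrightarrow> evalS (rotate1 s) = \<one>"
  by (cases s) (auto simp: evalS_append rotate_eq_one[of "val _"])

lemma evalS_matches: "matches t r w \<Longrightarrow> evalS (nf t r) = \<one> \<longleftrightarrow> evalS (sylls w) = \<one>"
  using evalS_rotate1[of "nf t r"] by (auto simp: matches_def)

lemma Rel_iff: "w \<in> Rel \<longleftrightarrow> nz w \<and> evalS (sylls w) = \<one>"
  by (cases w) (simp add: Rel_def)

lemma state_ok_grow: "set ws \<subseteq> Rel \<Longrightarrow> state_ok t Rel (grow t ws)"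
proof (induction ws)
  case Nil
  then show ?case by (simp add: grow_def tab_ok_empty)
next
  case (Cons w ws)
  then have "state_ok t Rel (grow t ws)" by simp
  moreover have "grow t (w # ws) = (case grow t ws of Bad \<Rightarrow> Bad
      | St T q \<Rightarrow> run fuel t (absorb t (Push w End) T End))"
    by (simp add: grow_def del: absorb.simps)
  ultimately show ?case
    using Cons.prems state_ok_start[OF relators_Rel, of _ w]
    by (cases "grow t ws") (simp_all del: absorb.simps)
qed

definition spanned :: "'a \<Rightarrow> bool" where
  "spanned x \<longleftrightarrow> (\<exists>f e f' e'. x = \<phi> f \<otimes> (\<epsilon> e \<otimes> (\<phi> f' \<otimes> \<epsilon> e')))"

text \<open>A factor from the first subgroup is absorbed by the last letter. For a factor
  \<open>y\<close> from the second, the letters \<open>e f' e' y\<close> are a key of the full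
  table; they equal the inverse of the second half of that relator, which begins in the second
  subgroup, so that its first letter merges with \<open>f\<close>. Units among the letters make room
  for \<open>y\<close> directly.\<close>

lemma spanned_mult:
  assumes "set ws \<subseteq> Rel" "full (grow t ws)" "spanned x"
  shows "spanned (x \<otimes> \<epsilon> a)" and "spanned (x \<otimes> \<phi> y)"
proof -
  obtain f e f' e' where x: "x = \<phi> f \<otimes> (\<epsilon> e \<otimes> (\<phi> f' \<otimes> \<epsilon> e'))" using assms(3) by (auto simp: spanned_def)
  show "spanned (x \<otimes> \<epsilon> a)"
    unfolding spanned_def
    by (rule exI[of _ f], rule exI[of _ e], rule exI[of _ f'], rule exI[of _ "mulE t e' a"]) (simp add: x m_assoc E_mult)
  obtain T q where T: "grow t ws = St T q" using assms(2) by (cases "grow t ws") auto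
  have ok: "tab_ok Rel T" and total: "total T" using state_ok_grow[OF assms(1)] assms(2) T by auto
  show "spanned (x \<otimes> \<phi> y)"
  proof (cases "e = E0 \<or> f' = F0 \<or> e' = E0 \<or> y = F0")
    case True
    then consider "e = E0" | "f' = F0" | "e' = E0" | "y = F0" by blast
    then show ?thesis
    proof cases
      case 1
      then have "x \<otimes> \<phi> y = \<phi> (mulF t f f') \<otimes> (\<epsilon> e' \<otimes> (\<phi> y \<otimes> \<epsilon> E0))" by (simp add: x m_assoc F_mult)
      then show ?thesis unfolding spanned_def by (intro exI)
    next
      case 2
      then have "x \<otimes> \<phi> y = \<phi> f \<otimes> (\<epsilon> (mulE t e e') \<otimes> (\<phi> y \<otimes> \<epsilon> E0))" by (simp add: x m_assoc E_mult)
      then show ?thesis unfolding spanned_def by (intro exI)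
    next
      case 3
      then have "x \<otimes> \<phi> y = \<phi> f \<otimes> (\<epsilon> e \<otimes> (\<phi> (mulF t f' y) \<otimes> \<epsilon> E0))" by (simp add: x m_assoc F_mult)
      then show ?thesis unfolding spanned_def by (intro exI)
    next
      case 4
      then show ?thesis using assms(3) by (simp add: x)
    qed
  next
    case False
    then have nz: "e \<noteq> E0" "f' \<noteq> F0" "e' \<noteq> E0" "y \<noteq> F0" by auto
    have "is_old (own_status (look e f' e' y T))"
      by (rule totalD[OF total nz])
    then obtain k l m n where "look e f' e' y T = V k l m n" by (cases "look e f' e' y T") auto
    then have W: "W e f' e' y k l m n \<in> Rel" using ok nz by (simp add: tab_ok_def)
    then have nzW: "nz (W e f' e' y k l m n)" by (simp add: Rel_def)
    have "evalS [SE e, SF f', SE e', SF y] = evalS [SF (invF t n), SE (invE t m), SF (invF t l), SE (invE t k)]"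
      by (rule Rel_eq[THEN iffD1, OF nzW W])
    then have "\<epsilon> e \<otimes> (\<phi> f' \<otimes> (\<epsilon> e' \<otimes> \<phi> y)) = \<phi> (invF t n) \<otimes> (\<epsilon> (invE t m) \<otimes> (\<phi> (invF t l) \<otimes> \<epsilon> (invE t k)))"
      by simp
    then have "x \<otimes> \<phi> y = \<phi> f \<otimes> (\<phi> (invF t n) \<otimes> (\<epsilon> (invE t m) \<otimes> (\<phi> (invF t l) \<otimes> \<epsilon> (invE t k))))"
      by (simp add: x m_assoc)
    also have "\<dots> = \<phi> (mulF t f (invF t n)) \<otimes> (\<epsilon> (invE t m) \<otimes> (\<phi> (invF t l) \<otimes> \<epsilon> (invE t k)))"
      by (simp add: F_mult m_assoc)
    finally show ?thesis unfolding spanned_def by (intro exI)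
  qed
qed

lemma spanned_evalS:
  assumes "set ws \<subseteq> Rel" "full (grow t ws)"
  shows "spanned (evalS s)"
proof (induction s rule: rev_induct)
  case Nil
  have "\<one> = \<phi> F0 \<otimes> (\<epsilon> E0 \<otimes> (\<phi> F0 \<otimes> \<epsilon> E0))" by simp
  then show ?case unfolding spanned_def evalS.simps by (intro exI)
next
  case (snoc x s)
  then show ?case
    using spanned_mult[OF assms snoc] by (cases x) (simp_all add: evalS_append)
qed

lemma spanned_alt:
  assumes "spanned x"
  obtains s where "alt s" "length s \<le> 4" "x = evalS s"
proof -
  obtain f e f' e' where x: "x = \<phi> f \<otimes> (\<epsilon> e \<otimes> (\<phi> f' \<otimes> \<epsilon> e'))" using assms by (auto simp: spanned_def)
  let ?s = "cons t (SF f) (cons t (SE e) (cons t (SF f') (cons t (SE e') [])))"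
  show thesis
  proof (rule that[of ?s])
    show "alt ?s" by (intro alt_cons) simp
    show "length ?s \<le> 4"
      using length_cons[of t "SF f" "cons t (SE e) (cons t (SF f') (cons t (SE e') []))"]
        length_cons[of t "SE e" "cons t (SF f') (cons t (SE e') [])"]
        length_cons[of t "SF f'" "cons t (SE e') []"] length_cons[of t "SE e'" "[]"] by simp
    show "x = evalS ?s" unfolding evalS_cons x by simp
  qed
qed

end

section \<open>The groups \<open>L i\<close> as amalgams\<close>

definition epsL :: "nat \<Rightarrow> ee \<Rightarrow> gen word set" where "epsL i = eps (L i) (ltype i) (L_gen i)"
definition phiL :: "nat \<Rightarrow> ff \<Rightarrow> gen word set" where "phiL i = phi (L i) (ltype i) (L_gen i)"

lemma group_L: "group (L i)"
  unfolding L_def by (rule group_presented_group)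

lemma word_val_L: "w \<in> words (fst (pres i)) \<Longrightarrow> word_val (L i) (L_gen i) w = word_class (fst (pres i)) (set (snd (pres i))) w"
  using word_val_presented[of w "fst (pres i)" "set (snd (pres i))"] by (simp add: L_def L_gen_def[abs_def])

lemma L_gen_closed: "x \<in> fst (pres i) \<Longrightarrow> L_gen i x \<in> carrier (L i)"
  by (auto simp: L_gen_def L_def presented_group_def)

lemma eps_cong:
  assumes "\<And>x. x \<in> gens t \<Longrightarrow> u x = v x" shows "eps H t u x = eps H t v x"
proof -
  obtain p q where t: "t = Ty p q" by (cases t)
  show ?thesis using assms[of A1] assms[of A2] unfolding t by (cases p; cases x; simp)
qed

lemma phi_cong:
  assumes "\<And>x. x \<in> gens t \<Longrightarrow> u x = v x" shows "phi H t u x = phi H t v x"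
proof -
  obtain p q where t: "t = Ty p q" by (cases t)
  show ?thesis using assms[of B1] assms[of B2] unfolding t by (cases q; cases x; simp)
qed

context
  fixes i assumes i: "i \<in> {1..11::nat}"
begin

interpretation L: group "L i" by (rule group_L)

lemma L_relator:
  assumes "r \<in> set (snd (pres i))" shows "word_val (L i) (L_gen i) r = \<one>\<^bsub>L i\<^esub>"
proof -
  have r: "r \<in> words (fst (pres i))" using pres_okD(1,2)[OF i] assms by simp
  have "word_class (fst (pres i)) (set (snd (pres i))) r = word_class (fst (pres i)) (set (snd (pres i))) []"
    by (rule word_class_eqI, rule pres_eq.relator[OF assms r])
  then show ?thesis by (simp add: word_val_L[OF r]) (simp add: L_def presented_group_def)
qed

lemma relEF_L: "relE (L i) (ltype i) (L_gen i)" "relF (L i) (ltype i) (L_gen i)"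
proof -
  obtain p q where t: "ltype i = Ty p q" by (cases "ltype i")
  have cl: "x \<in> gens (ltype i) \<Longrightarrow> L_gen i x \<in> carrier (L i)" for x using L_gen_closed pres_okD(1)[OF i] by blast
  have rel: "r \<in> set (genrels (ltype i)) \<Longrightarrow> word_val (L i) (L_gen i) r = \<one>\<^bsub>L i\<^esub>" for r
    by (rule L_relator[OF pres_okD(5)[OF i]])
  show "relE (L i) (ltype i) (L_gen i)"
  proof (cases p)
    case True
    have "word_val (L i) (L_gen i) (a1 @ a1 @ a1 @ a1) = \<one>\<^bsub>L i\<^esub>" by (rule rel) (simp add: t True)
    then show ?thesis using cl[of A1] by (simp add: t True)
  next
    case False
    have "word_val (L i) (L_gen i) (a1 @ a1) = \<one>\<^bsub>L i\<^esub>" "word_val (L i) (L_gen i) (a2 @ a2) = \<one>\<^bsub>L i\<^esub>"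
      "word_val (L i) (L_gen i) (a1 @ a2 @ a1 @ a2) = \<one>\<^bsub>L i\<^esub>"
      by (rule rel, simp add: t False)+
    then show ?thesis using cl[of A1] cl[of A2] False by (simp add: t)
  qed
  show "relF (L i) (ltype i) (L_gen i)"
  proof (cases q)
    case True
    have "word_val (L i) (L_gen i) (b1 @ b1 @ b1 @ b1 @ b1 @ b1) = \<one>\<^bsub>L i\<^esub>" by (rule rel) (simp add: t True)
    then show ?thesis using cl[of B1] by (simp add: t True)
  next
    case False
    let ?s = "L_gen i B1" and ?r = "L_gen i B2"
    have c: "?s \<in> carrier (L i)" "?r \<in> carrier (L i)" using cl[of B1] cl[of B2] False by (simp_all add: t)
    have "word_val (L i) (L_gen i) (b1 @ b1) = \<one>\<^bsub>L i\<^esub>" "word_val (L i) (L_gen i) (b2 @ b2 @ b2) = \<one>\<^bsub>L i\<^esub>"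
      by (rule rel, simp add: t False)+
    then have s: "?s \<otimes>\<^bsub>L i\<^esub> ?s = \<one>\<^bsub>L i\<^esub>" and r: "?r \<otimes>\<^bsub>L i\<^esub> (?r \<otimes>\<^bsub>L i\<^esub> ?r) = \<one>\<^bsub>L i\<^esub>"
      using c by simp_all
    have "?s \<otimes>\<^bsub>L i\<^esub> (?r \<otimes>\<^bsub>L i\<^esub> (?s \<otimes>\<^bsub>L i\<^esub> ?r)) = \<one>\<^bsub>L i\<^esub>"
    proof (cases "b1 @ b2 @ b1 @ b2 \<in> set (snd (pres i))")
      case True
      then show ?thesis using L_relator[OF True] c by simp
    next
      case F: False
      then have "b1 @ [(B2, False)] @ b1 @ [(B2, False)] \<in> set (snd (pres i))"
        using pres_okD(6)[OF i] t False by auto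
      from L_relator[OF this] have *: "?s \<otimes>\<^bsub>L i\<^esub> (inv\<^bsub>L i\<^esub> ?r \<otimes>\<^bsub>L i\<^esub> (?s \<otimes>\<^bsub>L i\<^esub> inv\<^bsub>L i\<^esub> ?r)) = \<one>\<^bsub>L i\<^esub>"
        using c by simp
      \<comment> \<open>As \<open>s\<close> is its own inverse, inverting the relation
        \<open>(s r^-1)^2 = 1\<close> gives \<open>(r s)^2 = 1\<close>, a conjugate of the relation
        wanted.\<close>
      have inv_s: "inv\<^bsub>L i\<^esub> ?s = ?s" using s c by (simp add: L.inv_equality)
      have "inv\<^bsub>L i\<^esub> (?s \<otimes>\<^bsub>L i\<^esub> (inv\<^bsub>L i\<^esub> ?r \<otimes>\<^bsub>L i\<^esub> (?s \<otimes>\<^bsub>L i\<^esub> inv\<^bsub>L i\<^esub> ?r))) =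
          ?r \<otimes>\<^bsub>L i\<^esub> (?s \<otimes>\<^bsub>L i\<^esub> (?r \<otimes>\<^bsub>L i\<^esub> ?s))"
        using c by (simp add: L.inv_mult_group inv_s L.m_assoc)
      then have "(?r \<otimes>\<^bsub>L i\<^esub> (?s \<otimes>\<^bsub>L i\<^esub> ?r)) \<otimes>\<^bsub>L i\<^esub> ?s = \<one>\<^bsub>L i\<^esub>" using * c by (simp add: L.m_assoc)
      then have "inv\<^bsub>L i\<^esub> ?s = ?r \<otimes>\<^bsub>L i\<^esub> (?s \<otimes>\<^bsub>L i\<^esub> ?r)" using c by (intro L.inv_equality) auto
      then show ?thesis using s by (simp add: inv_s)
    qed
    then show ?thesis using c s r False unfolding t by simp
  qed
qed

lemma amalgam_L: "amalgam (L i) (ltype i) (epsL i) (phiL i)"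
  unfolding epsL_def phiL_def by (rule L.amalgam_gen[OF relEF_L])

interpretation A: amalgam "L i" "ltype i" "epsL i" "phiL i" by (rule amalgam_L)

lemma val_letter_L:
  assumes "x \<in> gens (ltype i)" shows "A.val (letter (ltype i) x) = L_gen i x"
proof -
  obtain p q where t: "ltype i = Ty p q" by (cases "ltype i")
  show ?thesis using assms unfolding t by (cases x; cases p; cases q; simp add: t; simp add: epsL_def phiL_def t)
qed

lemma word_class_L:
  assumes "w \<in> words (gens (ltype i))"
  shows "word_class (fst (pres i)) (set (snd (pres i))) w = A.evalS (nf (ltype i) w)"
proof -
  have "word_val (L i) (\<lambda>x. A.val (letter (ltype i) x)) w = word_val (L i) (L_gen i) w"
    using assms by (induction w) (auto simp: val_letter_L simp del: gens.simps)
  then show ?thesis using assms by (simp add: A.word_val_letter word_val_L pres_okD(1)[OF i])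
qed

lemma lwords_Rel: "set (lwords i) \<subseteq> A.Rel"
proof
  fix w assume "w \<in> set (lwords i)"
  then obtain r where r: "nz w" "r \<in> set (snd (pres i))" "matches (ltype i) r w" using pres_okD(4)[OF i] by blast
  have "r \<in> words (gens (ltype i))" by (rule pres_okD(2)[OF i r(2)])
  then have "A.evalS (nf (ltype i) r) = \<one>\<^bsub>L i\<^esub>"
    using word_class_L[of r] L_relator[OF r(2)] word_val_L[of r i] pres_okD(1)[OF i] by simp
  then show "w \<in> A.Rel" using A.evalS_matches[OF r(3)] r(1) by (simp add: A.Rel_iff)
qed

lemma carrier_L: "x \<in> carrier (L i) \<Longrightarrow> A.spanned x"
proof -
  assume "x \<in> carrier (L i)"
  then obtain w where "w \<in> words (gens (ltype i))" "x = word_class (fst (pres i)) (set (snd (pres i))) w"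
    using pres_okD(1)[OF i] by (auto simp: L_def presented_group_def)
  then have "x = A.evalS (nf (ltype i) w)" using word_class_L by simp
  then show ?thesis using A.spanned_evalS[OF lwords_Rel pres_okD(8)[OF i]] by simp
qed

lemma generated_L: "L_a i = range (epsL i)" "L_b i = range (phiL i)"
proof -
  obtain p q where t: "ltype i = Ty p q" by (cases "ltype i")
  have S: "fst (pres i) = gens (Ty p q)" using pres_okD(1)[OF i] t by simp
  have sub: "subgroup (range (epsL i)) (L i)" "subgroup (range (phiL i)) (L i)"
    by (rule A.subgroup_range)+
  have "L_gen i x \<in> range (epsL i)" if "x \<in> gens (ltype i)" "x \<in> {A1, A2}" for x
  proof -
    have "A.val (letter (ltype i) x) \<in> range (epsL i)" using that(2) by auto
    then show ?thesis unfolding val_letter_L[OF that(1)] .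
  qed
  moreover have "L_gen i x \<in> range (phiL i)" if "x \<in> gens (ltype i)" "x \<in> {B1, B2}" for x
  proof -
    have "A.val (letter (ltype i) x) \<in> range (phiL i)" using that(2) unfolding t by auto
    then show ?thesis unfolding val_letter_L[OF that(1)] .
  qed
  ultimately have sub': "L_gen i ` (fst (pres i) \<inter> {A1, A2}) \<subseteq> range (epsL i)" "L_gen i ` (fst (pres i) \<inter> {B1, B2}) \<subseteq> range (phiL i)"
    unfolding S t by blast+
  have 1: "L_a i \<subseteq> range (epsL i)" "L_b i \<subseteq> range (phiL i)"
    unfolding L_a_def L_b_def by (rule L.generate_subgroup_incl[OF sub'(1) sub(1)]) (rule L.generate_subgroup_incl[OF sub'(2) sub(2)])
  have gen: "L_gen i A1 \<in> L_a i" "\<not> p \<Longrightarrow> L_gen i A2 \<in> L_a i" "L_gen i B1 \<in> L_b i" "\<not> q \<Longrightarrow> L_gen i B2 \<in> L_b i"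
    unfolding L_a_def L_b_def S by (auto intro!: generate.incl)
  have mult: "x \<in> L_a i \<Longrightarrow> y \<in> L_a i \<Longrightarrow> x \<otimes>\<^bsub>L i\<^esub> y \<in> L_a i" "x \<in> L_b i \<Longrightarrow> y \<in> L_b i \<Longrightarrow> x \<otimes>\<^bsub>L i\<^esub> y \<in> L_b i"
    for x y unfolding L_a_def L_b_def by (rule generate.eng; assumption)+
  have one: "\<one>\<^bsub>L i\<^esub> \<in> L_a i" "\<one>\<^bsub>L i\<^esub> \<in> L_b i" unfolding L_a_def L_b_def by (rule generate.one)+
  have "epsL i x \<in> L_a i" for x
    unfolding epsL_def t by (cases p; cases x; simp add: gen mult one)
  moreover have "phiL i x \<in> L_b i" for x
    unfolding phiL_def t by (cases q; cases x; simp add: gen mult one)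
  ultimately show "L_a i = range (epsL i)" "L_b i = range (phiL i)" using 1 by auto
qed

theorem iso_L:
  assumes "quadrangle_amalgam H (ltype i) \<epsilon> \<phi>"
    and ws: "set (lwords i) \<subseteq> amalgam.Rel H \<epsilon> \<phi>"
  obtains h where "h \<in> iso (L i) H" "h ` L_a i = range \<epsilon>" "h ` L_b i = range \<phi>"
proof -
  interpret Q: quadrangle_amalgam H "ltype i" \<epsilon> \<phi> by fact
  let ?v = "\<lambda>x. Q.val (letter (ltype i) x)" and ?S = "fst (pres i)" and ?R = "set (snd (pres i))"
  let ?h = "lift H ?v"
  have cl: "?v ` ?S \<subseteq> carrier H" by auto
  \<comment> \<open>A relator with empty \<open>nf\<close> holds in every amalgam; any other is, up
    to rotation, one of the words assumed to lie in \<open>Rel\<close>.\<close>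
  have rel: "word_val H ?v r = \<one>\<^bsub>H\<^esub>" if r: "r \<in> ?R" for r
  proof (cases "nf (ltype i) r = []")
    case False
    then obtain w where w: "w \<in> set (lwords i)" "matches (ltype i) r w" using pres_okD(3)[OF i r] by blast
    then have "w \<in> Q.Rel" using ws by blast
    then show ?thesis unfolding Q.word_val_letter Q.evalS_matches[OF w(2)] by (simp add: Q.Rel_iff)
  qed (simp add: Q.word_val_letter)
  have hom: "?h \<in> hom (L i) H" unfolding L_def by (rule Q.lift_hom[OF cl rel])
  have gen: "?h (L_gen i x) = ?v x" if "x \<in> gens (ltype i)" for x
    unfolding L_gen_def using that pres_okD(1)[OF i]
    by (subst Q.lift_class[OF cl rel]) auto
  have gE: "eps H (ltype i) (?h \<circ> L_gen i) x = eps H (ltype i) ?v x" for x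
    using gen by (intro eps_cong) simp
  have gF: "phi H (ltype i) (?h \<circ> L_gen i) x = phi H (ltype i) ?v x" for x
    using gen by (intro phi_cong) simp
  have hE: "?h (epsL i x) = \<epsilon> x" for x
    unfolding epsL_def hom_eps[OF hom group_L Q.group_axioms relEF_L(1)] gE Q.eps_letter ..
  have hF: "?h (phiL i x) = \<phi> x" for x
    unfolding phiL_def hom_phi[OF hom group_L Q.group_axioms relEF_L(2)] gF Q.phi_letter ..
  interpret h: group_hom "L i" H ?h
    by unfold_locales (rule hom)
  have hS: "?h (A.evalS s) = Q.evalS s" for s
  proof (induction s)
    case (Cons x s)
    then show ?case by (cases x) (simp_all add: hE hF)
  qed simp
  have inj: "inj_on ?h (carrier (L i))"
  proof (rule h.inj_on_one_iff[THEN iffD2], intro allI impI)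
    fix x assume x: "x \<in> carrier (L i)" "?h x = \<one>\<^bsub>H\<^esub>"
    obtain s where s: "alt s" "length s \<le> 4" "x = A.evalS s" using A.spanned_alt[OF carrier_L[OF x(1)]] by blast
    have one: "Q.evalS s = \<one>\<^bsub>H\<^esub>" using x(2) unfolding s(3) hS .
    have "s = []"
    proof (rule ccontr)
      assume "s \<noteq> []"
      then show False using Q.girth[OF s(1)] s(2) one by simp
    qed
    then show "x = \<one>\<^bsub>L i\<^esub>" using s(3) by simp
  qed
  have surj: "?h ` carrier (L i) = carrier H"
  proof
    show "carrier H \<subseteq> ?h ` carrier (L i)"
    proof
      fix y assume "y \<in> carrier H"
      then obtain f e f' e' where y: "y = \<phi> f \<otimes>\<^bsub>H\<^esub> \<epsilon> e \<otimes>\<^bsub>H\<^esub> \<phi> f' \<otimes>\<^bsub>H\<^esub> \<epsilon> e'" using Q.cover by blast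
      have "y = Q.evalS [SF f, SE e, SF f', SE e']" unfolding y by (simp add: Q.m_assoc)
      then have "y = ?h (A.evalS [SF f, SE e, SF f', SE e'])" unfolding hS .
      then show "y \<in> ?h ` carrier (L i)" by (rule image_eqI[OF _ A.evalS_closed])
    qed
    show "?h ` carrier (L i) \<subseteq> carrier H" by (rule image_subsetI) (rule h.hom_closed)
  qed
  have "?h \<in> iso (L i) H" using hom inj surj by (simp add: iso_def bij_betw_def)
  moreover have "?h ` L_a i = range \<epsilon>" "?h ` L_b i = range \<phi>"
    unfolding generated_L image_image hE hF by simp_all
  ultimately show thesis using that by blast
qed

end

section \<open>Automorphisms and the search\<close>

fun mapE :: "ee te \<Rightarrow> ee \<Rightarrow> ee" where "mapE (TE p q r) a = pickE a E0 p q r"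
fun mapF :: "ff tf \<Rightarrow> ff \<Rightarrow> ff" where "mapF (TF p q r s u) b = pickF b F0 p q r s u"

fun mapS :: "ee te \<Rightarrow> ff tf \<Rightarrow> sy \<Rightarrow> sy" where
  "mapS x y (SE a) = SE (mapE x a)" | "mapS x y (SF b) = SF (mapF y b)"

lemma mapE_aut:
  assumes "x \<in> set (fst (auts t))"
  shows "mapE x (mulE t a b) = mulE t (mapE x a) (mapE x b)" and "mapE x a = E0 \<longleftrightarrow> a = E0"
    and "range (mapE x) = UNIV"
proof -
  obtain p q where t: "t = Ty p q" by (cases t)
  have x: "x \<in> set (fst (auts (Ty p q)))" using assms t by simp
  show "mapE x (mulE t a b) = mulE t (mapE x a) (mapE x b)"
    using x unfolding t by (cases p; simp; elim disjE; cases a; cases b; simp)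
  show zero: "mapE x a = E0 \<longleftrightarrow> a = E0" for a
    using x unfolding t by (cases p; simp; elim disjE; cases a; simp)
  have "inj (mapE x)"
    using x unfolding t inj_def by (cases p; simp; elim disjE; intro allI; rename_tac a b; case_tac a; case_tac b; simp)
  moreover have "finite (UNIV :: ee set)"
  proof -
    have *: "UNIV = {E0, E1, E2, E3}" by (rule Set.set_eqI, rename_tac a, case_tac a) simp_all
    show ?thesis unfolding * by simp
  qed
  ultimately show "range (mapE x) = UNIV" by (rule finite_UNIV_inj_surj[rotated])
qed

lemma mapF_aut:
  assumes "y \<in> set (snd (auts t))"
  shows "mapF y (mulF t a b) = mulF t (mapF y a) (mapF y b)" and "mapF y a = F0 \<longleftrightarrow> a = F0"
    and "range (mapF y) = UNIV"
proof -
  obtain p q where t: "t = Ty p q" by (cases t)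
  have x: "y \<in> set (snd (auts (Ty p q)))" using assms t by simp
  show "mapF y (mulF t a b) = mulF t (mapF y a) (mapF y b)"
    using x unfolding t by (cases q; simp; elim disjE; cases a; cases b; simp)
  show zero: "mapF y a = F0 \<longleftrightarrow> a = F0" for a
    using x unfolding t by (cases q; simp; elim disjE; cases a; simp)
  have "inj (mapF y)"
    using x unfolding t inj_def by (cases q; simp; elim disjE; intro allI; rename_tac a b; case_tac a; case_tac b; simp)
  moreover have "finite (UNIV :: ff set)"
  proof -
    have *: "UNIV = {F0, F1, F2, F3, F4, F5}" by (rule Set.set_eqI, rename_tac a, case_tac a) simp_all
    show ?thesis unfolding * by simp
  qed
  ultimately show "range (mapF y) = UNIV" by (rule finite_UNIV_inj_surj[rotated])
qed

text \<open>Translates the position of a base, as named in a \<open>Sol\<close> leaf, into the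
  number of a group.\<close>

lemma bases_indexed:
  "list_all (\<lambda>t. list_all (\<lambda>ws. list_ex (\<lambda>i. ltype i = t \<and> lwords i = ws) [1, 2, 3, 4, 5, 6, 7, 8, 9, 10, 11]) (bases t))
     [Ty True True, Ty True False, Ty False True, Ty False False]"
  by code_simp

context quadrangle_amalgam
begin

text \<open>Automorphisms permute the nonunits of each model group, so alternating words stay
  alternating and the two subgroups stay the same sets; only their coordinates change.\<close>

lemma quadrangle_twist:
  assumes x: "x \<in> set (fst (auts t))" and y: "y \<in> set (snd (auts t))"
  shows "quadrangle_amalgam H t (\<lambda>a. \<epsilon> (mapE x a)) (\<lambda>b. \<phi> (mapF y b))"
    and "range (\<lambda>a. \<epsilon> (mapE x a)) = range \<epsilon>" and "range (\<lambda>b. \<phi> (mapF y b)) = range \<phi>"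
    and "twist x y Rel = amalgam.Rel H (\<lambda>a. \<epsilon> (mapE x a)) (\<lambda>b. \<phi> (mapF y b))"
proof -
  interpret A: amalgam H t "\<lambda>a. \<epsilon> (mapE x a)" "\<lambda>b. \<phi> (mapF y b)"
    by unfold_locales (simp_all add: mapE_aut(1)[OF x] mapF_aut(1)[OF y] E_mult F_mult)
  have ev: "A.evalS s = evalS (map (mapS x y) s)" for s
  proof (induction s)
    case (Cons z s)
    then show ?case by (cases z) simp_all
  qed simp
  have sE: "\<exists>b. a = mapE x b" for a
  proof -
    have "a \<in> range (mapE x)" unfolding mapE_aut(3)[OF x] ..
    then show ?thesis by blast
  qed
  have sF: "\<exists>b. a = mapF y b" for a
  proof -
    have "a \<in> range (mapF y)" unfolding mapF_aut(3)[OF y] ..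
    then show ?thesis by blast
  qed
  show "quadrangle_amalgam H t (\<lambda>a. \<epsilon> (mapE x a)) (\<lambda>b. \<phi> (mapF y b))"
  proof (intro_locales, unfold_locales)
    fix z assume "z \<in> carrier H"
    then obtain f e f' e' where z: "z = \<phi> f \<otimes> \<epsilon> e \<otimes> \<phi> f' \<otimes> \<epsilon> e'" using cover by blast
    obtain k l where "f = mapF y k" "e = mapE x l" using sE[of e] sF[of f] by blast
    moreover obtain m n where "f' = mapF y m" "e' = mapE x n" using sE[of e'] sF[of f'] by blast
    ultimately have "z = \<phi> (mapF y k) \<otimes> \<epsilon> (mapE x l) \<otimes> \<phi> (mapF y m) \<otimes> \<epsilon> (mapE x n)" using z by simp
    then show "\<exists>f e f' e'. z = \<phi> (mapF y f) \<otimes> \<epsilon> (mapE x e) \<otimes> \<phi> (mapF y f') \<otimes> \<epsilon> (mapE x e')"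
      by (intro exI)
  next
    fix s assume s: "alt s" "s \<noteq> []" "length s \<le> 7"
    have nu: "nonunit (mapS x y z) \<longleftrightarrow> nonunit z" "is_SE (mapS x y z) \<longleftrightarrow> is_SE z" for z
      by (cases z; simp add: mapE_aut(2)[OF x] mapF_aut(2)[OF y])+
    have "alt (map (mapS x y) s)"
      using s(1) by (induction s) (auto simp: alt_Cons nu hd_map)
    then show "A.evalS s \<noteq> \<one>" unfolding ev using s girth by simp
  qed
  show "range (\<lambda>a. \<epsilon> (mapE x a)) = range \<epsilon>" using image_image[of \<epsilon> "mapE x" UNIV, symmetric] mapE_aut(3)[OF x] by simp
  show "range (\<lambda>b. \<phi> (mapF y b)) = range \<phi>" using image_image[of \<phi> "mapF y" UNIV, symmetric] mapF_aut(3)[OF y] by simp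
  show "twist x y Rel = A.Rel"
  proof (rule Set.set_eqI)
    fix w
    obtain a b c d e f g h where w: "w = W a b c d e f g h" by (cases w)
    have gE: "getE a x = mapE x a" if "a \<noteq> E0" for a using that by (cases x; cases a) auto
    have gF: "getF b y = mapF y b" if "b \<noteq> F0" for b using that by (cases y; cases b) auto
    show "w \<in> twist x y Rel \<longleftrightarrow> w \<in> A.Rel"
    proof (cases "nz w")
      case True
      then have m: "mapW x y w = W (mapE x a) (mapF y b) (mapE x c) (mapF y d) (mapE x e) (mapF y f) (mapE x g) (mapF y h)"
        unfolding w by (simp add: gE gF)
      then have "nz (mapW x y w)" using True unfolding w by (simp add: mapE_aut(2)[OF x] mapF_aut(2)[OF y])
      moreover have "sylls (mapW x y w) = map (mapS x y) (sylls w)" unfolding m by (simp add: w)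
      ultimately show ?thesis using True unfolding twist_def Rel_iff A.Rel_iff ev by simp
    next
      case False
      then show ?thesis unfolding twist_def A.Rel_iff by simp
    qed
  qed
qed

definition recognized :: bool where
  "recognized \<longleftrightarrow> (\<exists>i \<in> {1..11}. \<exists>h \<in> iso (L i) H. h ` L_a i = range \<epsilon> \<and> h ` L_b i = range \<phi>)"

text \<open>The group, its two subgroups and the type are fixed, and only the identifications with
  the model groups vary. As \<open>recognized\<close> mentions the subgroups but not their
  coordinates, it is one and the same conclusion for all members, and \<open>twist\<close> does not
  lead out of the family.\<close>

definition family :: "wd set set" where
  "family = {R. \<exists>\<epsilon>' \<phi>'. quadrangle_amalgam H t \<epsilon>' \<phi>' \<and> range \<epsilon>' = range \<epsilon> \<and> range \<phi>' = range \<phi> \<and>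
     R = amalgam.Rel H \<epsilon>' \<phi>'}"

lemma search_family:
  assumes "m \<le> length (roots t)" "\<And>R k. R \<in> family \<Longrightarrow> k < m \<Longrightarrow> roots t ! k \<in> R \<Longrightarrow> recognized"
  shows "search t family recognized m"
proof
  fix R assume R: "R \<in> family"
  then obtain \<epsilon>' \<phi>' where R': "quadrangle_amalgam H t \<epsilon>' \<phi>'" "range \<epsilon>' = range \<epsilon>" "range \<phi>' = range \<phi>"
      "R = amalgam.Rel H \<epsilon>' \<phi>'"
    unfolding family_def by blast
  interpret Q: quadrangle_amalgam H t \<epsilon>' \<phi>' by fact
  show "quadrangular t R" unfolding R'(4) by (rule Q.quadrangular_Rel)
  show "twist x y R \<in> family" if "x \<in> set (fst (auts t))" "y \<in> set (snd (auts t))" for x y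
    unfolding family_def R'(4) Q.quadrangle_twist(4)[OF that]
    by (rule CollectI, rule exI, rule exI, intro conjI, rule Q.quadrangle_twist(1)[OF that])
      (simp_all only: Q.quadrangle_twist(2,3)[OF that] R'(2,3))
  show recognized if k: "k < length (bases t)" "set (bases t ! k) \<subseteq> R" for k
  proof -
    have *: "t \<in> set [Ty True True, Ty True False, Ty False True, Ty False False]"
      by (cases t; rename_tac p q; case_tac p; case_tac q; simp)
    obtain i where "i \<in> set [1, 2, 3, 4, 5, 6, 7, 8, 9, 10, 11]" and i: "ltype i = t" "lwords i = bases t ! k"
      using bspec[OF bspec[OF bases_indexed[unfolded list_all_iff] *] nth_mem[OF k(1)]]
      unfolding list_ex_iff by (elim bexE conjE)
    then have I: "i \<in> {1..11}" by auto
    have qa: "quadrangle_amalgam H (ltype i) \<epsilon>' \<phi>'" using R'(1) i(1) by simp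
    have sub: "set (lwords i) \<subseteq> amalgam.Rel H \<epsilon>' \<phi>'" using k(2) i(2) R'(4) by simp
    obtain h where h: "h \<in> iso (L i) H" "h ` L_a i = range \<epsilon>'" "h ` L_b i = range \<phi>'"
      by (rule iso_L[OF I qa sub])
    show ?thesis
      unfolding recognized_def R'(2,3)[symmetric] by (intro bexI[OF _ I] bexI[OF _ h(1)] conjI h(2,3))
  qed
  show recognized if "k < m" "roots t ! k \<in> R" for k
    by (rule assms(2)[OF R that])
qed (rule assms(1))

text \<open>Strong induction on the number of the root. It ranges over all members of the family at
  once, since a \<open>Sym\<close> leaf uses an earlier root only after a change of
  coordinates.\<close>

lemma recognized_root:
  assumes "\<And>k. k < length (roots t) \<Longrightarrow> \<exists>c. kids k t [roots t ! k] [c] empty_tab"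
  shows "k < length (roots t) \<Longrightarrow> R \<in> family \<Longrightarrow> roots t ! k \<in> R \<Longrightarrow> recognized"
proof (induction k arbitrary: R rule: less_induct)
  case (less k)
  interpret search t family recognized k
    using less by (intro search_family) auto
  obtain c where c: "kids k t [roots t ! k] [c] empty_tab" using assms less.prems(1) by blast
  show ?case
    by (rule check_sound(2)[OF HOL.refl HOL.refl c less.prems(2) tab_ok_empty]) (use less.prems(3) in simp)
qed

lemma recognizedI:
  assumes "\<And>k. k < length (roots t) \<Longrightarrow> \<exists>c. kids k t [roots t ! k] [c] empty_tab"
    and "check (length (roots t)) t c empty_tab"
  shows recognized
proof -
  interpret search t family recognized "length (roots t)"
    using recognized_root[OF assms(1)] by (intro search_family) auto
  have "Rel \<in> family" unfolding family_def using quadrangle_amalgam_axioms by blast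
  then show ?thesis using check_sound(1)[OF HOL.refl HOL.refl assms(2) _ tab_ok_empty] by blast
qed

end

section \<open>Certificates\<close>

text \<open>Entry \<open>k\<close> settles root \<open>k\<close>. The subcertificates of
  \<open>Br\<close> follow the order of \<open>cands\<close>; an empty list means that every
  completion of that half collapses.\<close>

fun certs :: "ty \<Rightarrow> cert list" where
  "certs (Ty True True) =
    [Br E3 F3 E2 F3 [],
     Br E1 F3 E2 F3 [],
     Br E2 F2 E1 F2 [],
     Br E1 F3 E2 F3 [],
     Br E2 F1 E1 F1 [],
     Br E3 F3 E2 F3 [],
     Br E3 F5 E2 F5 [],
     Br E3 F4 E2 F4 [],
     Br E2 F2 E2 F5 [],
     Br E1 F3 E2 F3 [],
     Br E3 F3 E1 F3 [],
     Br E1 F2 E1 F4 [],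
     Br E1 F1 E1 F5 [],
     Br E3 F1 E1 F5 [],
     Br E3 F2 E1 F4 [],
     Br E3 F4 E3 F4 [],
     Br E3 F4 E1 F1 [],
     Br E1 F5 E1 F5 [],
     Br E3 F2 E1 F1 [],
     Br E1 F1 E3 F5 [],
     Br E3 F2 E2 F3 [],
     Br E1 F3 E2 F5 [],
     Br E1 F3 E2 F3 [Br E2 F1 E1 F4 [], Br E2 F2 E3 F2 []],
     Br E3 F3 E2 F3 [Br E2 F3 E2 F2 [], Br E2 F2 E3 F5 []],
     Br E3 F5 E1 F1 [Br E1 F3 E2 F3 []],
     Br E2 F3 E2 F2 [Br E2 F3 E3 F3 [], Br E2 F3 E2 F4 [], Br E1 F3 E3 F3 []],
     Br E2 F4 E2 F4 [Br E2 F4 E2 F3 [], Br E2 F4 E2 F3 [], Br E2 F4 E2 F3 [], Br E1 F3 E2 F2 []],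
     Br E3 F3 E2 F3 [Br E2 F2 E2 F3 [Br E3 F3 E2 F5 [], Br E2 F5 E2 F5 []], Br E2 F3 E2 F4 [Br E2 F4 E2 F4 []],
         Br E3 F3 E3 F3 [Br E3 F3 E3 F4 [Br E1 F3 E3 F2 [], Br E1 F3 E3 F2 [], Br E1 F2 E1 F3 [],
         Br E1 F4 E1 F3 [], Br E2 F1 E1 F3 [], Br E2 F1 E1 F3 [], Br E1 F4 E1 F3 [], Br E1 F2 E1 F3 [],
         Br E3 F3 E1 F2 [], Br E1 F1 E3 F3 [Br E2 F1 E3 F3 []]], Br E1 F3 E3 F1 [Br E2 F5 E2 F5 [],
         Br E2 F5 E2 F5 [], Br E1 F1 E1 F3 [], Br E3 F1 E3 F3 [], Br E1 F1 E1 F3 [], Br E2 F2 E2 F2 [],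
         Br E2 F2 E2 F2 [], Br E3 F3 E3 F5 [], Br E3 F4 E2 F4 [Sol 0 1 0, Sol 0 1 1], Br E2 F1 E2 F1 [],
         Br E2 F1 E2 F1 [], Br E1 F1 E3 F3 [], Br E2 F1 E2 F3 [], Br E2 F4 E2 F3 [], Br E3 F1 E2 F1 [Sol 0 0 1,
         Sol 0 0 0], Br E2 F4 E2 F4 [], Br E2 F4 E2 F4 [], Br E1 F5 E3 F3 [], Br E1 F3 E1 F5 [],
         Br E3 F3 E3 F1 [Br E1 F3 E3 F2 []]]], Br E2 F3 E2 F2 [Br E2 F2 E2 F2 []],
         Br E2 F4 E2 F3 [Br E2 F1 E2 F1 [], Br E3 F3 E2 F1 []], Br E2 F5 E2 F5 [Br E3 F3 E2 F5 []],
         Br E2 F4 E2 F4 [], Br E3 F3 E3 F3 [Br E2 F5 E2 F5 [], Br E2 F4 E2 F4 [], Br E2 F5 E2 F5 [],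
         Br E2 F1 E2 F4 [], Br E2 F1 E2 F5 [], Br E2 F2 E2 F4 [], Br E2 F4 E2 F2 [], Br E2 F5 E2 F1 []],
         Br E2 F2 E2 F2 [], Br E2 F1 E2 F1 [Br E3 F3 E2 F1 []]]]"
|   "certs (Ty False True) =
    [Br E2 F1 E2 F3 [],
     Br E1 F5 E1 F3 [],
     Br E3 F3 E3 F3 [],
     Br E2 F2 E1 F2 [],
     Br E2 F1 E1 F1 [],
     Br E2 F2 E1 F2 [],
     Br E2 F1 E1 F1 [],
     Br E1 F1 E1 F1 [],
     Br E1 F2 E1 F2 [],
     Br E3 F4 E1 F3 [],
     Br E1 F1 E1 F1 [],
     Br E1 F1 E1 F2 [],
     Br E1 F1 E1 F1 [],
     Br E3 F5 E1 F3 [],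
     Br E1 F2 E1 F1 [],
     Br E1 F3 E1 F5 [],
     Br E3 F3 E2 F5 [],
     Br E1 F3 E1 F1 [],
     Br E1 F5 E1 F1 [],
     Br E1 F1 E1 F2 [],
     Br E3 F1 E2 F3 [],
     Br E2 F2 E2 F5 [],
     Br E1 F5 E1 F2 [],
     Br E1 F2 E1 F2 [Br E1 F2 E1 F4 []],
     Br E1 F3 E2 F4 [],
     Br E2 F5 E2 F5 [],
     Br E3 F3 E3 F2 [Br E2 F5 E2 F5 []],
     Br E1 F1 E1 F5 [Br E1 F3 E1 F4 [], Sym 12 0 1, Sym 12 1 1],
     Br E1 F4 E1 F4 [Br E1 F2 E1 F2 [], Br E3 F3 E1 F2 [], Br E2 F3 E1 F2 [], Br E1 F2 E1 F2 []],
     Br E1 F2 E2 F4 [Br E2 F4 E2 F5 [], Br E2 F3 E2 F2 [Br E3 F3 E3 F3 []], Br E2 F1 E2 F2 [],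
         Br E3 F4 E1 F5 [], Sym 8 3 1],
     Br E1 F1 E2 F5 [Br E2 F5 E2 F4 [], Br E1 F3 E1 F5 [Br E3 F3 E3 F3 []], Br E1 F5 E1 F3 [],
         Br E2 F5 E2 F5 [], Br E2 F1 E2 F5 [], Sym 20 3 1],
     Br E3 F3 E3 F3 [Sym 4 1 0, Sym 24 1 0, Sym 19 1 1, Sym 12 1 1, Sym 13 5 1, Sym 26 0 0, Sym 18 2 1,
         Sym 20 3 1, Sym 6 4 1, Sym 21 1 0, Sym 7 4 1, Sym 10 4 1, Sym 15 4 1, Sym 3 1 0, Sym 23 1 1,
         Sym 14 1 1, Sym 25 5 1, Sym 9 5 1, Sym 8 3 1, Sym 16 3 1, Sym 22 4 1, Sym 5 4 1, Sym 17 4 1,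
         Sym 11 4 1, Sym 14 1 0, Sym 23 1 0, Sym 3 1 1, Sym 15 4 0, Sym 16 3 0, Sym 8 3 0, Sym 9 5 0,
         Sym 25 5 0, Sym 11 4 0, Sym 17 4 0, Sym 5 4 0, Sym 22 4 0, Sym 12 1 0, Sym 19 1 0, Sym 24 1 1,
         Sym 4 1 1, Sym 20 3 0, Sym 18 2 0, Sym 26 0 1, Sym 13 5 0, Sym 10 4 0, Sym 7 4 0, Sym 21 1 1,
         Sym 6 4 0, Sym 13 4 1, Sym 26 2 0, Sym 18 0 1, Sym 20 1 1, Sym 4 3 0, Sym 24 3 0, Sym 19 3 1,
         Sym 12 3 1, Sym 6 5 1, Sym 21 3 0, Sym 7 5 1, Sym 10 5 1, Sym 25 4 1, Sym 9 4 1, Sym 8 1 1,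
         Sym 16 1 1, Sym 15 5 1, Sym 3 3 0, Sym 23 3 1, Sym 14 3 1, Sym 22 5 1, Sym 5 5 1, Sym 17 5 1,
         Sym 11 5 1, Sym 0 1 0, Sym 2 1 0, Sym 2 1 1, Sym 0 1 1, Sym 1 3 0,
         Br E1 F3 E1 F1 [Br E2 F1 E1 F3 [Br E3 F5 E1 F3 []], Br E2 F2 E1 F3 [Br E3 F3 E1 F1 []],
         Br E2 F1 E1 F3 [], Br E2 F1 E1 F3 [], Br E3 F1 E3 F3 [], Br E2 F5 E2 F3 [], Br E2 F5 E1 F3 [],
         Br E2 F5 E1 F3 [], Br E2 F1 E2 F3 [], Br E2 F1 E2 F3 []], Sym 1 3 1, Sym 16 1 0, Sym 8 1 0, Sym 9 4 0,
         Sym 25 4 0, Sym 14 3 0, Sym 23 3 0, Sym 3 3 1, Sym 15 5 0, Sym 11 5 0, Sym 17 5 0, Sym 5 5 0,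
         Sym 22 5 0, Sym 20 1 0, Sym 18 0 0, Sym 26 2 1, Sym 13 4 0, Sym 12 3 0, Sym 19 3 0, Sym 24 3 1,
         Sym 4 3 1, Sym 10 5 0, Sym 7 5 0, Sym 21 3 1, Sym 6 5 0, Sym 30 1 1, Sym 30 3 1, Sym 27 4 1,
         Sym 29 1 1, Sym 29 3 1, Sym 28 4 1, Br E2 F3 E2 F3 [Sym 4 0 0, Sym 24 0 0, Sym 19 0 1, Sym 6 2 1,
         Sym 21 0 0, Sym 7 2 1, Sym 13 3 1, Sym 26 1 0, Sym 18 4 1, Sym 15 2 1, Sym 3 0 0, Sym 14 0 1,
         Sym 22 2 1, Sym 5 2 1, Sym 11 2 1, Sym 25 3 1, Sym 9 3 1, Sym 16 5 1, Sym 14 0 0, Sym 3 0 1,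
         Sym 15 2 0, Sym 11 2 0, Sym 5 2 0, Sym 22 2 0, Sym 16 5 0, Sym 9 3 0, Sym 25 3 0, Sym 19 0 0,
         Sym 24 0 1, Sym 4 0 1, Sym 7 2 0, Sym 21 0 1, Sym 6 2 0, Sym 18 4 0, Sym 26 1 1, Sym 13 3 0,
         Sym 30 0 1, Sym 27 2 1, Sym 30 5 1, Sym 29 0 1, Sym 28 2 1, Sym 29 5 1,
         Br E3 F3 E2 F3 [Br E3 F3 E3 F1 [], Br E1 F3 E1 F1 [], Br E1 F3 E1 F1 [], Br E3 F3 E3 F2 [],
         Br E1 F3 E1 F2 [], Br E1 F3 E1 F2 [], Br E3 F3 E3 F4 [], Br E3 F3 E3 F4 [], Br E1 F3 E1 F4 [],
         Br E3 F3 E3 F5 [], Br E1 F3 E1 F5 [], Br E1 F3 E1 F5 [], Br E3 F3 E3 F1 [],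
         Br E3 F3 E3 F1 [Br E3 F3 E1 F3 []], Br E1 F3 E1 F1 [], Br E3 F3 E3 F2 [], Br E2 F4 E2 F4 [],
         Br E1 F3 E1 F2 [], Br E1 F2 E1 F3 [Br E2 F2 E1 F3 [Br E2 F5 E1 F3 []],
         Br E2 F1 E1 F3 [Br E2 F3 E2 F5 [Sol 3 5 0, Sol 2 1 0], Br E2 F4 E1 F3 [Br E3 F3 E3 F5 [Sol 1 1 0,
         Sol 0 1 0], Br E3 F3 E3 F5 [Sol 3 3 0, Sol 2 0 0]], Br E2 F3 E2 F5 [Sol 1 0 0, Sol 0 0 0]],
         Br E1 F3 E1 F5 [Br E1 F5 E1 F3 [Sol 0 5 0, Sol 1 4 0], Br E2 F5 E2 F3 [Sol 0 4 0, Sol 1 5 0]],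
         Br E1 F4 E1 F3 [], Br E3 F2 E1 F3 [], Br E1 F1 E1 F3 [], Br E1 F3 E1 F5 [Br E3 F3 E1 F1 [Sol 2 4 0,
         Sol 3 2 0], Br E3 F3 E1 F1 [Sol 3 0 0, Sol 2 5 0]], Br E1 F1 E1 F3 [], Br E2 F2 E1 F3 [],
         Br E1 F1 E2 F3 [], Br E3 F2 E1 F3 [], Br E2 F3 E2 F5 [], Br E2 F2 E1 F3 [], Br E1 F1 E1 F3 [],
         Br E1 F3 E1 F5 [Br E1 F5 E1 F3 [Sol 0 3 0, Sol 1 2 0], Br E1 F5 E1 F3 [Sol 1 3 0, Sol 0 2 0]],
         Br E1 F4 E1 F3 [], Br E1 F1 E1 F3 [], Br E1 F3 E1 F5 [Br E2 F3 E1 F1 [Sol 2 2 0, Sol 3 4 0],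
         Br E2 F3 E1 F5 [Sol 2 3 0, Sol 3 1 0]], Br E2 F2 E1 F3 [], Br E3 F3 E3 F5 [], Br E3 F2 E1 F3 [],
         Br E1 F1 E3 F3 []], Br E3 F3 E3 F4 [], Br E2 F2 E2 F2 [], Br E1 F3 E1 F4 [], Br E3 F3 E3 F5 [],
         Br E3 F3 E3 F5 [Br E3 F3 E1 F3 []], Br E1 F3 E1 F5 []], Sym 29 0 0, Sym 28 2 0, Sym 29 5 0,
         Sym 30 0 0, Sym 27 2 0, Sym 30 5 0, Sym 13 2 1, Sym 26 4 0, Sym 18 1 1, Sym 6 3 1, Sym 21 5 0,
         Sym 7 3 1, Sym 4 5 0, Sym 24 5 0, Sym 19 5 1, Sym 25 2 1, Sym 9 2 1, Sym 16 0 1, Sym 22 3 1,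
         Sym 5 3 1, Sym 11 3 1, Sym 15 3 1, Sym 3 5 0, Sym 14 5 1, Sym 16 0 0, Sym 9 2 0, Sym 25 2 0,
         Sym 11 3 0, Sym 5 3 0, Sym 22 3 0, Sym 14 5 0, Sym 3 5 1, Sym 15 3 0, Sym 18 1 0, Sym 26 4 1,
         Sym 13 2 0, Sym 7 3 0, Sym 21 5 1, Sym 6 3 0, Sym 19 5 0, Sym 24 5 1, Sym 4 5 1], Sym 29 1 0,
         Sym 29 3 0, Sym 28 4 0, Sym 30 1 0, Sym 30 3 0, Sym 27 4 0],
     Sym 31 4 0]"
|   "certs (Ty True False) =
    [Br E1 F1 E2 F2 [],
     Br E1 F1 E2 F2 [],
     Br E3 F1 E2 F2 [],
     Br E3 F2 E2 F2 [],
     Br E2 F1 E3 F5 [],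
     Br E2 F5 E2 F2 [],
     Br E2 F5 E2 F3 [],
     Br E1 F1 E1 F1 [],
     Br E2 F2 E2 F5 [],
     Br E1 F1 E2 F5 [],
     Br E2 F1 E2 F1 [Sym 9 1 4],
     Br E3 F3 E2 F2 [],
     Br E1 F3 E2 F1 [],
     Br E3 F2 E3 F2 [],
     Br E3 F2 E2 F1 [],
     Br E3 F5 E2 F5 [Br E1 F2 E2 F5 [], Br E1 F2 E2 F5 []],
     Br E3 F1 E2 F1 [Br E2 F1 E2 F1 []],
     Br E1 F1 E2 F3 [Sol 1 0 3, Sol 1 0 1],
     Br E3 F1 E2 F2 [Br E1 F1 E1 F2 [], Br E1 F2 E3 F1 [Br E1 F2 E2 F2 [Sol 0 1 5]],
         Br E1 F2 E3 F1 [Br E1 F2 E2 F2 [Sol 0 1 3]], Br E1 F2 E3 F1 [Br E1 F2 E2 F2 [Sol 0 1 4]]],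
     Br E2 F1 E2 F1 [Br E1 F5 E3 F5 [], Br E1 F3 E1 F3 []],
     Br E1 F1 E2 F3 [Sol 0 1 2, Br E2 F3 E2 F2 [], Sym 19 0 4],
     Br E2 F1 E2 F1 [Sym 20 1 3, Br E1 F2 E1 F5 []],
     Br E2 F1 E2 F4 [Br E1 F2 E2 F1 [], Br E1 F2 E2 F1 [], Br E1 F1 E2 F2 [], Br E1 F2 E2 F1 [],
         Br E1 F1 E2 F2 [], Br E1 F1 E2 F2 [], Br E2 F2 E1 F1 [Br E3 F2 E2 F1 [], Br E3 F2 E2 F1 []],
         Br E1 F2 E2 F1 [Br E2 F3 E2 F3 [], Br E2 F4 E2 F4 [], Br E2 F5 E2 F5 []],
         Br E1 F2 E2 F2 [Br E3 F1 E2 F2 [], Br E3 F1 E2 F2 [], Br E1 F2 E2 F1 [], Br E3 F1 E2 F2 []],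
         Br E1 F2 E2 F1 [Br E2 F3 E2 F3 [], Br E2 F4 E2 F4 [], Br E2 F5 E2 F5 []], Br E3 F2 E2 F1 [],
         Br E3 F2 E2 F1 [], Br E3 F1 E2 F2 [], Br E3 F2 E2 F1 [], Br E3 F1 E2 F2 [], Br E3 F1 E2 F2 []],
     Br E1 F2 E2 F2 [Br E2 F3 E2 F3 [], Br E2 F4 E2 F4 [], Br E2 F5 E2 F5 [], Br E3 F3 E1 F3 [],
         Br E1 F5 E3 F5 [], Br E2 F3 E2 F3 [], Br E2 F3 E2 F3 [], Br E3 F4 E1 F4 [], Br E1 F3 E3 F3 [],
         Br E1 F3 E3 F3 [], Br E3 F4 E1 F4 [], Br E2 F3 E2 F3 [], Br E2 F4 E2 F4 [], Br E1 F4 E3 F4 [],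
         Br E3 F5 E1 F5 [], Br E3 F5 E1 F5 [], Br E1 F4 E3 F4 [], Br E2 F3 E2 F3 [], Br E2 F4 E2 F4 [],
         Br E3 F3 E1 F3 [], Br E1 F5 E3 F5 []]]"
|   "certs (Ty False False) =
    [Br E3 F2 E1 F3 [],
     Br E1 F2 E2 F2 [],
     Br E2 F1 E1 F1 [],
     Br E2 F2 E1 F1 [],
     Br E1 F3 E1 F1 [],
     Br E2 F1 E1 F1 [],
     Br E2 F2 E2 F3 [],
     Br E2 F1 E1 F1 [Br E2 F4 E1 F2 []],
     Br E1 F2 E1 F2 [],
     Br E2 F2 E1 F4 [],
     Br E2 F2 E1 F1 [],
     Br E2 F2 E1 F3 [],
     Br E2 F2 E1 F1 [],
     Br E2 F2 E1 F1 [],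
     Br E1 F1 E1 F2 [],
     Br E2 F2 E1 F1 [],
     Br E3 F3 E3 F4 [Sym 15 2 0],
     Br E1 F1 E1 F3 [Br E1 F2 E2 F3 [Br E1 F3 E1 F5 [Sol 2 5 0, Sol 3 2 0]]],
     Br E1 F2 E1 F2 [Br E2 F5 E1 F2 []],
     Br E1 F4 E1 F4 [Br E1 F1 E2 F3 [], Br E1 F2 E2 F4 []],
     Br E1 F2 E1 F1 [Br E3 F3 E3 F3 [Br E3 F3 E1 F2 [Sol 3 1 0, Sol 2 4 0]], Br E2 F2 E1 F3 []],
     Br E3 F1 E2 F1 [Sym 20 0 5, Sym 20 0 3, Sym 20 0 4],
     Br E1 F2 E1 F3 [Br E1 F2 E1 F1 [], Br E2 F2 E1 F3 [], Br E1 F1 E3 F1 []],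
     Br E1 F2 E1 F2 [Br E1 F3 E1 F3 [Br E1 F2 E3 F3 [Sym 17 3 0, Br E1 F3 E1 F2 [Sol 0 0 0, Sol 1 0 0]],
         Br E1 F2 E3 F3 []], Sym 22 3 1, Br E3 F5 E3 F3 [], Br E2 F3 E2 F5 []],
     Br E2 F1 E2 F1 [Sym 10 2 0, Sym 7 2 0, Sym 18 2 0, Sym 20 2 0, Sym 2 2 0, Sym 9 2 0, Sym 17 2 0,
         Sym 13 2 0, Sym 3 2 0, Sym 5 2 0, Sym 16 2 0, Sym 23 2 0, Sym 20 2 1, Sym 7 2 1, Sym 18 2 1,
         Sym 17 2 1, Sym 2 2 1, Sym 9 2 1, Sym 13 2 1, Sym 3 2 1, Sym 23 2 1, Sym 5 2 1, Sym 16 2 1,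
         Sym 18 2 2, Sym 20 2 2, Sym 7 2 2, Sym 9 2 2, Sym 17 2 2, Sym 2 2 2, Sym 13 2 2, Sym 3 2 2,
         Sym 16 2 2, Sym 23 2 2, Sym 5 2 2, Br E3 F1 E3 F1 [Sym 18 4 0, Sym 20 4 0, Sym 13 4 0, Sym 3 4 0,
         Sym 16 4 0, Sym 23 4 0, Sym 9 4 0, Sym 20 4 1, Sym 18 4 1, Sym 13 4 1, Sym 3 4 1, Sym 23 4 1,
         Sym 16 4 1, Sym 9 4 1, Sym 18 4 2, Sym 20 4 2, Sym 13 4 2, Sym 3 4 2, Sym 16 4 2, Sym 23 4 2,
         Sym 9 4 2, Sym 0 5 0, Sym 0 5 1, Sym 0 5 2, Sym 10 5 0, Sym 13 4 3, Sym 3 5 0, Sym 16 5 0, Sym 23 5 0,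
         Sym 18 5 0, Sym 20 5 0, Sym 9 5 0, Sym 17 5 0, Sym 13 4 4, Sym 3 5 1, Sym 23 5 1, Sym 16 5 1,
         Sym 20 5 1, Sym 18 5 1, Sym 17 5 1, Sym 9 5 1, Sym 13 4 5, Sym 3 5 2, Sym 16 5 2, Sym 23 5 2,
         Sym 18 5 2, Sym 20 5 2, Sym 9 5 2, Sym 17 5 2, Br E1 F2 E1 F3 [Br E1 F2 E3 F2 [], Br E2 F1 E2 F2 [],
         Br E1 F1 E3 F1 [], Br E2 F1 E2 F2 []], Br E3 F2 E3 F3 [Br E3 F1 E2 F1 [], Br E3 F1 E2 F1 [],
         Br E1 F1 E2 F1 [], Br E3 F1 E2 F1 [], Br E3 F1 E1 F2 [], Br E1 F1 E3 F1 [], Br E3 F1 E1 F2 [],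
         Br E1 F1 E3 F1 [], Br E1 F2 E3 F2 [], Br E3 F1 E1 F1 []], Sym 22 4 0, Sym 22 5 0, Sym 19 4 0,
         Sym 22 4 1, Sym 22 5 1, Sym 19 4 1, Sym 22 4 2, Sym 22 5 2, Sym 19 4 2], Br E3 F1 E3 F1 [Sym 18 4 0,
         Sym 20 4 0, Sym 13 4 0, Sym 3 4 0, Sym 16 4 0, Sym 23 4 0, Sym 9 4 0, Sym 20 4 1, Sym 18 4 1,
         Sym 13 4 1, Sym 3 4 1, Sym 23 4 1, Sym 16 4 1, Sym 9 4 1, Sym 18 4 2, Sym 20 4 2, Sym 13 4 2,
         Sym 3 4 2, Sym 16 4 2, Sym 23 4 2, Sym 9 4 2, Sym 13 4 3, Sym 3 5 0, Sym 16 5 0, Sym 23 5 0,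
         Sym 18 5 0, Sym 20 5 0, Sym 9 5 0, Sym 13 4 4, Sym 3 5 1, Sym 23 5 1, Sym 16 5 1, Sym 20 5 1,
         Sym 18 5 1, Sym 9 5 1, Sym 13 4 5, Sym 3 5 2, Sym 16 5 2, Sym 23 5 2, Sym 18 5 2, Sym 20 5 2,
         Sym 9 5 2, Br E2 F2 E2 F3 [Br E2 F1 E3 F1 [], Br E2 F1 E3 F1 [], Br E2 F1 E3 F1 [], Br E2 F1 E3 F1 [],
         Br E1 F1 E2 F2 [], Br E1 F1 E2 F1 [], Br E2 F1 E1 F2 [], Br E1 F1 E2 F1 [], Br E1 F2 E2 F2 [],
         Br E2 F1 E1 F1 []], Br E3 F2 E3 F5 [Br E1 F1 E3 F3 [], Br E3 F1 E1 F5 [], Br E3 F4 E2 F2 [],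
         Br E1 F2 E3 F5 [], Br E3 F2 E1 F4 [], Br E1 F3 E2 F2 [], Br E2 F1 E3 F4 [], Br E3 F1 E2 F5 [],
         Br E3 F3 E1 F2 [], Br E2 F2 E3 F4 [], Br E3 F1 E2 F5 [], Br E2 F4 E1 F2 [],
         Br E1 F2 E3 F2 [Br E3 F1 E1 F1 [], Br E3 F2 E2 F1 []], Br E1 F2 E3 F2 [Br E3 F2 E2 F2 [],
         Br E3 F2 E1 F1 []], Br E3 F2 E2 F1 [Br E3 F2 E1 F2 [], Br E3 F2 E1 F1 []],
         Br E3 F2 E1 F1 [Br E3 F2 E2 F2 [], Br E3 F1 E2 F2 [], Br E3 F2 E1 F2 [], Br E3 F2 E1 F2 [],
         Br E3 F2 E1 F2 []]], Sym 22 4 0, Sym 22 5 0, Sym 19 4 0, Sym 22 4 1, Sym 22 5 1, Sym 19 4 1,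
         Sym 22 4 2, Sym 22 5 2, Sym 19 4 2], Sym 22 2 0, Sym 19 2 0, Sym 6 3 0, Sym 22 3 0, Sym 22 2 1,
         Sym 19 2 1, Sym 22 3 1, Sym 6 3 1, Sym 22 2 2, Sym 19 2 2, Sym 6 3 2, Sym 22 3 2, Sym 11 3 0,
         Sym 11 3 1, Sym 11 3 2, Sym 8 3 0, Sym 8 3 1, Sym 8 3 2, Sym 1 3 0, Sym 14 3 0, Sym 14 3 1,
         Sym 14 3 2, Sym 0 3 0, Sym 0 3 1, Sym 0 3 2, Sym 10 3 0, Sym 4 3 0, Sym 4 3 1, Sym 4 3 2, Sym 13 2 3,
         Sym 3 3 0, Sym 5 3 0, Sym 16 3 0, Sym 23 3 0, Sym 2 3 0, Sym 9 3 0, Sym 17 3 0, Sym 7 3 0, Sym 18 3 0,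
         Sym 20 3 0, Sym 13 2 4, Sym 3 3 1, Sym 23 3 1, Sym 5 3 1, Sym 16 3 1, Sym 17 3 1, Sym 2 3 1,
         Sym 9 3 1, Sym 20 3 1, Sym 7 3 1, Sym 18 3 1, Sym 13 2 5, Sym 3 3 2, Sym 16 3 2, Sym 23 3 2,
         Sym 5 3 2, Sym 9 3 2, Sym 17 3 2, Sym 2 3 2, Sym 18 3 2, Sym 20 3 2, Sym 7 3 2],
     Br E2 F2 E2 F2 [Sym 10 2 3, Sym 0 2 3, Sym 0 2 4, Sym 0 2 5, Sym 8 2 3, Sym 8 2 4, Sym 8 2 5, Sym 7 2 3,
         Sym 20 2 3, Sym 18 2 3, Sym 2 2 3, Sym 17 2 3, Sym 9 2 3, Sym 3 2 3, Sym 13 2 3, Sym 5 2 3,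
         Sym 23 2 3, Sym 16 2 3, Sym 18 2 4, Sym 7 2 4, Sym 20 2 4, Sym 9 2 4, Sym 2 2 4, Sym 17 2 4,
         Sym 3 2 4, Sym 13 2 4, Sym 16 2 4, Sym 5 2 4, Sym 23 2 4, Sym 20 2 5, Sym 18 2 5, Sym 7 2 5,
         Sym 17 2 5, Sym 9 2 5, Sym 2 2 5, Sym 3 2 5, Sym 13 2 5, Sym 23 2 5, Sym 16 2 5, Sym 5 2 5,
         Sym 24 2 0, Br E3 F1 E3 F1 [Sym 8 4 0, Sym 8 4 1, Sym 8 4 2, Sym 0 4 0, Sym 0 4 1, Sym 0 4 2,
         Sym 10 4 0, Sym 7 4 0, Sym 18 4 0, Sym 20 4 0, Sym 13 4 0, Sym 3 4 0, Sym 5 4 0, Sym 16 4 0,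
         Sym 23 4 0, Sym 2 4 0, Sym 9 4 0, Sym 17 4 0, Sym 20 4 1, Sym 7 4 1, Sym 18 4 1, Sym 13 4 1,
         Sym 3 4 1, Sym 23 4 1, Sym 5 4 1, Sym 16 4 1, Sym 17 4 1, Sym 2 4 1, Sym 9 4 1, Sym 18 4 2,
         Sym 20 4 2, Sym 7 4 2, Sym 13 4 2, Sym 3 4 2, Sym 16 4 2, Sym 23 4 2, Sym 5 4 2, Sym 9 4 2,
         Sym 17 4 2, Sym 2 4 2, Sym 8 5 0, Sym 8 5 1, Sym 8 5 2, Sym 0 5 0, Sym 0 5 1, Sym 0 5 2, Sym 10 5 0,
         Sym 13 4 3, Sym 3 5 0, Sym 5 5 0, Sym 16 5 0, Sym 23 5 0, Sym 7 5 0, Sym 18 5 0, Sym 20 5 0,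
         Sym 2 5 0, Sym 9 5 0, Sym 17 5 0, Sym 13 4 4, Sym 3 5 1, Sym 23 5 1, Sym 5 5 1, Sym 16 5 1,
         Sym 20 5 1, Sym 7 5 1, Sym 18 5 1, Sym 17 5 1, Sym 2 5 1, Sym 9 5 1, Sym 13 4 5, Sym 3 5 2,
         Sym 16 5 2, Sym 23 5 2, Sym 5 5 2, Sym 18 5 2, Sym 20 5 2, Sym 7 5 2, Sym 9 5 2, Sym 17 5 2,
         Sym 2 5 2, Br E1 F1 E1 F2 [], Sym 24 4 0, Sym 22 4 0, Sym 22 5 0, Sym 19 4 0, Sym 22 4 1, Sym 22 5 1,
         Sym 19 4 1, Sym 22 4 2, Sym 22 5 2, Sym 19 4 2], Sym 22 2 1, Sym 19 2 2, Sym 22 3 1, Sym 6 3 2,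
         Sym 22 2 2, Sym 19 2 0, Sym 6 3 0, Sym 22 3 2, Sym 22 2 0, Sym 19 2 1, Sym 22 3 0, Sym 6 3 1,
         Sym 0 3 3, Sym 0 3 4, Sym 0 3 5, Sym 10 3 3, Sym 21 3 3, Sym 15 3 0, Sym 4 3 3, Sym 4 3 4, Sym 4 3 5,
         Sym 11 3 3, Sym 11 3 4, Sym 11 3 5, Sym 8 3 3, Sym 8 3 4, Sym 8 3 5, Sym 14 3 3, Sym 14 3 4,
         Sym 14 3 5, Sym 3 3 3, Sym 13 2 0, Sym 5 3 3, Sym 23 3 3, Sym 16 3 3, Sym 2 3 3, Sym 17 3 3,
         Sym 9 3 3, Sym 7 3 3, Sym 20 3 3, Sym 18 3 3, Sym 3 3 4, Sym 13 2 1, Sym 16 3 4, Sym 5 3 4,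
         Sym 23 3 4, Sym 9 3 4, Sym 2 3 4, Sym 17 3 4, Sym 18 3 4, Sym 7 3 4, Sym 20 3 4, Sym 3 3 5,
         Sym 13 2 2, Sym 23 3 5, Sym 16 3 5, Sym 5 3 5, Sym 17 3 5, Sym 9 3 5, Sym 2 3 5, Sym 20 3 5,
         Sym 18 3 5, Sym 7 3 5]]"

text \<open>All leaves are of the form \<open>Sym\<close>: each completion of one particular half
  collapses or leads to a table that contains a root up to automorphisms.\<close>

fun top_cert :: "ty \<Rightarrow> cert" where
  "top_cert (Ty True True) =
    Br E2 F3 E2 F3 [Sym 4 0 0, Sym 24 0 0, Sym 23 1 1, Sym 12 1 1, Sym 6 0 0, Sym 3 0 0, Sym 9 0 0, Sym 21 1 0,
        Sym 17 0 0, Sym 19 0 1, Sym 13 1 1, Sym 15 0 0, Sym 2 0 0, Sym 11 1 1, Sym 22 0 1, Sym 1 0 0,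
        Sym 7 0 0, Sym 8 0 0, Sym 16 1 0, Sym 20 1 0, Sym 14 1 1, Sym 18 1 1, Sym 10 0 0, Sym 10 0 1,
        Sym 0 1 0, Sym 5 1 0, Sym 0 1 1, Sym 22 0 0, Sym 11 1 0, Sym 2 0 1, Sym 15 0 1, Sym 8 0 1, Sym 7 0 1,
        Sym 1 0 1, Sym 18 1 0, Sym 14 1 0, Sym 20 1 1, Sym 16 1 1, Sym 12 1 0, Sym 23 1 0, Sym 24 0 1,
        Sym 4 0 1, Sym 9 0 1, Sym 3 0 1, Sym 6 0 1, Sym 13 1 0, Sym 19 0 0, Sym 17 0 1, Sym 21 1 1, Sym 25 0 1,
        Sym 26 0 1, Sym 27 0 0, Sym 26 0 0, Sym 25 0 0, Sym 21 0 0, Sym 17 1 0, Sym 19 1 1, Sym 13 0 1,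
        Sym 6 1 0, Sym 3 1 0, Sym 9 1 0, Sym 4 1 0, Sym 24 1 0, Sym 23 0 1, Sym 12 0 1, Sym 16 0 0, Sym 20 0 0,
        Sym 14 0 1, Sym 18 0 1, Sym 1 1 0, Sym 7 1 0, Sym 8 1 0, Sym 15 1 0, Sym 2 1 0, Sym 11 0 1, Sym 22 1 1,
        Sym 0 0 0, Sym 5 0 0, Sym 0 0 1, Sym 10 1 0, Sym 10 1 1, Sym 18 0 0, Sym 14 0 0, Sym 20 0 1,
        Sym 16 0 1, Sym 8 1 1, Sym 7 1 1, Sym 1 1 1, Sym 22 1 0, Sym 11 0 0, Sym 2 1 1, Sym 15 1 1, Sym 13 0 0,
        Sym 19 1 0, Sym 17 1 1, Sym 21 0 1, Sym 9 1 1, Sym 3 1 1, Sym 6 1 1, Sym 12 0 0, Sym 23 0 0,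
        Sym 24 1 1, Sym 4 1 1]"
|   "top_cert (Ty False True) =
    Br E1 F3 E1 F3 [Sym 27 0 1, Sym 30 2 1, Sym 30 4 1, Sym 28 0 1, Sym 29 2 1, Sym 29 4 1, Sym 31 0 0,
        Sym 28 0 0, Sym 29 2 0, Sym 29 4 0, Sym 27 0 0, Sym 30 2 0, Sym 30 4 0, Sym 6 0 1, Sym 21 2 0,
        Sym 7 0 1, Sym 10 0 1, Sym 4 2 0, Sym 24 2 0, Sym 19 2 1, Sym 12 2 1, Sym 13 1 1, Sym 26 3 0,
        Sym 18 5 1, Sym 20 4 1, Sym 22 0 1, Sym 5 0 1, Sym 17 0 1, Sym 11 0 1, Sym 15 0 1, Sym 3 2 0,
        Sym 23 2 1, Sym 14 2 1, Sym 25 1 1, Sym 9 1 1, Sym 8 4 1, Sym 16 4 1, Sym 1 0 1, Sym 32 0 0, Sym 1 0 0,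
        Sym 0 4 0, Sym 2 4 0, Sym 2 4 1, Sym 0 4 1, Sym 11 0 0, Sym 17 0 0, Sym 5 0 0, Sym 22 0 0, Sym 14 2 0,
        Sym 23 2 0, Sym 3 2 1, Sym 15 0 0, Sym 16 4 0, Sym 8 4 0, Sym 9 1 0, Sym 25 1 0, Sym 10 0 0, Sym 7 0 0,
        Sym 21 2 1, Sym 6 0 0, Sym 12 2 0, Sym 19 2 0, Sym 24 2 1, Sym 4 2 1, Sym 20 4 0, Sym 18 5 0,
        Sym 26 3 1, Sym 13 1 0, Sym 6 1 1, Sym 21 4 0, Sym 7 1 1, Sym 10 1 1, Sym 13 0 1, Sym 26 5 0,
        Sym 18 3 1, Sym 20 2 1, Sym 4 4 0, Sym 24 4 0, Sym 19 4 1, Sym 12 4 1, Sym 22 1 1, Sym 5 1 1,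
        Sym 17 1 1, Sym 11 1 1, Sym 25 0 1, Sym 9 0 1, Sym 8 2 1, Sym 16 2 1, Sym 15 1 1, Sym 3 4 0,
        Sym 23 4 1, Sym 14 4 1, Sym 0 2 0, Sym 2 2 0, Sym 2 2 1, Sym 0 2 1, Sym 1 1 1, Sym 32 1 0, Sym 1 1 0,
        Sym 11 1 0, Sym 17 1 0, Sym 5 1 0, Sym 22 1 0, Sym 16 2 0, Sym 8 2 0, Sym 9 0 0, Sym 25 0 0,
        Sym 14 4 0, Sym 23 4 0, Sym 3 4 1, Sym 15 1 0, Sym 10 1 0, Sym 7 1 0, Sym 21 4 1, Sym 6 1 0,
        Sym 20 2 0, Sym 18 3 0, Sym 26 5 1, Sym 13 0 0, Sym 12 4 0, Sym 19 4 0, Sym 24 4 1, Sym 4 4 1]"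
|   "top_cert (Ty True False) =
    Br E2 F1 E2 F1 [Sym 0 1 3, Sym 13 1 3, Sym 13 1 4, Sym 13 1 5, Sym 18 1 3, Sym 16 1 3, Sym 16 1 4,
        Sym 16 1 5, Sym 2 0 3, Sym 12 1 0, Sym 12 1 1, Sym 12 1 2, Sym 7 1 3, Sym 11 1 3, Sym 11 1 4,
        Sym 11 1 5, Sym 14 0 0, Sym 1 1 3, Sym 19 1 3, Sym 20 1 4, Sym 21 1 5, Sym 3 1 3, Sym 5 1 4, Sym 4 1 5,
        Sym 10 1 3, Sym 9 1 4, Sym 17 1 5, Sym 14 0 1, Sym 1 1 4, Sym 21 1 3, Sym 19 1 4, Sym 20 1 5,
        Sym 4 1 3, Sym 3 1 4, Sym 5 1 5, Sym 17 1 3, Sym 10 1 4, Sym 9 1 5, Sym 14 0 2, Sym 1 1 5, Sym 20 1 3,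
        Sym 21 1 4, Sym 19 1 5, Sym 5 1 3, Sym 4 1 4, Sym 3 1 5, Sym 9 1 3, Sym 17 1 4, Sym 10 1 5, Sym 23 0 0,
        Sym 22 0 0, Sym 6 0 0, Sym 8 0 1, Sym 15 0 0, Sym 6 0 3, Sym 8 0 3, Sym 6 0 1, Sym 8 0 2, Sym 15 0 1,
        Sym 6 0 4, Sym 8 0 4, Sym 8 0 0, Sym 6 0 2, Sym 15 0 2, Sym 8 0 5, Sym 6 0 5, Sym 18 0 3, Sym 16 0 3,
        Sym 16 0 4, Sym 16 0 5, Sym 0 0 3, Sym 13 0 3, Sym 13 0 4, Sym 13 0 5, Sym 7 0 3, Sym 11 0 3,
        Sym 11 0 4, Sym 11 0 5, Sym 2 1 3, Sym 12 0 0, Sym 12 0 1, Sym 12 0 2, Sym 10 0 3, Sym 9 0 4,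
        Sym 17 0 5, Sym 3 0 3, Sym 5 0 4, Sym 4 0 5, Sym 14 0 3, Sym 1 0 3, Sym 19 0 3, Sym 20 0 4, Sym 21 0 5,
        Sym 17 0 3, Sym 10 0 4, Sym 9 0 5, Sym 4 0 3, Sym 3 0 4, Sym 5 0 5, Sym 14 0 4, Sym 1 0 4, Sym 21 0 3,
        Sym 19 0 4, Sym 20 0 5, Sym 9 0 3, Sym 17 0 4, Sym 10 0 5, Sym 5 0 3, Sym 4 0 4, Sym 3 0 5, Sym 14 0 5,
        Sym 1 0 5, Sym 20 0 3, Sym 21 0 4, Sym 19 0 5]"
|   "top_cert (Ty False False) =
    Br E1 F1 E1 F1 [Sym 25 0 0, Sym 24 0 0, Sym 19 0 0, Sym 6 0 0, Sym 22 0 0, Sym 6 1 0, Sym 22 1 0,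
        Sym 19 0 1, Sym 22 0 1, Sym 6 0 1, Sym 22 1 1, Sym 6 1 1, Sym 19 0 2, Sym 6 0 2, Sym 22 0 2, Sym 6 1 2,
        Sym 22 1 2, Sym 8 0 0, Sym 8 0 1, Sym 8 0 2, Sym 12 0 0, Sym 1 0 0, Sym 14 0 0, Sym 14 0 1, Sym 14 0 2,
        Sym 11 0 0, Sym 11 0 1, Sym 11 0 2, Sym 10 0 0, Sym 15 0 0, Sym 21 0 0, Sym 4 0 0, Sym 4 0 1,
        Sym 4 0 2, Sym 0 0 0, Sym 0 0 1, Sym 0 0 2, Sym 2 0 0, Sym 9 0 0, Sym 17 0 0, Sym 7 0 0, Sym 18 0 0,
        Sym 20 0 0, Sym 13 0 0, Sym 3 0 0, Sym 5 0 0, Sym 16 0 0, Sym 23 0 0, Sym 17 0 1, Sym 2 0 1, Sym 9 0 1,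
        Sym 20 0 1, Sym 7 0 1, Sym 18 0 1, Sym 13 0 1, Sym 3 0 1, Sym 23 0 1, Sym 5 0 1, Sym 16 0 1, Sym 9 0 2,
        Sym 17 0 2, Sym 2 0 2, Sym 18 0 2, Sym 20 0 2, Sym 7 0 2, Sym 13 0 2, Sym 3 0 2, Sym 16 0 2,
        Sym 23 0 2, Sym 5 0 2, Sym 8 1 0, Sym 8 1 1, Sym 8 1 2, Sym 11 1 0, Sym 11 1 1, Sym 11 1 2, Sym 12 1 0,
        Sym 1 1 0, Sym 14 1 0, Sym 14 1 1, Sym 14 1 2, Sym 10 1 0, Sym 0 1 0, Sym 0 1 1, Sym 0 1 2, Sym 15 1 0,
        Sym 21 1 0, Sym 4 1 0, Sym 4 1 1, Sym 4 1 2, Sym 2 1 0, Sym 9 1 0, Sym 17 1 0, Sym 13 0 3, Sym 3 1 0,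
        Sym 5 1 0, Sym 16 1 0, Sym 23 1 0, Sym 7 1 0, Sym 18 1 0, Sym 20 1 0, Sym 17 1 1, Sym 2 1 1, Sym 9 1 1,
        Sym 13 0 4, Sym 3 1 1, Sym 23 1 1, Sym 5 1 1, Sym 16 1 1, Sym 20 1 1, Sym 7 1 1, Sym 18 1 1, Sym 9 1 2,
        Sym 17 1 2, Sym 2 1 2, Sym 13 0 5, Sym 3 1 2, Sym 16 1 2, Sym 23 1 2, Sym 5 1 2, Sym 18 1 2,
        Sym 20 1 2, Sym 7 1 2]"

text \<open>The root is passed as the only candidate, so that it is inserted into the empty table
  and its consequences are drawn before its certificate is read.\<close>

definition root_ok :: "ty \<Rightarrow> nat \<Rightarrow> bool" where
  "root_ok t k \<longleftrightarrow> kids k t [roots t ! k] [certs t ! k] empty_tab"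

text \<open>In these names \<open>C\<close>, \<open>V\<close> and \<open>S\<close> stand for cyclic,
  Klein four-group and S_3, first for the subgroup of order four and then for that of order six.
  Splitting the ranges keeps each computation small.\<close>

lemma roots_CC_1: "list_all (root_ok (Ty True True)) [0..<26]"
  by code_simp

lemma roots_CC_2: "list_all (root_ok (Ty True True)) [26..<28]"
  by code_simp

lemma roots_VC_1: "list_all (root_ok (Ty False True)) [0..<23]"
  by code_simp

lemma roots_VC_2: "list_all (root_ok (Ty False True)) [23..<31]"
  by code_simp

lemma roots_VC_3: "list_all (root_ok (Ty False True)) [31..<32]"
  by code_simp

lemma roots_VC_4: "list_all (root_ok (Ty False True)) [32..<33]"
  by code_simp

lemma roots_CS_1: "list_all (root_ok (Ty True False)) [0..<18]"
  by code_simp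

lemma roots_CS_2: "list_all (root_ok (Ty True False)) [18..<23]"
  by code_simp

lemma roots_CS_3: "list_all (root_ok (Ty True False)) [23..<24]"
  by code_simp

lemma roots_VS_1: "list_all (root_ok (Ty False False)) [0..<19]"
  by code_simp

lemma roots_VS_2: "list_all (root_ok (Ty False False)) [19..<25]"
  by code_simp

lemma roots_VS_3: "list_all (root_ok (Ty False False)) [25..<26]"
  by code_simp

lemma top_ok: "list_all (\<lambda>t. check (length (roots t)) t (top_cert t) empty_tab)
    [Ty True True, Ty False True, Ty True False, Ty False False]"
  by code_simp

lemma roots_ok: "k < length (roots t) \<Longrightarrow> root_ok t k"
proof -
  assume k: "k < length (roots t)"
  obtain p q where t: "t = Ty p q" by (cases t)
  have *: "list_all Q [i..<j] \<Longrightarrow> i \<le> k \<Longrightarrow> k < j \<Longrightarrow> Q k" for Q i j by (simp add: list_all_iff)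
  show ?thesis
  proof (cases p; cases q)
    assume pq: "p" "q"
    then have "k < 28" using k by (simp add: t)
    then show ?thesis using *[OF roots_CC_1] *[OF roots_CC_2] pq unfolding t by (simp; linarith)
  next
    assume pq: "p" "\<not> q"
    then have "k < 24" using k by (simp add: t)
    then show ?thesis using *[OF roots_CS_1] *[OF roots_CS_2] *[OF roots_CS_3] pq unfolding t by (simp; linarith)
  next
    assume pq: "\<not> p" "q"
    then have "k < 33" using k by (simp add: t)
    then show ?thesis using *[OF roots_VC_1] *[OF roots_VC_2] *[OF roots_VC_3] *[OF roots_VC_4] pq unfolding t by (simp; linarith)
  next
    assume pq: "\<not> p" "\<not> q"
    then have "k < 26" using k by (simp add: t)
    then show ?thesis using *[OF roots_VS_1] *[OF roots_VS_2] *[OF roots_VS_3] pq unfolding t by (simp; linarith)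
  qed
qed

lemma roots_kids: "k < length (roots t) \<Longrightarrow> \<exists>c. kids k t [roots t ! k] [c] empty_tab"
  using roots_ok[of k t] unfolding root_ok_def by (rule exI)

lemma top_check: "check (length (roots t)) t (top_cert t) empty_tab"
proof -
  have "t \<in> set [Ty True True, Ty False True, Ty True False, Ty False False]"
    by (cases t; rename_tac p q; case_tac p; case_tac q; simp)
  then show ?thesis using top_ok unfolding list_all_iff by blast
qed

section \<open>Groups of order four and six\<close>

lemma card_UNIV_E: "card (UNIV :: ee set) = 4" and card_UNIV_F: "card (UNIV :: ff set) = 6"
proof -
  have "(UNIV :: ee set) = {E0, E1, E2, E3}" "(UNIV :: ff set) = {F0, F1, F2, F3, F4, F5}"
    by (rule Set.set_eqI, rename_tac a, case_tac a; simp)+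
  note * = this
  show "card (UNIV :: ee set) = 4" unfolding *(1) by simp
  show "card (UNIV :: ff set) = 6" unfolding *(2) by simp
qed

context group
begin

lemma left_cancel: "x \<in> carrier G \<Longrightarrow> y \<in> carrier G \<Longrightarrow> z \<in> carrier G \<Longrightarrow> x \<otimes> y = x \<otimes> z \<longleftrightarrow> y = z"
  by simp

text \<open>An element with nontrivial square has order four. If there is none, any two different
  nonunits generate a Klein four-group.\<close>

lemma order_4_gens:
  assumes "order G = 4"
  obtains p v where "\<And>q. relE G (Ty p q) v" "\<And>q. range (eps G (Ty p q) v) = carrier G"
proof -
  have fin: "finite (carrier G)" using assms by (metis card.infinite order_def zero_neq_numeral)
  have sub: "S = carrier G" if "S \<subseteq> carrier G" "card S = 4" for S
    using that assms fin by (metis card_subset_eq order_def)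
  show thesis
  proof (cases "\<exists>a \<in> carrier G. a \<otimes> a \<noteq> \<one>")
    case True
    then obtain a where a: "a \<in> carrier G" "a \<otimes> a \<noteq> \<one>" by blast
    have "a [^] (4::nat) = \<one>" using pow_order_eq_1[OF a(1)] assms by simp
    then have a4: "a \<otimes> (a \<otimes> (a \<otimes> a)) = \<one>" using a(1) by (simp add: numeral_eq_Suc m_assoc)
    have "a \<noteq> \<one>" using a by auto
    have "a \<otimes> (a \<otimes> a) \<noteq> \<one>"
    proof
      assume "a \<otimes> (a \<otimes> a) = \<one>"
      then show False using a4 a(1) \<open>a \<noteq> \<one>\<close> by simp
    qed
    have "a \<noteq> a \<otimes> a" using a(1) \<open>a \<noteq> \<one>\<close> by simp
    have "a \<noteq> a \<otimes> (a \<otimes> a)" using a by simp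
    have "a \<otimes> a \<noteq> a \<otimes> (a \<otimes> a)" using a(1) \<open>a \<noteq> \<one>\<close> by simp
    have "card {\<one>, a, a \<otimes> a, a \<otimes> (a \<otimes> a)} = 4"
      using a(2) \<open>a \<noteq> \<one>\<close> \<open>a \<otimes> (a \<otimes> a) \<noteq> \<one>\<close> \<open>a \<noteq> a \<otimes> a\<close> \<open>a \<noteq> a \<otimes> (a \<otimes> a)\<close> \<open>a \<otimes> a \<noteq> a \<otimes> (a \<otimes> a)\<close>
      by auto
    from sub[OF _ this] have S: "{\<one>, a, a \<otimes> a, a \<otimes> (a \<otimes> a)} = carrier G" using a(1) by simp
    have "range (eps G (Ty True q) (\<lambda>_. a)) = {\<one>, a, a \<otimes> a, a \<otimes> (a \<otimes> a)}" for q
    proof (intro equalityI subsetI)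
      fix x assume "x \<in> range (eps G (Ty True q) (\<lambda>_. a))"
      then obtain y where "x = eps G (Ty True q) (\<lambda>_. a) y" by blast
      then show "x \<in> {\<one>, a, a \<otimes> a, a \<otimes> (a \<otimes> a)}" by (cases y) auto
    next
      fix x assume "x \<in> {\<one>, a, a \<otimes> a, a \<otimes> (a \<otimes> a)}"
      then show "x \<in> range (eps G (Ty True q) (\<lambda>_. a))"
        using rangeI[of "eps G (Ty True q) (\<lambda>_. a)" E0] rangeI[of "eps G (Ty True q) (\<lambda>_. a)" E1]
          rangeI[of "eps G (Ty True q) (\<lambda>_. a)" E2] rangeI[of "eps G (Ty True q) (\<lambda>_. a)" E3]
        by (auto simp del: rangeI)
    qed
    then show thesis using S a(1) a4 by (intro that[of True "\<lambda>_. a"]) simp_all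
  next
    case False
    then have sq: "a \<otimes> a = \<one>" if "a \<in> carrier G" for a using that by blast
    have "\<not> carrier G \<subseteq> {\<one>}" using assms card_mono[of "{\<one>}" "carrier G"] by (auto simp: order_def)
    then obtain a where a: "a \<in> carrier G" "a \<noteq> \<one>" by blast
    have "card {\<one>, a} = 2" using a(2) by simp
    then have "\<not> carrier G \<subseteq> {\<one>, a}" using assms card_mono[of "{\<one>, a}" "carrier G"] by (auto simp: order_def)
    then obtain b where b: "b \<in> carrier G" "b \<noteq> \<one>" "b \<noteq> a" by blast
    have ab: "a \<otimes> b \<in> carrier G" using a b by simp
    have "a \<otimes> b \<noteq> \<one>" using a b sq[OF a(1)] left_cancel[of a b a] by auto
    have "a \<otimes> b \<noteq> a" using a b by simp
    have "a \<otimes> b \<noteq> b" using a b by simp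
    have "card {\<one>, a, b, a \<otimes> b} = 4"
      using a(2) b(2,3) \<open>a \<otimes> b \<noteq> \<one>\<close> \<open>a \<otimes> b \<noteq> a\<close> \<open>a \<otimes> b \<noteq> b\<close> by auto
    from sub[OF _ this] have S: "{\<one>, a, b, a \<otimes> b} = carrier G" using a(1) b(1) by simp
    let ?v = "\<lambda>x. if x = A1 then a else b"
    have "range (eps G (Ty False q) ?v) = {\<one>, a, b, a \<otimes> b}" for q
    proof (intro equalityI subsetI)
      fix x assume "x \<in> range (eps G (Ty False q) ?v)"
      then obtain y where "x = eps G (Ty False q) ?v y" by blast
      then show "x \<in> {\<one>, a, b, a \<otimes> b}" by (cases y) auto
    next
      fix x assume "x \<in> {\<one>, a, b, a \<otimes> b}"
      then show "x \<in> range (eps G (Ty False q) ?v)"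
        using rangeI[of "eps G (Ty False q) ?v" E0] rangeI[of "eps G (Ty False q) ?v" E1]
          rangeI[of "eps G (Ty False q) ?v" E2] rangeI[of "eps G (Ty False q) ?v" E3]
        by (auto simp del: rangeI)
    qed
    moreover have "a \<otimes> (b \<otimes> (a \<otimes> b)) = \<one>" using sq[OF ab] a(1) b(1) by (simp add: m_assoc)
    ultimately show thesis using S a(1) b(1) sq by (intro that[of False ?v]) simp_all
  qed
qed

text \<open>Sylow's theorem gives \<open>c\<close> of order three and \<open>s\<close> of order two.
  Their six products exhaust the group, so \<open>s c\<close> can only be \<open>c s\<close> or
  \<open>c c s\<close>; this decides between the cyclic group and S_3.\<close>

lemma order_6_gens:
  assumes "order G = 6"
  obtains q v where "\<And>p. relF G (Ty p q) v" "\<And>p. range (phi G (Ty p q) v) = carrier G"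
proof -
  have fin: "finite (carrier G)" using assms by (metis card.infinite order_def zero_neq_numeral)
  have "prime (3::nat)" "prime (2::nat)" by simp_all
  obtain C where C: "subgroup C G" "card C = 3"
    using sylow_thm[OF \<open>prime 3\<close> is_group, of 1 2] assms fin by auto
  obtain D where D: "subgroup D G" "card D = 2"
    using sylow_thm[OF \<open>prime 2\<close> is_group, of 1 3] assms fin by auto
  have "\<not> C \<subseteq> {\<one>}" using card_mono[of "{\<one>}" C] C(2) by auto
  then obtain c where c: "c \<in> C" "c \<noteq> \<one>" by blast
  have "\<not> D \<subseteq> {\<one>}" using card_mono[of "{\<one>}" D] D(2) by auto
  then obtain s where s: "s \<in> D" "s \<noteq> \<one>" by blast
  have cG: "c \<in> carrier G" and sG: "s \<in> carrier G"
    using c s subgroup.mem_carrier[OF C(1)] subgroup.mem_carrier[OF D(1)] by auto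
  have "c [^]\<^bsub>G\<lparr>carrier := C\<rparr>\<^esub> (3::nat) = \<one>"
    using group.pow_order_eq_1[OF subgroup.subgroup_is_group[OF C(1) is_group], of c] c C(2) by (simp add: order_def)
  then have c3: "c \<otimes> (c \<otimes> c) = \<one>" using cG by (simp add: nat_pow_def numeral_eq_Suc m_assoc)
  have "s [^]\<^bsub>G\<lparr>carrier := D\<rparr>\<^esub> (2::nat) = \<one>"
    using group.pow_order_eq_1[OF subgroup.subgroup_is_group[OF D(1) is_group], of s] s D(2) by (simp add: order_def)
  then have s2: "s \<otimes> s = \<one>" using sG by (simp add: nat_pow_def numeral_eq_Suc)
  have c3': "c \<otimes> (c \<otimes> (c \<otimes> x)) = x" if "x \<in> carrier G" for x
  proof -
    have "c \<otimes> (c \<otimes> (c \<otimes> x)) = (c \<otimes> (c \<otimes> c)) \<otimes> x" using cG that by (simp add: m_assoc)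
    then show ?thesis using c3 that by simp
  qed
  have s2': "s \<otimes> (s \<otimes> x) = x" if "x \<in> carrier G" for x
    using s2 sG that by (simp add: m_assoc[symmetric])
  have "c \<otimes> c \<noteq> \<one>"
  proof
    assume "c \<otimes> c = \<one>"
    then show False using c3 cG c(2) by simp
  qed
  have "c \<noteq> c \<otimes> c" using cG c(2) by simp
  have "s \<noteq> c"
  proof
    assume "s = c" then show False using s2 \<open>c \<otimes> c \<noteq> \<one>\<close> by simp
  qed
  have "s \<noteq> c \<otimes> c"
  proof
    assume "s = c \<otimes> c"
    then have "c \<otimes> (c \<otimes> (c \<otimes> c)) = \<one>" using s2 cG by (simp add: m_assoc)
    then show False using c3'[OF cG] c(2) by simp
  qed
  let ?S = "{\<one>, c, c \<otimes> c, s, c \<otimes> s, c \<otimes> (c \<otimes> s)}"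
  have cancel: "c \<otimes> x = c \<otimes> y \<longleftrightarrow> x = y" if "x \<in> carrier G" "y \<in> carrier G" for x y
    using that cG by simp
  have ne: "\<one> \<noteq> c" "\<one> \<noteq> c \<otimes> c" "\<one> \<noteq> s" "\<one> \<noteq> c \<otimes> s" "\<one> \<noteq> c \<otimes> (c \<otimes> s)" "c \<noteq> c \<otimes> c" "c \<noteq> s" "c \<noteq> c \<otimes> s"
    "c \<noteq> c \<otimes> (c \<otimes> s)" "c \<otimes> c \<noteq> s" "c \<otimes> c \<noteq> c \<otimes> s" "c \<otimes> c \<noteq> c \<otimes> (c \<otimes> s)" "s \<noteq> c \<otimes> s" "s \<noteq> c \<otimes> (c \<otimes> s)"
    "c \<otimes> s \<noteq> c \<otimes> (c \<otimes> s)"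
  proof -
    show 1: "\<one> \<noteq> c \<otimes> s"
      using c3 cG sG cancel[of s "c \<otimes> c"] \<open>s \<noteq> c \<otimes> c\<close> by (simp add: eq_commute)
    have "c \<otimes> (c \<otimes> s) = c \<otimes> (c \<otimes> c) \<longleftrightarrow> s = c" using cancel cG sG by simp
    then show "\<one> \<noteq> c \<otimes> (c \<otimes> s)" using c3 \<open>s \<noteq> c\<close> by metis
    show "c \<noteq> c \<otimes> s" using cancel[of \<one> s] cG sG s(2) by auto
    show "c \<noteq> c \<otimes> (c \<otimes> s)" using cancel[of \<one> "c \<otimes> s"] cG sG 1 by auto
    show "c \<otimes> c \<noteq> c \<otimes> s" using cancel[of c s] cG sG \<open>s \<noteq> c\<close> by auto
    show "c \<otimes> c \<noteq> c \<otimes> (c \<otimes> s)" using cancel[of c "c \<otimes> s"] cancel[of \<one> s] cG sG s(2) by auto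
    show 2: "s \<noteq> c \<otimes> s" using sG cG c(2) by simp
    show "s \<noteq> c \<otimes> (c \<otimes> s)"
    proof
      assume "s = c \<otimes> (c \<otimes> s)"
      then have "(c \<otimes> c) \<otimes> s = s" using cG sG by (simp add: m_assoc)
      then show False using \<open>c \<otimes> c \<noteq> \<one>\<close> cG sG by simp
    qed
    show "c \<otimes> s \<noteq> c \<otimes> (c \<otimes> s)" using cancel[of s "c \<otimes> s"] cG sG 2 by auto
  qed (use c(2) s(2) \<open>c \<otimes> c \<noteq> \<one>\<close> \<open>c \<noteq> c \<otimes> c\<close> \<open>s \<noteq> c\<close> \<open>s \<noteq> c \<otimes> c\<close> in auto)
  have "card ?S = 6" using ne by simp
  moreover have "?S \<subseteq> carrier G" using cG sG by simp
  ultimately have S: "?S = carrier G" using assms fin by (metis card_subset_eq order_def)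
  have "s \<otimes> c \<in> ?S" using cG sG S by simp
  moreover have "s \<otimes> c \<noteq> \<one>" using sG cG s2 \<open>s \<noteq> c\<close> left_cancel[of s c s] by auto
  moreover have "s \<otimes> c \<noteq> c" using sG cG s(2) by simp
  moreover have "s \<otimes> c \<noteq> c \<otimes> c" using sG cG \<open>s \<noteq> c\<close> by simp
  moreover have "s \<otimes> c \<noteq> s" using sG cG c(2) by simp
  ultimately consider "s \<otimes> c = c \<otimes> s" | "s \<otimes> c = c \<otimes> (c \<otimes> s)" by blast
  then show thesis
  proof cases
    case 1
    \<comment> \<open>The product of commuting elements of orders three and two has order six; its
      powers run through the six elements in the order displayed in \<open>v\<close>.\<close>
    let ?b = "c \<otimes> s" and ?v = "\<lambda>_. c \<otimes> s"
    have com: "s \<otimes> (c \<otimes> x) = c \<otimes> (s \<otimes> x)" if "x \<in> carrier G" for x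
      using 1 cG sG that by (simp add: m_assoc[symmetric])
    note simps = m_assoc com 1 s2 s2' c3 c3' cG sG
    have pw: "?b \<otimes> ?b = c \<otimes> c" "?b \<otimes> (?b \<otimes> ?b) = s" "?b \<otimes> (?b \<otimes> (?b \<otimes> ?b)) = c"
      "?b \<otimes> (?b \<otimes> (?b \<otimes> (?b \<otimes> ?b))) = c \<otimes> (c \<otimes> s)" "?b \<otimes> (?b \<otimes> (?b \<otimes> (?b \<otimes> (?b \<otimes> ?b)))) = \<one>"
      by (simp_all add: simps)
    have v: "phi G (Ty p True) ?v y = pickF y \<one> ?b (c \<otimes> c) s c (c \<otimes> (c \<otimes> s))" for p y
      unfolding phi.simps by (cases y; simp add: simps)
    have "range (phi G (Ty p True) ?v) = ?S" for p
    proof (intro equalityI subsetI)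
      fix x assume "x \<in> range (phi G (Ty p True) ?v)"
      then obtain y where "x = phi G (Ty p True) ?v y" by blast
      then show "x \<in> ?S" unfolding v by (cases y) auto
    next
      fix x assume "x \<in> ?S"
      then show "x \<in> range (phi G (Ty p True) ?v)"
        using rangeI[of "phi G (Ty p True) ?v" F0] rangeI[of "phi G (Ty p True) ?v" F1]
          rangeI[of "phi G (Ty p True) ?v" F2] rangeI[of "phi G (Ty p True) ?v" F3]
          rangeI[of "phi G (Ty p True) ?v" F4] rangeI[of "phi G (Ty p True) ?v" F5]
        unfolding v by (auto simp del: rangeI)
    qed
    then show thesis using S cG sG pw(5) by (intro that[of True ?v]) simp_all
  next
    case 2
    let ?v = "\<lambda>x. if x = B1 then s else c"
    have "range (phi G (Ty p False) ?v) = ?S" for p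
    proof (intro equalityI subsetI)
      fix x assume "x \<in> range (phi G (Ty p False) ?v)"
      then obtain y where "x = phi G (Ty p False) ?v y" by blast
      then show "x \<in> ?S" by (cases y) auto
    next
      fix x assume "x \<in> ?S"
      then show "x \<in> range (phi G (Ty p False) ?v)"
        using rangeI[of "phi G (Ty p False) ?v" F0] rangeI[of "phi G (Ty p False) ?v" F1]
          rangeI[of "phi G (Ty p False) ?v" F2] rangeI[of "phi G (Ty p False) ?v" F3]
          rangeI[of "phi G (Ty p False) ?v" F4] rangeI[of "phi G (Ty p False) ?v" F5]
        by (auto simp del: rangeI)
    qed
    moreover have "s \<otimes> (c \<otimes> (s \<otimes> c)) = \<one>"
    proof -
      have "s \<otimes> (c \<otimes> (s \<otimes> c)) = s \<otimes> (c \<otimes> (c \<otimes> (c \<otimes> s)))" unfolding 2 ..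
      then show ?thesis using c3' s2 sG by simp
    qed
    ultimately show thesis using S cG sG s2 c3 by (intro that[of False ?v]) simp_all
  qed
qed

text \<open>Each component of a type concerns one subgroup only, and the two lemmas above leave the
  other component arbitrary, so the two choices combine. The identifications are injective by
  counting.\<close>

lemma subgroup_gens:
  assumes "subgroup E G" "card E = 4" "subgroup F G" "card F = 6"
  obtains t \<epsilon> \<phi> where "amalgam G t \<epsilon> \<phi>" "range \<epsilon> = E" "range \<phi> = F" "inj \<epsilon>" "inj \<phi>"
proof -
  interpret E: group "G\<lparr>carrier := E\<rparr>" by (rule subgroup.subgroup_is_group[OF assms(1) is_group])
  interpret F: group "G\<lparr>carrier := F\<rparr>" by (rule subgroup.subgroup_is_group[OF assms(3) is_group])
  have "order (G\<lparr>carrier := E\<rparr>) = 4" "order (G\<lparr>carrier := F\<rparr>) = 6"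
    using assms(2,4) by (simp_all add: order_def)
  note order = this
  obtain p v where v: "\<And>q. relE (G\<lparr>carrier := E\<rparr>) (Ty p q) v"
      "\<And>q. range (eps (G\<lparr>carrier := E\<rparr>) (Ty p q) v) = carrier (G\<lparr>carrier := E\<rparr>)"
    by (rule E.order_4_gens[OF order(1)]) (rule that; assumption)
  obtain q u where u: "\<And>p. relF (G\<lparr>carrier := F\<rparr>) (Ty p q) u"
      "\<And>p. range (phi (G\<lparr>carrier := F\<rparr>) (Ty p q) u) = carrier (G\<lparr>carrier := F\<rparr>)"
    by (rule F.order_6_gens[OF order(2)]) (rule that; assumption)
  let ?t = "Ty p q"
  have relE: "relE G ?t v" and relF: "relF G ?t u"
    using v(1)[of q] u(1)[of p] subgroup.mem_carrier[OF assms(1)] subgroup.mem_carrier[OF assms(3)] by (auto split: if_splits)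
  have "eps (G\<lparr>carrier := E\<rparr>) ?t v = eps G ?t v" "phi (G\<lparr>carrier := F\<rparr>) ?t u = phi G ?t u"
    by (simp_all add: fun_eq_iff)
  then have rng: "range (eps G ?t v) = E" "range (phi G ?t u) = F" using v(2)[of q] u(2)[of p] by simp_all
  have fin: "finite (UNIV :: ee set)" "finite (UNIV :: ff set)"
    using card_UNIV_E card_UNIV_F by (metis card.infinite zero_neq_numeral)+
  have "inj (eps G ?t v)" "inj (phi G ?t u)"
    using rng assms(2,4) card_UNIV_E card_UNIV_F by (auto intro!: eq_card_imp_inj_on fin)
  moreover have "amalgam G ?t (eps G ?t v) (phi G ?t u)"
    by unfold_locales (auto simp: eps_mult[OF relE] phi_mult[OF relF] simp del: eps.simps phi.simps)
  ultimately show thesis using that rng by blast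
qed

end

section \<open>Groups that are regular on edges\<close>

text \<open>A group acting on a bipartite graph, simply transitively on the edges; \<open>p0\<close> and \<open>l0\<close> are the
  ends of a fixed edge.\<close>

locale edge_regular = group H for H (structure) +
  fixes X :: "'v graph" and act :: "'a \<Rightarrow> 'v \<Rightarrow> 'v" and P Ls :: "'v set" and p0 l0 :: 'v
  assumes act_mult: "g \<in> carrier H \<Longrightarrow> h \<in> carrier H \<Longrightarrow> v \<in> P \<union> Ls \<Longrightarrow> act (g \<otimes> h) v = act g (act h v)"
    and act_one: "v \<in> P \<union> Ls \<Longrightarrow> act \<one> v = v"
    and act_P: "g \<in> carrier H \<Longrightarrow> v \<in> P \<Longrightarrow> act g v \<in> P"
    and act_L: "g \<in> carrier H \<Longrightarrow> v \<in> Ls \<Longrightarrow> act g v \<in> Ls"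
    and act_edge: "g \<in> carrier H \<Longrightarrow> p \<in> P \<Longrightarrow> l \<in> Ls \<Longrightarrow> {p, l} \<in> edges X \<Longrightarrow> {act g p, act g l} \<in> edges X"
    and verts: "verts X = P \<union> Ls" "P \<inter> Ls = {}"
    and edges: "e \<in> edges X \<Longrightarrow> \<exists>p \<in> P. \<exists>l \<in> Ls. e = {p, l}"
    and base: "p0 \<in> P" "l0 \<in> Ls" "{p0, l0} \<in> edges X"
    and regular: "p \<in> P \<Longrightarrow> l \<in> Ls \<Longrightarrow> {p, l} \<in> edges X \<Longrightarrow> \<exists>!g. g \<in> carrier H \<and> act g p0 = p \<and> act g l0 = l"
begin

definition E where "E = {g \<in> carrier H. act g l0 = l0}"
definition F where "F = {g \<in> carrier H. act g p0 = p0}"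

lemma act_inv: "g \<in> carrier H \<Longrightarrow> v \<in> P \<union> Ls \<Longrightarrow> act (inv g) (act g v) = v"
  using act_mult[of "inv g" g v] act_one by simp

lemma act_eq: "g \<in> carrier H \<Longrightarrow> h \<in> carrier H \<Longrightarrow> v \<in> P \<union> Ls \<Longrightarrow> act g v = act h v \<longleftrightarrow> act (inv g \<otimes> h) v = v"
proof -
  assume *: "g \<in> carrier H" "h \<in> carrier H" "v \<in> P \<union> Ls"
  have hv: "act h v \<in> P \<union> Ls" using * act_P act_L by blast
  have "act g (act (inv g) (act h v)) = act h v"
    using act_mult[of g "inv g" "act h v"] act_one[OF hv] * hv by simp
  moreover have "act (inv g \<otimes> h) v = act (inv g) (act h v)" using act_mult * by simp
  moreover have "act (inv g) (act g v) = v" using act_inv * by simp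
  ultimately show ?thesis by metis
qed

lemma subgroup_E: "subgroup E H" and subgroup_F: "subgroup F H"
proof -
  have "subgroup {g \<in> carrier H. act g v = v} H" if v: "v \<in> P \<union> Ls" for v
  proof (rule subgroupI)
    show "{g \<in> carrier H. act g v = v} \<noteq> {}" using act_one[OF v] by auto
    show "inv g \<in> {g \<in> carrier H. act g v = v}" if "g \<in> {g \<in> carrier H. act g v = v}" for g
      using that act_inv[of g v] v by auto
    show "g \<otimes> h \<in> {g \<in> carrier H. act g v = v}"
      if "g \<in> {g \<in> carrier H. act g v = v}" "h \<in> {g \<in> carrier H. act g v = v}" for g h
      using that act_mult v by simp
  qed auto
  then show "subgroup E H" "subgroup F H" unfolding E_def F_def using base by auto
qed

lemma E_carrier: "x \<in> E \<Longrightarrow> x \<in> carrier H" and F_carrier: "x \<in> F \<Longrightarrow> x \<in> carrier H"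
  by (simp_all add: E_def F_def)

lemma act_l0: "g \<in> carrier H \<Longrightarrow> h \<in> carrier H \<Longrightarrow> act g l0 = act h l0 \<longleftrightarrow> inv g \<otimes> h \<in> E"
  using act_eq base by (simp add: E_def)

lemma act_p0: "g \<in> carrier H \<Longrightarrow> h \<in> carrier H \<Longrightarrow> act g p0 = act h p0 \<longleftrightarrow> inv g \<otimes> h \<in> F"
  using act_eq base by (simp add: F_def)

lemma act_E: "g \<in> carrier H \<Longrightarrow> e \<in> E \<Longrightarrow> act (g \<otimes> e) l0 = act g l0"
  using act_mult base by (simp add: E_def)

lemma act_F: "g \<in> carrier H \<Longrightarrow> f \<in> F \<Longrightarrow> act (g \<otimes> f) p0 = act g p0"
  using act_mult base by (simp add: F_def)

lemma E_Int_F: "x \<in> E \<Longrightarrow> x \<in> F \<Longrightarrow> x = \<one>"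
  using regular[OF base] act_one base unfolding E_def F_def by auto

lemma edge: "g \<in> carrier H \<Longrightarrow> {act g p0, act g l0} \<in> edges X"
  using act_edge base by simp

lemma edge_unique:
  assumes "g \<in> carrier H" "h \<in> carrier H" "act g p0 = act h p0" "act g l0 = act h l0" shows "g = h"
  using regular[OF act_P[OF assms(1) base(1)] act_L[OF assms(1) base(2)] edge[OF assms(1)]] assms by (elim ex1E) metis

lemma edge_obtain:
  assumes "p \<in> P" "l \<in> Ls" "{p, l} \<in> edges X"
  obtains g where "g \<in> carrier H" "act g p0 = p" "act g l0 = l"
  using regular[OF assms] by blast

lemma neighbour_line:
  assumes "g \<in> carrier H" "l \<in> Ls" "{act g p0, l} \<in> edges X"
  obtains f where "f \<in> F" "l = act (g \<otimes> f) l0"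
proof -
  obtain h where h: "h \<in> carrier H" "act h p0 = act g p0" "act h l0 = l"
    using edge_obtain[OF act_P[OF assms(1) base(1)] assms(2,3)] by blast
  then have "inv g \<otimes> h \<in> F" using act_p0[of g h] assms(1) by simp
  moreover have "l = act (g \<otimes> (inv g \<otimes> h)) l0" using h assms(1) by (simp add: m_assoc[symmetric])
  ultimately show thesis using that by blast
qed

lemma neighbour_point:
  assumes "g \<in> carrier H" "p \<in> P" "{p, act g l0} \<in> edges X"
  obtains e where "e \<in> E" "p = act (g \<otimes> e) p0"
proof -
  obtain h where h: "h \<in> carrier H" "act h p0 = p" "act h l0 = act g l0"
    using edge_obtain[OF assms(2) act_L[OF assms(1) base(2)] assms(3)] by blast
  then have "inv g \<otimes> h \<in> E" using act_l0[of g h] assms(1) by simp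
  moreover have "p = act (g \<otimes> (inv g \<otimes> h)) p0" using h assms(1) by (simp add: m_assoc[symmetric])
  ultimately show thesis using that by blast
qed

lemma adjacent_types: "{u, v} \<in> edges X \<Longrightarrow> (u \<in> P \<and> v \<in> Ls) \<or> (u \<in> Ls \<and> v \<in> P)"
  using edges[of "{u, v}"] by (auto simp: doubleton_eq_iff)

text \<open>An orbit-stabilizer count: the stabilizer of \<open>l0\<close> acts simply transitively
  on the edges at \<open>l0\<close>.\<close>

lemma card_E: "card E = card {e \<in> edges X. l0 \<in> e}"
proof (rule bij_betw_same_card[of "\<lambda>g. {act g p0, l0}"])
  show "bij_betw (\<lambda>g. {act g p0, l0}) E {e \<in> edges X. l0 \<in> e}"
    unfolding bij_betw_def
  proof
    show "inj_on (\<lambda>g. {act g p0, l0}) E"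
    proof (rule inj_onI)
      fix g h assume gh: "g \<in> E" "h \<in> E" "{act g p0, l0} = {act h p0, l0}"
      then have "act g p0 = act h p0" by (auto simp: doubleton_eq_iff)
      moreover have "act g l0 = act h l0" using gh by (simp add: E_def)
      ultimately show "g = h"
        using edge_unique[of g h] gh E_carrier by simp
    qed
    show "(\<lambda>g. {act g p0, l0}) ` E = {e \<in> edges X. l0 \<in> e}"
    proof (intro equalityI subsetI)
      fix e assume "e \<in> (\<lambda>g. {act g p0, l0}) ` E"
      then obtain g where "g \<in> carrier H" "act g l0 = l0" "e = {act g p0, l0}" by (auto simp: E_def)
      then show "e \<in> {e \<in> edges X. l0 \<in> e}" using edge[of g] by simp
    next
      fix e assume e: "e \<in> {e \<in> edges X. l0 \<in> e}"
      then obtain p l where pl: "p \<in> P" "l \<in> Ls" "e = {p, l}" using edges by blast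
      then have "l = l0" using e base verts by auto
      then obtain g where "g \<in> carrier H" "act g p0 = p" "act g l0 = l0" using edge_obtain pl e by blast
      then show "e \<in> (\<lambda>g. {act g p0, l0}) ` E" using pl \<open>l = l0\<close> by (auto simp: E_def)
    qed
  qed
qed

lemma card_F: "card F = card {e \<in> edges X. p0 \<in> e}"
proof (rule bij_betw_same_card[of "\<lambda>g. {p0, act g l0}"])
  show "bij_betw (\<lambda>g. {p0, act g l0}) F {e \<in> edges X. p0 \<in> e}"
    unfolding bij_betw_def
  proof
    show "inj_on (\<lambda>g. {p0, act g l0}) F"
    proof (rule inj_onI)
      fix g h assume gh: "g \<in> F" "h \<in> F" "{p0, act g l0} = {p0, act h l0}"
      then have "act g l0 = act h l0" by (auto simp: doubleton_eq_iff)
      moreover have "act g p0 = act h p0" using gh by (simp add: F_def)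
      ultimately show "g = h"
        using edge_unique[of g h] gh F_carrier by simp
    qed
    show "(\<lambda>g. {p0, act g l0}) ` F = {e \<in> edges X. p0 \<in> e}"
    proof (intro equalityI subsetI)
      fix e assume "e \<in> (\<lambda>g. {p0, act g l0}) ` F"
      then obtain g where "g \<in> carrier H" "act g p0 = p0" "e = {p0, act g l0}" by (auto simp: F_def)
      then show "e \<in> {e \<in> edges X. p0 \<in> e}" using edge[of g] by simp
    next
      fix e assume e: "e \<in> {e \<in> edges X. p0 \<in> e}"
      then obtain p l where pl: "p \<in> P" "l \<in> Ls" "e = {p, l}" using edges by blast
      then have "p = p0" using e base verts by auto
      then obtain g where "g \<in> carrier H" "act g p0 = p0" "act g l0 = l" using edge_obtain pl e by blast
      then show "e \<in> (\<lambda>g. {p0, act g l0}) ` F" using pl \<open>p = p0\<close> by (auto simp: F_def)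
    qed
  qed
qed

text \<open>A walk from \<open>p0\<close> to the line \<open>act x l0\<close> determines the factors
  one by one: each further vertex is reached by another letter from F or E. The diameter allows four
  edges, parity only three, and the last factor fixes \<open>l0\<close>.\<close>

lemma cover_FEFE:
  assumes diam: "diameter X \<le> 4" and x: "x \<in> carrier H"
  obtains f e f' e' where "f \<in> F" "e \<in> E" "f' \<in> F" "e' \<in> E" "x = f \<otimes> e \<otimes> f' \<otimes> e'"
proof -
  have one: "\<one> \<in> E" "\<one> \<in> F" using subgroup_E subgroup_F by (simp_all add: subgroup.one_closed)
  let ?l = "act x l0"
  have l: "?l \<in> Ls" using act_L x base by blast
  have "distance X p0 ?l \<le> diameter X"
    unfolding diameter_def using base l verts by (intro SUP_upper2[of p0] SUP_upper2[of ?l]) auto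
  then have "distance X p0 ?l \<le> 4" using diam by simp
  have "\<exists>w \<in> walks X p0 ?l. length w - 1 \<le> 4"
  proof (rule ccontr)
    assume "\<not> ?thesis"
    then have "enat 5 \<le> distance X p0 ?l" unfolding distance_def by (intro INF_greatest) auto
    then have "enat 5 \<le> 4" using \<open>distance X p0 ?l \<le> 4\<close> by (rule order_trans)
    then show False by (simp add: numeral_eq_enat)
  qed
  then obtain w where w: "w \<noteq> []" "successively (adjacent X) w" "hd w = p0" "last w = ?l" "length w \<le> 5"
    by (auto simp: walks_def)
  have nP: "v \<notin> P" if "v \<in> Ls" for v using that verts by auto
  have step: "v \<in> Ls" if "{u, v} \<in> edges X" "u \<in> P" for u v using adjacent_types[OF that(1)] that(2) nP by auto
  have step': "v \<in> P" if "{u, v} \<in> edges X" "u \<in> Ls" for u v using adjacent_types[OF that(1)] that(2) nP by auto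
  have first: "\<exists>f \<in> F. v = act f l0" if e: "{p0, v} \<in> edges X" for v
  proof -
    have "{act \<one> p0, v} \<in> edges X" using e act_one base by simp
    then obtain f where "f \<in> F" "v = act (\<one> \<otimes> f) l0"
      using neighbour_line[of \<one> v] step[OF e base(1)] by auto
    then show ?thesis using F_carrier by auto
  qed
  obtain w1 where w1: "w = p0 # w1" using w(1,3) by (cases w) auto
  have "w1 \<noteq> []" using w w1 l base nP by auto
  then obtain v1 w2 where w2: "w1 = v1 # w2" by (cases w1) auto
  have e1: "{p0, v1} \<in> edges X" using w(2) w1 w2 by simp
  obtain f where f: "f \<in> F" "v1 = act f l0" using first[OF e1] by blast
  show thesis
  proof (cases w2)
    case Nil
    then have "act f l0 = ?l" using w(4) w1 w2 f by simp
    then have "inv f \<otimes> x \<in> E" using act_l0 f x F_carrier by simp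
    moreover have "x = f \<otimes> \<one> \<otimes> \<one> \<otimes> (inv f \<otimes> x)" using f x F_carrier by (simp add: m_assoc[symmetric])
    ultimately show thesis using that f one by blast
  next
    case (Cons v2 w3)
    have e2: "{v1, v2} \<in> edges X" using w(2) w1 w2 Cons by simp
    have v2: "v2 \<in> P" using step'[OF e2] step[OF e1 base(1)] by simp
    obtain e where e: "e \<in> E" "v2 = act (f \<otimes> e) p0"
      using neighbour_point[of f v2] e2 v2 f F_carrier by (auto simp: insert_commute)
    have "w3 \<noteq> []" using w(4) w1 w2 Cons l v2 nP by auto
    then obtain v3 w4 where w3: "w3 = v3 # w4" by (cases w3) auto
    have e3: "{v2, v3} \<in> edges X" using w(2) w1 w2 Cons w3 by simp
    have v3: "v3 \<in> Ls" using step[OF e3 v2] .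
    have fe: "f \<otimes> e \<in> carrier H" using f e E_carrier F_carrier by simp
    obtain f' where f': "f' \<in> F" "v3 = act (f \<otimes> e \<otimes> f') l0"
      using neighbour_line[of "f \<otimes> e" v3] e3 v3 e fe by auto
    \<comment> \<open>A fifth vertex would be the end of the walk and a point, whereas the walk ends
      in a line.\<close>
    have "w4 = []"
    proof (rule ccontr)
      assume "w4 \<noteq> []"
      then obtain v4 w5 where w4: "w4 = v4 # w5" by (cases w4) auto
      have "w5 = []" using w(5) w1 w2 Cons w3 w4 by simp
      then have "v4 = ?l" using w(4) w1 w2 Cons w3 w4 by simp
      moreover have "{v3, v4} \<in> edges X" using w(2) w1 w2 Cons w3 w4 by simp
      ultimately show False using step'[of v3 v4] v3 l nP by auto
    qed
    then have eq: "act (f \<otimes> e \<otimes> f') l0 = ?l" using w(4) w1 w2 Cons w3 f' by simp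
    have fef: "f \<otimes> e \<otimes> f' \<in> carrier H" using fe f' F_carrier by simp
    have "inv (f \<otimes> e \<otimes> f') \<otimes> x \<in> E" using act_l0[OF fef x] eq by simp
    moreover have "x = f \<otimes> e \<otimes> f' \<otimes> (inv (f \<otimes> e \<otimes> f') \<otimes> x)" using fef x by (simp add: m_assoc[symmetric])
    ultimately show thesis using that f e f' by blast
  qed
qed

lemma act_neq_l0:
  assumes "g \<in> carrier H" "f \<in> F" "f \<noteq> \<one>" "e \<in> E" shows "act (g \<otimes> f \<otimes> e) l0 \<noteq> act g l0"
proof
  assume "act (g \<otimes> f \<otimes> e) l0 = act g l0"
  then have "act g l0 = act (g \<otimes> f) l0" using act_E assms F_carrier by simp
  then have "inv g \<otimes> (g \<otimes> f) \<in> E" using act_l0[of g "g \<otimes> f"] assms F_carrier by simp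
  then have "f \<in> E" using assms F_carrier by (simp add: m_assoc[symmetric])
  then show False using E_Int_F assms by blast
qed

lemma act_neq_p0:
  assumes "g \<in> carrier H" "e \<in> E" "e \<noteq> \<one>" "f \<in> F" shows "act (g \<otimes> e \<otimes> f) p0 \<noteq> act g p0"
proof
  assume "act (g \<otimes> e \<otimes> f) p0 = act g p0"
  then have "act g p0 = act (g \<otimes> e) p0" using act_F assms E_carrier by simp
  then have "inv g \<otimes> (g \<otimes> e) \<in> F" using act_p0[of g "g \<otimes> e"] assms E_carrier by simp
  then have "e \<in> F" using assms E_carrier by (simp add: m_assoc[symmetric])
  then show False using E_Int_F assms by blast
qed

lemma edges_EF:
  assumes "g \<in> carrier H" "e \<in> E" "f \<in> F"
  shows "{act g l0, act (g \<otimes> e) p0} \<in> edges X" and "{act (g \<otimes> e) p0, act (g \<otimes> e \<otimes> f) l0} \<in> edges X"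
proof -
  have c: "g \<otimes> e \<in> carrier H" "g \<otimes> e \<otimes> f \<in> carrier H" using assms E_carrier F_carrier by auto
  show "{act g l0, act (g \<otimes> e) p0} \<in> edges X"
    using edge[OF c(1)] act_E[OF assms(1,2)] by (simp add: insert_commute)
  show "{act (g \<otimes> e) p0, act (g \<otimes> e \<otimes> f) l0} \<in> edges X"
    using edge[OF c(2)] act_F[OF c(1) assms(3)] by (simp add: insert_commute)
qed

lemma no_quadrilateral:
  assumes "8 \<le> girth X" "u \<in> Ls" "p \<in> P" "v \<in> Ls" "q \<in> P" "u \<noteq> v" "p \<noteq> q"
    and "{u, p} \<in> edges X" "{p, v} \<in> edges X" "{v, q} \<in> edges X" "{q, u} \<in> edges X"
  shows False
proof -
  have "x \<noteq> y" "y \<noteq> x" if "x \<in> P" "y \<in> Ls" for x y using that verts by auto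
  then have "[u, p, v, q] \<in> cycles X"
    using assms verts by (simp add: cycles_def)
  then have "girth X \<le> enat 4" unfolding girth_def by (rule INF_lower2) simp
  with assms(1) have "8 \<le> enat 4" by (rule order_trans)
  then show False by (simp add: numeral_eq_enat)
qed

lemma no_hexagon:
  assumes "8 \<le> girth X" "u \<in> Ls" "p \<in> P" "v \<in> Ls" "q \<in> P" "w \<in> Ls" "r \<in> P"
    and "u \<noteq> v" "v \<noteq> w" "u \<noteq> w" "p \<noteq> q" "q \<noteq> r" "p \<noteq> r"
    and "{u, p} \<in> edges X" "{p, v} \<in> edges X" "{v, q} \<in> edges X" "{q, w} \<in> edges X" "{w, r} \<in> edges X" "{r, u} \<in> edges X"
  shows False
proof -
  have "x \<noteq> y" "y \<noteq> x" if "x \<in> P" "y \<in> Ls" for x y using that verts by auto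
  then have "[u, p, v, q, w, r] \<in> cycles X"
    using assms verts by (simp add: cycles_def)
  then have "girth X \<le> enat 6" unfolding girth_def by (rule INF_lower2) simp
  with assms(1) have "8 \<le> enat 6" by (rule order_trans)
  then show False by (simp add: numeral_eq_enat)
qed

text \<open>The prefixes of the product carry the base edge along a walk \<open>l0\<close>,
  \<open>a p0\<close>, \<open>a b l0\<close>, and so on, which a trivial product would close.
  Nontrivial letters make consecutive lines and consecutive points of the walk distinct. In a closed
  walk with four or six edges any two lines, and any two points, are consecutive, so it is a cycle
  of that length. Length two is excluded because the stabilizers intersect trivially.\<close>

lemma girth_words:
  assumes girth: "8 \<le> girth X"
    and EF: "a \<in> E" "b \<in> F" "c \<in> E" "d \<in> F" "e \<in> E" "f \<in> F"
    and ne: "a \<noteq> \<one>" "b \<noteq> \<one>" "c \<noteq> \<one>" "d \<noteq> \<one>"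
  shows "a \<otimes> b \<noteq> \<one>" and "a \<otimes> b \<otimes> c \<otimes> d \<noteq> \<one>" and "e \<noteq> \<one> \<Longrightarrow> f \<noteq> \<one> \<Longrightarrow> a \<otimes> b \<otimes> c \<otimes> d \<otimes> e \<otimes> f \<noteq> \<one>"
proof -
  have oneE: "\<one> \<in> E" and oneF: "\<one> \<in> F" using subgroup_E subgroup_F by (simp_all add: subgroup.one_closed)
  have cl: "a \<in> carrier H" "b \<in> carrier H" "c \<in> carrier H" "d \<in> carrier H" "e \<in> carrier H" "f \<in> carrier H"
    using EF E_carrier F_carrier by auto
  have ty: "act g l0 \<in> Ls" "act g p0 \<in> P" if "g \<in> carrier H" for g
    using act_L[OF that base(2)] act_P[OF that base(1)] by auto
  show "a \<otimes> b \<noteq> \<one>"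
  proof
    assume "a \<otimes> b = \<one>"
    then have "inv b = a" using cl by (intro inv_equality)
    then have "a \<in> F" using subgroup.m_inv_closed[OF subgroup_F EF(2)] by simp
    then show False using E_Int_F EF ne by blast
  qed
  define g1 g2 g3 g4 g5 where g: "g1 = a" "g2 = g1 \<otimes> b" "g3 = g2 \<otimes> c" "g4 = g3 \<otimes> d" "g5 = g4 \<otimes> e"
  have gc: "g1 \<in> carrier H" "g2 \<in> carrier H" "g3 \<in> carrier H" "g4 \<in> carrier H" "g5 \<in> carrier H"
    using cl by (simp_all add: g)
  have adj: "{act \<one> l0, act g1 p0} \<in> edges X" "{act g1 p0, act g2 l0} \<in> edges X" "{act g2 l0, act g3 p0} \<in> edges X"
    "{act g3 p0, act g4 l0} \<in> edges X" "{act g4 l0, act g5 p0} \<in> edges X" "{act g5 p0, act (g5 \<otimes> f) l0} \<in> edges X"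
    using edges_EF[OF one_closed EF(1,2)] edges_EF[OF gc(2) EF(3,4)] edges_EF[OF gc(4) EF(5,6)] cl by (simp_all add: g)
  have l: "act \<one> l0 = act g1 l0" "act g3 l0 = act g2 l0" "act g5 l0 = act g4 l0"
    using act_E[OF one_closed EF(1)] act_E[OF gc(2) EF(3)] act_E[OF gc(4) EF(5)] cl by (simp_all add: g)
  have p: "act g2 p0 = act g1 p0" "act g4 p0 = act g3 p0" "act (g5 \<otimes> f) p0 = act g5 p0"
    using act_F[OF gc(1) EF(2)] act_F[OF gc(3) EF(4)] act_F[OF gc(5) EF(6)] by (simp_all add: g)
  have nl: "act g2 l0 \<noteq> act g1 l0" "act g4 l0 \<noteq> act g3 l0"
    using act_neq_l0[OF gc(1) EF(2) ne(2) oneE] act_neq_l0[OF gc(3) EF(4) ne(4) oneE] gc by (simp_all add: g)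
  have np: "act g3 p0 \<noteq> act g2 p0"
    using act_neq_p0[OF gc(2) EF(3) ne(3) oneF] gc by (simp_all add: g)
  show "a \<otimes> b \<otimes> c \<otimes> d \<noteq> \<one>"
  proof
    assume "a \<otimes> b \<otimes> c \<otimes> d = \<one>"
    then have g4: "g4 = \<one>" by (simp add: g)
    show False
      by (rule no_quadrilateral[OF girth ty(1)[OF one_closed] ty(2)[OF gc(1)] ty(1)[OF gc(2)] ty(2)[OF gc(3)] _ _ adj(1-3)])
        (use nl(1) np l(1) p(1) adj(4) g4 in auto)
  qed
  show "a \<otimes> b \<otimes> c \<otimes> d \<otimes> e \<otimes> f \<noteq> \<one>" if "e \<noteq> \<one>" "f \<noteq> \<one>"
  proof
    assume "a \<otimes> b \<otimes> c \<otimes> d \<otimes> e \<otimes> f = \<one>"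
    then have g6: "g5 \<otimes> f = \<one>" by (simp add: g)
    have "act (g5 \<otimes> f) l0 \<noteq> act g5 l0" "act g5 p0 \<noteq> act g4 p0"
      using act_neq_l0[OF gc(5) EF(6) that(2) oneE] act_neq_p0[OF gc(4) EF(5) that(1) oneF] gc cl by (simp_all add: g)
    moreover have "act g1 p0 \<noteq> act \<one> p0"
      using act_neq_p0[OF one_closed EF(1) ne(1) oneF] cl by (simp add: g)
    ultimately show False
      by (intro no_hexagon[OF girth ty(1)[OF one_closed] ty(2)[OF gc(1)] ty(1)[OF gc(2)] ty(2)[OF gc(3)]
            ty(1)[OF gc(4)] ty(2)[OF gc(5)] _ _ _ _ _ _ adj(1-5)])
        (use nl np l p adj(6) g6 in auto)
  qed
qed

end

lemma alt_SE: "alt (SE a # s) \<Longrightarrow> s = [] \<or> (\<exists>b u. s = SF b # u \<and> b \<noteq> F0 \<and> alt (SF b # u))"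
  and alt_SF: "alt (SF b # s) \<Longrightarrow> s = [] \<or> (\<exists>a u. s = SE a # u \<and> a \<noteq> E0 \<and> alt (SE a # u))"
  by (cases s; cases "hd s"; auto simp: alt_Cons)+

section \<open>The girth condition for all short words, and the coset graph\<close>

context edge_regular
begin

text \<open>Triviality is invariant under rotation. A word of even length can be rotated to start in
  the first subgroup, where \<open>girth_words\<close> applies. A longer word of odd length starts
  and ends in the same subgroup; rotating its last syllable to the front merges the two and leaves a
  shorter word. A single syllable is nontrivial by injectivity.\<close>

lemma evalS_neq_one:
  assumes "amalgam H t \<epsilon> \<phi>" "range \<epsilon> = E" "range \<phi> = F" "inj \<epsilon>" "inj \<phi>" "8 \<le> girth X"
  shows "alt s \<Longrightarrow> s \<noteq> [] \<Longrightarrow> length s \<le> 7 \<Longrightarrow> amalgam.evalS H \<epsilon> \<phi> s \<noteq> \<one>"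
proof (induction "length s" arbitrary: s rule: less_induct)
  case less
  interpret A: amalgam H t \<epsilon> \<phi> by fact
  have mem: "\<epsilon> a \<in> E" "\<phi> b \<in> F" for a b using assms(2,3) by auto
  have neE: "\<epsilon> a \<noteq> \<one>" if "a \<noteq> E0" for a using that injD[OF assms(4), of a E0] by auto
  have neF: "\<phi> b \<noteq> \<one>" if "b \<noteq> F0" for b using that injD[OF assms(5), of b F0] by auto
  have even: "A.evalS u \<noteq> \<one>" if u: "alt u" "length u \<le> 7" "u \<noteq> []" "is_SE (hd u)" "\<not> is_SE (last u)" for u
  proof -
    obtain a s1 where a: "u = SE a # s1" using u by (cases u; cases "hd u") auto
    have a0: "a \<noteq> E0" using u a by (simp add: alt_Cons)
    obtain b s2 where b: "s1 = SF b # s2" "b \<noteq> F0" "alt (SF b # s2)"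
      using alt_SE[of a s1] u a by auto
    show ?thesis
    proof (cases s2)
      case Nil
      then show ?thesis using girth_words(1)[OF assms(6) mem mem mem neE[OF a0] neF[OF b(2)] neE[OF a0] neF[OF b(2)]] a b by simp
    next
      case (Cons x s3')
      then obtain c s3 where c: "s2 = SE c # s3" "c \<noteq> E0" "alt (SE c # s3)" using alt_SF[OF b(3)] by auto
      obtain d s4 where d: "s3 = SF d # s4" "d \<noteq> F0" "alt (SF d # s4)"
        using alt_SE[OF c(3)] u a b c by auto
      note gw = girth_words[OF assms(6) mem mem mem neE[OF a0] neF[OF b(2)] neE[OF c(2)] neF[OF d(2)]]
      show ?thesis
      proof (cases s4)
        case Nil
        then show ?thesis using gw(2) a b c d by (simp add: m_assoc)
      next
        case (Cons x s5')
        then obtain e s5 where e: "s4 = SE e # s5" "e \<noteq> E0" "alt (SE e # s5)" using alt_SF[OF d(3)] by auto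
        obtain f s6 where f: "s5 = SF f # s6" "f \<noteq> F0" "alt (SF f # s6)"
          using alt_SE[OF e(3)] u a b c d e by auto
        have "s6 = []"
        proof (rule ccontr)
          assume "s6 \<noteq> []"
          then obtain g s7 where g: "s6 = SE g # s7" using alt_SF[OF f(3)] by auto
          then have "s7 = []" using u(2) a b c d e f by simp
          then show False using u(5) a b c d e f g by simp
        qed
        then show ?thesis using gw(3)[OF neE[OF e(2)] neF[OF f(2)]] a b c d e f by (simp add: m_assoc)
      qed
    qed
  qed
  obtain x s' where s: "s = x # s'" using less.prems(2) by (cases s) auto
  show ?case
  proof (cases "is_SE (hd s) = is_SE (last s)")
    case False
    show ?thesis
    proof (cases "is_SE (hd s)")
      case True
      then show ?thesis using even[of s] less.prems False by simp
    next
      case F: False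
      have "s' \<noteq> []" using False s by auto
      then have "alt (s' @ [x])" "is_SE (hd (s' @ [x]))" "\<not> is_SE (last (s' @ [x]))"
        using less.prems(1) False F unfolding s by (auto simp: alt_append alt_Cons)
      then have "A.evalS (s' @ [x]) \<noteq> \<one>" using even[of "s' @ [x]"] less.prems(3) s by simp
      then show ?thesis using A.evalS_rotate1[of s] s by simp
    qed
  next
    case True
    show ?thesis
    proof (cases s' rule: rev_cases)
      case Nil
      then show ?thesis using less.prems(1) neE neF s by (cases x) (auto simp: alt_Cons)
    next
      case (snoc u y)
      have xy: "is_SE x = is_SE y" using True s snoc by simp
      have au: "alt u" "nonunit x" "nonunit y" using less.prems(1) unfolding s snoc by (auto simp: alt_Cons alt_append)
      have "u \<noteq> []" using less.prems(1) xy unfolding s snoc by (auto simp: alt_Cons)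
      then have hu: "is_SE (hd u) \<noteq> is_SE x" using less.prems(1) unfolding s snoc by (auto simp: alt_Cons)
      have rot: "A.evalS s = \<one> \<longleftrightarrow> A.val y \<otimes> A.val x \<otimes> A.evalS u = \<one>"
      proof -
        have "A.evalS s = (A.val x \<otimes> A.evalS u) \<otimes> A.val y" by (simp add: s snoc A.evalS_append m_assoc)
        then show ?thesis using A.rotate_eq_one[of "A.val x \<otimes> A.evalS u" "A.val y"] by (simp add: m_assoc)
      qed
      obtain z where z: "A.val z = A.val y \<otimes> A.val x" "is_SE z = is_SE x"
      proof (cases x)
        case (SE a)
        then obtain b where "y = SE b" using xy by (cases y) auto
        then show ?thesis using that[of "SE (mulE t b a)"] SE by (simp add: A.E_mult)
      next
        case (SF a)
        then obtain b where "y = SF b" using xy by (cases y) auto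
        then show ?thesis using that[of "SF (mulF t b a)"] SF by (simp add: A.F_mult)
      qed
      show ?thesis
      proof (cases "nonunit z")
        case True
        have "A.evalS (z # u) \<noteq> \<one>"
          by (rule less.hyps) (use True z(2) au hu less.prems(3) s snoc in \<open>auto simp: alt_Cons\<close>)
        then show ?thesis using rot z(1) by simp
      next
        case False
        then have "A.val z = \<one>" by (cases z) auto
        moreover have "A.evalS u \<noteq> \<one>"
          by (rule less.hyps) (use au \<open>u \<noteq> []\<close> less.prems(3) s snoc in auto)
        ultimately show ?thesis using rot z(1)[symmetric] by simp
      qed
    qed
  qed
qed

lemma quadrangle_amalgamI:
  assumes "diameter X \<le> 4" "8 \<le> girth X" "card E = 4" "card F = 6"
  obtains t \<epsilon> \<phi> where "quadrangle_amalgam H t \<epsilon> \<phi>" "range \<epsilon> = E" "range \<phi> = F"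
proof -
  obtain t \<epsilon> \<phi> where A: "amalgam H t \<epsilon> \<phi>" "range \<epsilon> = E" "range \<phi> = F" "inj \<epsilon>" "inj \<phi>"
    by (rule subgroup_gens[OF subgroup_E assms(3) subgroup_F assms(4)])
  interpret A: amalgam H t \<epsilon> \<phi> by fact
  have "quadrangle_amalgam H t \<epsilon> \<phi>"
  proof
    fix x assume "x \<in> carrier H"
    then obtain f e f' e' where x: "f \<in> F" "e \<in> E" "f' \<in> F" "e' \<in> E" "x = f \<otimes> e \<otimes> f' \<otimes> e'"
      using cover_FEFE[OF assms(1)] by blast
    obtain k l where kl: "f = \<phi> k" "e = \<epsilon> l" using x(1,2) unfolding A(2,3)[symmetric] by blast
    obtain m n where mn: "f' = \<phi> m" "e' = \<epsilon> n" using x(3,4) unfolding A(2,3)[symmetric] by blast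
    have "x = \<phi> k \<otimes> \<epsilon> l \<otimes> \<phi> m \<otimes> \<epsilon> n" unfolding x(5) kl mn ..
    then show "\<exists>f e f' e'. x = \<phi> f \<otimes> \<epsilon> e \<otimes> \<phi> f' \<otimes> \<epsilon> e'" by (intro exI)
  next
    show "A.evalS s \<noteq> \<one>" if "alt s" "s \<noteq> []" "length s \<le> 7" for s
      by (rule evalS_neq_one[OF A assms(2) that])
  qed
  then show thesis by (rule that[OF _ A(2,3)])
qed

text \<open>The elements that take \<open>l0\<close> to a given line form a left coset of
  \<open>E\<close>, and those that take \<open>p0\<close> to a given point one of \<open>F\<close>;
  a vertex is sent to the image of its coset under \<theta>. Lines thus go to the left summand,
  points to the right one.\<close>

lemma coset_graph_iso:
  assumes iso: "\<theta> \<in> iso H K" and K: "group K" and conn: "\<And>v. v \<in> P \<Longrightarrow> \<exists>g \<in> carrier H. act g p0 = v"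
    "\<And>v. v \<in> Ls \<Longrightarrow> \<exists>g \<in> carrier H. act g l0 = v"
  shows "isomorphic_actions H act X K (coset_action K) (coset_graph K (\<theta> ` E) (\<theta> ` F))"
proof -
  interpret K: group K by fact
  have hom: "\<theta> \<in> hom H K" and bij: "bij_betw \<theta> (carrier H) (carrier K)" using iso by (auto simp: iso_def)
  have cl: "\<theta> g \<in> carrier K" if "g \<in> carrier H" for g using hom that by (auto simp: hom_def)
  have mult: "\<theta> (g \<otimes> h) = \<theta> g \<otimes>\<^bsub>K\<^esub> \<theta> h" if "g \<in> carrier H" "h \<in> carrier H" for g h
    using hom that by (auto simp: hom_def)
  have sur: "\<exists>g \<in> carrier H. y = \<theta> g" if "y \<in> carrier K" for y using bij that by (auto simp: bij_betw_def)
  have sub: "E \<subseteq> carrier H" "F \<subseteq> carrier H" by (auto simp: E_def F_def)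
  have subV: "\<theta> ` E \<subseteq> carrier K" "\<theta> ` F \<subseteq> carrier K" using sub cl by auto
  define fl where "fl v = \<theta> ` {h \<in> carrier H. act h l0 = v}" for v
  define fp where "fp v = \<theta> ` {h \<in> carrier H. act h p0 = v}" for v
  have coset: "\<theta> ` {h \<in> carrier H. act h w = act g w} = \<theta> g <#\<^bsub>K\<^esub> (\<theta> ` {h \<in> carrier H. act h w = w})"
    if g: "g \<in> carrier H" and w: "w \<in> P \<union> Ls" for g w
  proof (intro equalityI subsetI)
    fix y assume "y \<in> \<theta> ` {h \<in> carrier H. act h w = act g w}"
    then obtain h where h: "h \<in> carrier H" "act h w = act g w" "y = \<theta> h" by blast
    have "y = \<theta> g \<otimes>\<^bsub>K\<^esub> \<theta> (inv g \<otimes> h)" using g h mult[of g "inv g \<otimes> h"] by (simp add: m_assoc[symmetric])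
    moreover have "act (inv g \<otimes> h) w = w" using act_eq[OF g h(1) w] h(2) by simp
    moreover have "\<theta> (inv g \<otimes> h) \<in> \<theta> ` {h \<in> carrier H. act h w = w}" if "act (inv g \<otimes> h) w = w"
      by (rule imageI) (use g h(1) that in simp)
    ultimately show "y \<in> \<theta> g <#\<^bsub>K\<^esub> (\<theta> ` {h \<in> carrier H. act h w = w})"
      unfolding l_coset_def by (intro UN_I[of "\<theta> (inv g \<otimes> h)"]) simp_all
  next
    fix y assume "y \<in> \<theta> g <#\<^bsub>K\<^esub> (\<theta> ` {h \<in> carrier H. act h w = w})"
    then obtain h where h: "h \<in> carrier H" "act h w = w" "y = \<theta> g \<otimes>\<^bsub>K\<^esub> \<theta> h" by (auto simp: l_coset_def)
    have "y = \<theta> (g \<otimes> h)" using h mult[OF g h(1)] by simp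
    moreover have "act (g \<otimes> h) w = act g w" using act_mult[OF g h(1) w] h(2) by simp
    ultimately show "y \<in> \<theta> ` {h \<in> carrier H. act h w = act g w}"
      using g h(1) by (intro image_eqI[of _ _ "g \<otimes> h"]) simp_all
  qed
  have fl: "fl (act g l0) = \<theta> g <#\<^bsub>K\<^esub> (\<theta> ` E)" and fp: "fp (act g p0) = \<theta> g <#\<^bsub>K\<^esub> (\<theta> ` F)" if "g \<in> carrier H" for g
    unfolding fl_def fp_def E_def F_def using base by (simp_all only: coset[OF that] Un_iff simp_thms)
  have types: "act g l0 \<in> Ls" "act g p0 \<in> P" "act g p0 \<notin> Ls" if "g \<in> carrier H" for g
    using act_L[OF that base(2)] act_P[OF that base(1)] verts by auto
  have inj: "g \<in> carrier H \<Longrightarrow> h \<in> carrier H \<Longrightarrow> \<theta> g = \<theta> h \<Longrightarrow> g = h" for g h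
    using bij by (auto simp: bij_betw_def inj_on_def)
  have inj_fl: "v = w" if vw: "v \<in> Ls" "w \<in> Ls" "fl v = fl w" for v w
  proof -
    obtain g where g: "g \<in> carrier H" "act g l0 = v" using conn(2)[OF vw(1)] by blast
    then have "\<theta> g \<in> fl v" by (auto simp: fl_def)
    then obtain h where "h \<in> carrier H" "act h l0 = w" "\<theta> g = \<theta> h" using vw(3) by (auto simp: fl_def)
    then show ?thesis using inj g by blast
  qed
  have inj_fp: "v = w" if vw: "v \<in> P" "w \<in> P" "fp v = fp w" for v w
  proof -
    obtain g where g: "g \<in> carrier H" "act g p0 = v" using conn(1)[OF vw(1)] by blast
    then have "\<theta> g \<in> fp v" by (auto simp: fp_def)
    then obtain h where "h \<in> carrier H" "act h p0 = w" "\<theta> g = \<theta> h" using vw(3) by (auto simp: fp_def)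
    then show ?thesis using inj g by blast
  qed
  define f where "f v = (if v \<in> Ls then Inl (fl v) else Inr (fp v))" for v
  have f: "f (act g l0) = Inl (\<theta> g <#\<^bsub>K\<^esub> (\<theta> ` E))" "f (act g p0) = Inr (\<theta> g <#\<^bsub>K\<^esub> (\<theta> ` F))"
    if "g \<in> carrier H" for g
    using fl[OF that] fp[OF that] types[OF that] by (simp_all add: f_def)
  let ?Y = "coset_graph K (\<theta> ` E) (\<theta> ` F)"
  have vY: "verts ?Y = (\<lambda>x. Inl (x <#\<^bsub>K\<^esub> (\<theta> ` E))) ` carrier K \<union> (\<lambda>x. Inr (x <#\<^bsub>K\<^esub> (\<theta> ` F))) ` carrier K"
    by (auto simp: coset_graph_def LCOSETS_def)
  have eY: "edges ?Y = (\<lambda>x. {Inl (x <#\<^bsub>K\<^esub> (\<theta> ` E)), Inr (x <#\<^bsub>K\<^esub> (\<theta> ` F))}) ` carrier K"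
    by (simp add: coset_graph_def)
  have injf: "inj_on f (verts X)"
  proof (rule inj_onI)
    fix v w assume vw: "v \<in> verts X" "w \<in> verts X" "f v = f w"
    show "v = w"
    proof (cases "v \<in> Ls")
      case True
      then have "w \<in> Ls" using vw(3) by (auto simp: f_def split: if_splits)
      then show ?thesis using inj_fl True vw(3) by (simp add: f_def)
    next
      case False
      then have "w \<notin> Ls" using vw(3) by (auto simp: f_def split: if_splits)
      then show ?thesis using inj_fp False vw verts by (simp add: f_def)
    qed
  qed
  have imf: "f ` verts X = verts ?Y"
  proof (intro equalityI subsetI)
    fix y assume "y \<in> f ` verts X"
    then obtain v where v: "v \<in> verts X" "y = f v" by blast
    show "y \<in> verts ?Y"
    proof (cases "v \<in> Ls")
      case True
      then obtain g where "g \<in> carrier H" "act g l0 = v" using conn(2) by blast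
      then have "y = Inl (\<theta> g <#\<^bsub>K\<^esub> (\<theta> ` E))" "\<theta> g \<in> carrier K" using v f(1)[of g] cl[of g] by auto
      then show ?thesis unfolding vY by (intro UnI1 image_eqI)
    next
      case False
      then obtain g where "g \<in> carrier H" "act g p0 = v" using conn(1) v verts by blast
      then have "y = Inr (\<theta> g <#\<^bsub>K\<^esub> (\<theta> ` F))" "\<theta> g \<in> carrier K" using v f(2)[of g] cl[of g] by auto
      then show ?thesis unfolding vY by (intro UnI2 image_eqI)
    qed
  next
    fix y assume "y \<in> verts ?Y"
    then obtain x where x: "x \<in> carrier K" "y = Inl (x <#\<^bsub>K\<^esub> (\<theta> ` E)) \<or> y = Inr (x <#\<^bsub>K\<^esub> (\<theta> ` F))"
      unfolding vY by blast
    obtain g where g: "g \<in> carrier H" "x = \<theta> g" using sur[OF x(1)] by blast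
    have "y = f (act g l0) \<or> y = f (act g p0)" using x(2) f[OF g(1)] g(2) by simp
    then show "y \<in> f ` verts X" using types[OF g(1)] verts by blast
  qed
  have adj: "adjacent X u v \<longleftrightarrow> adjacent ?Y (f u) (f v)" if uv: "u \<in> verts X" "v \<in> verts X" for u v
  proof
    assume "adjacent X u v"
    then obtain p l where pl: "p \<in> P" "l \<in> Ls" "{u, v} = {p, l}" "{p, l} \<in> edges X" using edges[of "{u, v}"] by auto
    then obtain g where g: "g \<in> carrier H" "act g p0 = p" "act g l0 = l" using edge_obtain by blast
    have "{f u, f v} = f ` {u, v}" by simp
    also have "\<dots> = {f (act g l0), f (act g p0)}" unfolding pl(3) using g by auto
    also have "\<dots> \<in> edges ?Y" unfolding eY f[OF g(1)] by (rule imageI[OF cl[OF g(1)]])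
    finally show "adjacent ?Y (f u) (f v)" .
  next
    assume "adjacent ?Y (f u) (f v)"
    then obtain x where x: "x \<in> carrier K" "{f u, f v} = {Inl (x <#\<^bsub>K\<^esub> (\<theta> ` E)), Inr (x <#\<^bsub>K\<^esub> (\<theta> ` F))}"
      unfolding eY by blast
    obtain g where g: "g \<in> carrier H" "x = \<theta> g" using sur[OF x(1)] by blast
    have "f ` {u, v} = f ` {act g p0, act g l0}" using x(2) f[OF g(1)] g(2) by auto
    then have "{u, v} = {act g p0, act g l0}"
      by (rule inj_on_image_eq_iff[OF injf, THEN iffD1, rotated -1]) (use uv types[OF g(1)] verts in auto)
    then show "adjacent X u v" using edge[OF g(1)] by simp
  qed
  have equi: "f (act g v) = coset_action K (\<theta> g) (f v)" if g: "g \<in> carrier H" and v: "v \<in> verts X" for g v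
  proof (cases "v \<in> Ls")
    case True
    then obtain h where h: "h \<in> carrier H" "act h l0 = v" using conn(2) by blast
    then have "act g v = act (g \<otimes> h) l0" using act_mult g base by simp
    then have "f (act g v) = Inl (\<theta> (g \<otimes> h) <#\<^bsub>K\<^esub> (\<theta> ` E))" using f(1) g h by simp
    also have "\<dots> = coset_action K (\<theta> g) (f v)"
      using f(1)[OF h(1)] h g mult K.lcos_m_assoc[OF subV(1) cl[OF g] cl[OF h(1)]] by (simp add: coset_action_def)
    finally show ?thesis .
  next
    case False
    then obtain h where h: "h \<in> carrier H" "act h p0 = v" using conn(1) v verts by blast
    then have "act g v = act (g \<otimes> h) p0" using act_mult g base by simp
    then have "f (act g v) = Inr (\<theta> (g \<otimes> h) <#\<^bsub>K\<^esub> (\<theta> ` F))" using f(2) g h by simp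
    also have "\<dots> = coset_action K (\<theta> g) (f v)"
      using f(2)[OF h(1)] h g mult K.lcos_m_assoc[OF subV(2) cl[OF g] cl[OF h(1)]] by (simp add: coset_action_def)
    finally show ?thesis .
  qed
  have "graph_iso f X ?Y" unfolding graph_iso_def bij_betw_def
    by (intro conjI ballI injf imf adj)
  then show ?thesis unfolding isomorphic_actions_def
    by (intro bexI[OF _ iso] exI[of _ f] conjI ballI equi)
qed

end

lemma valency_card: "valency X v = enat n \<Longrightarrow> finite {e \<in> edges X. v \<in> e} \<and> card {e \<in> edges X. v \<in> e} = n"
  by (auto simp: valency_def split: if_splits)

text \<open>Points and lines have different valencies, so no element of \<open>G\<close>
  interchanges them. Regularity on edges as unordered pairs then becomes regularity on incident
  pairs of a point and a line.\<close>

lemma edge_regular_quadrangle: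
  assumes Q: "generalized_quadrangle_of_order 3 5 Q" and G: "aut_subgroup G Q"
    and reg: "regular_on_edges (BijGroup (verts Q)\<lparr>carrier := G\<rparr>) (\<lambda>g. g) Q"
  obtains P Ls p0 l0 where "edge_regular (BijGroup (verts Q)\<lparr>carrier := G\<rparr>) Q (\<lambda>g. g) P Ls p0 l0"
    "\<And>p. p \<in> P \<Longrightarrow> valency Q p = enat 6" "\<And>l. l \<in> Ls \<Longrightarrow> valency Q l = enat 4"
proof -
  let ?S = "verts Q" and ?K = "BijGroup (verts Q)\<lparr>carrier := G\<rparr>"
  obtain P Ls where bip: "bipartition Q P Ls" and vP: "\<And>p. p \<in> P \<Longrightarrow> valency Q p = enat 6"
    and vL: "\<And>l. l \<in> Ls \<Longrightarrow> valency Q l = enat 4"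
    using Q unfolding generalized_quadrangle_of_order_def by auto
  have PL: "P \<union> Ls = ?S" "P \<inter> Ls = {}" and ed: "\<And>e. e \<in> edges Q \<Longrightarrow> \<exists>p \<in> P. \<exists>l \<in> Ls. e = {p, l}"
    using bip unfolding bipartition_def by auto
  have gq: "generalized_quadrangle Q" using Q unfolding generalized_quadrangle_of_order_def by simp
  have sub: "subgroup G (BijGroup ?S)" and aut: "\<And>g. g \<in> G \<Longrightarrow> g \<in> Bij ?S \<and> graph_iso g Q Q"
    using G unfolding aut_subgroup_def graph_auts_def by auto
  interpret B: group "BijGroup ?S" by (rule group_BijGroup)
  interpret K: group ?K by (rule subgroup.subgroup_is_group[OF sub B.group_axioms])
  have mult: "(g \<otimes>\<^bsub>?K\<^esub> h) v = g (h v)" if "g \<in> G" "h \<in> G" "v \<in> ?S" for g h v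
    using that aut by (simp add: BijGroup_def compose_def)
  have one: "\<one>\<^bsub>?K\<^esub> v = v" if "v \<in> ?S" for v using that by (simp add: BijGroup_def)
  have bij: "bij_betw g ?S ?S" if "g \<in> G" for g using aut[OF that] by (simp add: Bij_def)
  have inS: "g v \<in> ?S" if "g \<in> G" "v \<in> ?S" for g v using bij[OF that(1)] that(2) by (auto simp: bij_betw_def)
  have esub: "e \<subseteq> ?S" if "e \<in> edges Q" for e using ed[OF that] PL by auto
  have edg: "g ` e \<in> edges Q" if g: "g \<in> G" and e: "e \<in> edges Q" for g e
  proof -
    obtain p l where pl: "p \<in> P" "l \<in> Ls" "e = {p, l}" using ed[OF e] by blast
    then have "{g p, g l} \<in> edges Q" using aut[OF g] e PL unfolding graph_iso_def by auto
    then show ?thesis using pl by simp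
  qed
  have fin: "finite {e \<in> edges Q. v \<in> e}" if "v \<in> ?S" for v
    using that PL valency_card[OF vP] valency_card[OF vL] by blast
  have mono: "card {e \<in> edges Q. v \<in> e} \<le> card {e \<in> edges Q. g v \<in> e}" if g: "g \<in> G" and v: "v \<in> ?S" for g v
  proof (rule card_inj_on_le[of "(`) g"])
    show "inj_on ((`) g) {e \<in> edges Q. v \<in> e}"
    proof (rule inj_onI)
      fix e e' assume "e \<in> {e \<in> edges Q. v \<in> e}" "e' \<in> {e \<in> edges Q. v \<in> e}" "g ` e = g ` e'"
      then show "e = e'" using inj_on_image_eq_iff[of g ?S e e'] bij[OF g] esub by (auto simp: bij_betw_def)
    qed
    show "(`) g ` {e \<in> edges Q. v \<in> e} \<subseteq> {e \<in> edges Q. g v \<in> e}" using edg[OF g] by auto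
    show "finite {e \<in> edges Q. g v \<in> e}" using fin inS g v by blast
  qed
  have aP: "g p \<in> P" if "g \<in> G" "p \<in> P" for g p
  proof (rule ccontr)
    assume "g p \<notin> P"
    then have "g p \<in> Ls" using inS[OF that(1), of p] that(2) PL by blast
    then have "card {e \<in> edges Q. g p \<in> e} = 4" "card {e \<in> edges Q. p \<in> e} = 6"
      using valency_card[OF vL] valency_card[OF vP[OF that(2)]] by auto
    then show False using mono[OF that(1), of p] that(2) PL by auto
  qed
  \<comment> \<open>For a line sent to a point, comparing the valencies gives only 4 \<le> 6; the
    contradiction comes from the inverse, which sends points to points.\<close>
  have aL: "g l \<in> Ls" if "g \<in> G" "l \<in> Ls" for g l
  proof (rule ccontr)
    assume "g l \<notin> Ls"
    then have gl: "g l \<in> P" using inS[OF that(1), of l] that(2) PL by blast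
    have lS: "l \<in> ?S" using that(2) PL by blast
    have ig: "inv\<^bsub>?K\<^esub> g \<in> G" using K.inv_closed[of g] that(1) by simp
    have "(inv\<^bsub>?K\<^esub> g) (g l) = (inv\<^bsub>?K\<^esub> g \<otimes>\<^bsub>?K\<^esub> g) l" using mult[OF ig that(1) lS] by simp
    also have "\<dots> = l" using K.l_inv[of g] that(1) one[OF lS] by simp
    finally have "l \<in> P" using aP[OF ig gl] by simp
    then show False using that(2) PL by blast
  qed
  \<comment> \<open>A base edge has to be found. The supremum over no vertices is 0 and not 4, so a
    vertex exists, and its valency is positive.\<close>
  have "?S \<noteq> {}"
  proof
    assume "?S = {}"
    then have "diameter Q = 0" by (simp add: diameter_def bot_enat_def)
    then show False using gq by (simp add: generalized_quadrangle_def)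
  qed
  then obtain v where v: "v \<in> ?S" by blast
  have "card {e \<in> edges Q. v \<in> e} \<noteq> 0" 
  proof (cases "v \<in> P")
    case True
    then show ?thesis using valency_card[OF vP] by simp
  next
    case False
    then have "v \<in> Ls" using v PL by blast
    then show ?thesis using valency_card[OF vL] by simp
  qed
  then have "{e \<in> edges Q. v \<in> e} \<noteq> {}" by (metis card.empty)
  then obtain e where "e \<in> edges Q" by blast
  then obtain p0 l0 where base: "p0 \<in> P" "l0 \<in> Ls" "{p0, l0} \<in> edges Q" using ed by blast
  have er: "edge_regular ?K Q (\<lambda>g. g) P Ls p0 l0"
  proof
    show "(g \<otimes>\<^bsub>?K\<^esub> h) w = g (h w)" if "g \<in> carrier ?K" "h \<in> carrier ?K" "w \<in> P \<union> Ls" for g h w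
      using mult that PL by simp
    show "\<one>\<^bsub>?K\<^esub> w = w" if "w \<in> P \<union> Ls" for w using one that PL by simp
    show "g p \<in> P" if "g \<in> carrier ?K" "p \<in> P" for g p using aP that by simp
    show "g l \<in> Ls" if "g \<in> carrier ?K" "l \<in> Ls" for g l using aL that by simp
    show "{g p, g l} \<in> edges Q" if "g \<in> carrier ?K" "p \<in> P" "l \<in> Ls" "{p, l} \<in> edges Q" for g p l
      using edg[of g "{p, l}"] that by simp
    show "verts Q = P \<union> Ls" "P \<inter> Ls = {}" using PL by auto
    show "\<exists>p \<in> P. \<exists>l \<in> Ls. e = {p, l}" if "e \<in> edges Q" for e using ed that by blast
    show "p0 \<in> P" "l0 \<in> Ls" "{p0, l0} \<in> edges Q" by fact+
    show "\<exists>!g. g \<in> carrier ?K \<and> g p0 = p \<and> g l0 = l" if pl: "p \<in> P" "l \<in> Ls" "{p, l} \<in> edges Q" for p l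
    proof -
      have *: "g ` {p0, l0} = {p, l} \<longleftrightarrow> g p0 = p \<and> g l0 = l" if "g \<in> G" for g
      proof -
        have "g p0 \<noteq> l" "g l0 \<noteq> p" using aP[OF that base(1)] aL[OF that base(2)] pl PL by auto
        then show ?thesis by (auto simp: doubleton_eq_iff)
      qed
      have "\<exists>!g. g \<in> carrier ?K \<and> g ` {p0, l0} = {p, l}"
        by (rule bspec[OF bspec[OF reg[unfolded regular_on_edges_def] base(3)] pl(3)])
      moreover have "(g \<in> carrier ?K \<and> g ` {p0, l0} = {p, l}) = (g \<in> carrier ?K \<and> g p0 = p \<and> g l0 = l)" for g
        using *[of g] by auto
      ultimately show ?thesis by (simp only:)
    qed
  qed
  show thesis using er vP vL by (rule that)
qed

theorem classification:
  assumes Q: "generalized_quadrangle_of_order 3 5 Q" and G: "aut_subgroup G Q"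
    and reg: "regular_on_edges (BijGroup (verts Q)\<lparr>carrier := G\<rparr>) (\<lambda>g. g) Q"
  shows "\<exists>i \<in> {1..11}. isomorphic_actions (BijGroup (verts Q)\<lparr>carrier := G\<rparr>) (\<lambda>g. g) Q
    (L i) (coset_action (L i)) (L_graph i)"
proof (rule edge_regular_quadrangle[OF Q G reg])
  let ?K = "BijGroup (verts Q)\<lparr>carrier := G\<rparr>"
  fix P Ls p0 l0
  assume er: "edge_regular ?K Q (\<lambda>g. g) P Ls p0 l0"
    and vP: "\<And>p. p \<in> P \<Longrightarrow> valency Q p = enat 6" and vL: "\<And>l. l \<in> Ls \<Longrightarrow> valency Q l = enat 4"
  interpret R: edge_regular ?K Q "\<lambda>g. g" P Ls p0 l0 by (rule er)
  have dg: "diameter Q \<le> 4" "8 \<le> girth Q"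
    using Q by (simp_all add: generalized_quadrangle_of_order_def generalized_quadrangle_def)
  have cE: "card R.E = 4" unfolding R.card_E using valency_card[OF vL[OF R.base(2)]] by simp
  have cF: "card R.F = 6" unfolding R.card_F using valency_card[OF vP[OF R.base(1)]] by simp
  obtain t \<epsilon> \<phi> where qa: "quadrangle_amalgam ?K t \<epsilon> \<phi>" and rg: "range \<epsilon> = R.E" "range \<phi> = R.F"
    by (rule R.quadrangle_amalgamI[OF dg cE cF])
  interpret A: quadrangle_amalgam ?K t \<epsilon> \<phi> by (rule qa)
  have "A.recognized" by (rule A.recognizedI[OF roots_kids top_check])
  then obtain i h where I: "i \<in> {1..11}" and h: "h \<in> iso (L i) ?K"
    and hE: "h ` L_a i = R.E" and hF: "h ` L_b i = R.F"
    unfolding A.recognized_def rg by (elim bexE conjE)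
  interpret L: group "L i" by (rule group_L)
  interpret M: amalgam "L i" "ltype i" "epsL i" "phiL i" by (rule amalgam_L[OF I])
  \<comment> \<open>Recognition yields an isomorphism from \<open>L i\<close> onto the group; the
    claim is about the opposite direction.\<close>
  let ?\<theta> = "inv_into (carrier (L i)) h"
  have \<theta>: "?\<theta> \<in> iso ?K (L i)" by (rule L.iso_set_sym[OF h])
  have sub: "L_a i \<subseteq> carrier (L i)" "L_b i \<subseteq> carrier (L i)" unfolding generated_L[OF I] by auto
  have inj: "inj_on h (carrier (L i))" using h by (simp add: iso_def bij_betw_def)
  have \<theta>E: "?\<theta> ` R.E = L_a i" unfolding hE[symmetric] by (rule inv_into_image_cancel[OF inj sub(1)])
  have \<theta>F: "?\<theta> ` R.F = L_b i" unfolding hF[symmetric] by (rule inv_into_image_cancel[OF inj sub(2)])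
  \<comment> \<open>Every vertex lies on an edge, so regularity on edges makes the group transitive
    on points and on lines.\<close>
  have edge: "\<exists>e \<in> edges Q. v \<in> e" if "valency Q v = enat n" "n \<noteq> 0" for v n
  proof (rule ccontr)
    assume "\<not> (\<exists>e \<in> edges Q. v \<in> e)"
    then have "{e \<in> edges Q. v \<in> e} = {}" by blast
    then have "card {e \<in> edges Q. v \<in> e} = 0" by (simp only: card.empty)
    then show False using valency_card[OF that(1)] that(2) by simp
  qed
  have "isomorphic_actions ?K (\<lambda>g. g) Q (L i) (coset_action (L i)) (coset_graph (L i) (?\<theta> ` R.E) (?\<theta> ` R.F))"
  proof (rule R.coset_graph_iso[OF \<theta> group_L])
    show "\<exists>g \<in> carrier ?K. g p0 = v" if v: "v \<in> P" for v
    proof -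
      obtain e where e: "e \<in> edges Q" "v \<in> e" using edge[OF vP[OF v]] by auto
      obtain p l where pl: "p \<in> P" "l \<in> Ls" "e = {p, l}" using R.edges[OF e(1)] by (elim bexE)
      have "v = p" using v e(2) pl R.verts(2) by auto
      then show ?thesis using R.edge_obtain[OF pl(1,2)] e(1) pl(3) by metis
    qed
    show "\<exists>g \<in> carrier ?K. g l0 = v" if v: "v \<in> Ls" for v
    proof -
      obtain e where e: "e \<in> edges Q" "v \<in> e" using edge[OF vL[OF v]] by auto
      obtain p l where pl: "p \<in> P" "l \<in> Ls" "e = {p, l}" using R.edges[OF e(1)] by (elim bexE)
      have "v = l" using v e(2) pl R.verts(2) by auto
      then show ?thesis using R.edge_obtain[OF pl(1,2)] e(1) pl(3) by metis
    qed
  qed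
  then show ?thesis unfolding \<theta>E \<theta>F by (rule bexI[OF _ I])
qed

section \<open>Permutation representations\<close>

datatype pt = X0 | X1 | X2 | X3 | X4 | X5 | X6 | X7 | X8 | X9 | X10 | X11 | X12 | X13 | X14 | X15
datatype pm = PM pt pt pt pt pt pt pt pt pt pt pt pt pt pt pt pt

fun app :: "pm \<Rightarrow> pt \<Rightarrow> pt" where
  "app (PM x0 x1 x2 x3 x4 x5 x6 x7 x8 x9 x10 x11 x12 x13 x14 x15) X0 = x0"
| "app (PM x0 x1 x2 x3 x4 x5 x6 x7 x8 x9 x10 x11 x12 x13 x14 x15) X1 = x1"
| "app (PM x0 x1 x2 x3 x4 x5 x6 x7 x8 x9 x10 x11 x12 x13 x14 x15) X2 = x2"
| "app (PM x0 x1 x2 x3 x4 x5 x6 x7 x8 x9 x10 x11 x12 x13 x14 x15) X3 = x3"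
| "app (PM x0 x1 x2 x3 x4 x5 x6 x7 x8 x9 x10 x11 x12 x13 x14 x15) X4 = x4"
| "app (PM x0 x1 x2 x3 x4 x5 x6 x7 x8 x9 x10 x11 x12 x13 x14 x15) X5 = x5"
| "app (PM x0 x1 x2 x3 x4 x5 x6 x7 x8 x9 x10 x11 x12 x13 x14 x15) X6 = x6"
| "app (PM x0 x1 x2 x3 x4 x5 x6 x7 x8 x9 x10 x11 x12 x13 x14 x15) X7 = x7"
| "app (PM x0 x1 x2 x3 x4 x5 x6 x7 x8 x9 x10 x11 x12 x13 x14 x15) X8 = x8"
| "app (PM x0 x1 x2 x3 x4 x5 x6 x7 x8 x9 x10 x11 x12 x13 x14 x15) X9 = x9"
| "app (PM x0 x1 x2 x3 x4 x5 x6 x7 x8 x9 x10 x11 x12 x13 x14 x15) X10 = x10"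
| "app (PM x0 x1 x2 x3 x4 x5 x6 x7 x8 x9 x10 x11 x12 x13 x14 x15) X11 = x11"
| "app (PM x0 x1 x2 x3 x4 x5 x6 x7 x8 x9 x10 x11 x12 x13 x14 x15) X12 = x12"
| "app (PM x0 x1 x2 x3 x4 x5 x6 x7 x8 x9 x10 x11 x12 x13 x14 x15) X13 = x13"
| "app (PM x0 x1 x2 x3 x4 x5 x6 x7 x8 x9 x10 x11 x12 x13 x14 x15) X14 = x14"
| "app (PM x0 x1 x2 x3 x4 x5 x6 x7 x8 x9 x10 x11 x12 x13 x14 x15) X15 = x15"

text \<open>A permutation representation of degree 16, given by the images of the points under the
  generators and under their inverses, in the order \<open>A1, A1\<inverse>, A2, A2\<inverse>, B1, B1\<inverse>, B2, B2\<inverse>\<close>.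
  Smaller degrees are padded with fixed points; a generator that does not occur acts trivially.\<close>

datatype model = Model pm pm pm pm pm pm pm pm

fun perm :: "model \<Rightarrow> gen \<Rightarrow> bool \<Rightarrow> pm" where
  "perm (Model a a' b b' c c' d d') A1 e = (if e then a else a')"
| "perm (Model a a' b b' c c' d d') A2 e = (if e then b else b')"
| "perm (Model a a' b b' c c' d d') B1 e = (if e then c else c')"
| "perm (Model a a' b b' c c' d d') B2 e = (if e then d else d')"

text \<open>The first letter acts first: this is a right action, so the parts of a concatenation act
  from left to right.\<close>

fun actw :: "model \<Rightarrow> gen word \<Rightarrow> pt \<Rightarrow> pt" where
  "actw m [] k = k"
| "actw m ((x, e) # w) k = actw m w (app (perm m x e) k)"

definition pts :: "pt list" where "pts = [X0, X1, X2, X3, X4, X5, X6, X7, X8, X9, X10, X11, X12, X13, X14, X15]"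

fun moves :: "model \<Rightarrow> gen word \<Rightarrow> pt list \<Rightarrow> bool" where
  "moves m w [] = False"
| "moves m w (k # ks) = (if actw m w k = k then moves m w ks else True)"

fun spell :: "ty \<Rightarrow> sy \<Rightarrow> gen word" where
  "spell (Ty p q) (SE a) = pickE a [] a1 (if p then a1 @ a1 else a2) (if p then a1 @ a1 @ a1 else a1 @ a2)"
| "spell (Ty p q) (SF b) = (if q
    then pickF b [] b1 (b1 @ b1) (b1 @ b1 @ b1) (b1 @ b1 @ b1 @ b1) (b1 @ b1 @ b1 @ b1 @ b1)
    else pickF b [] b2 (b2 @ b2) b1 (b2 @ b1) (b2 @ b2 @ b1))"

definition model :: "nat \<Rightarrow> model" where
  "model i = [Model
      (PM X1 X2 X3 X0 X6 X4 X7 X5 X8 X9 X10 X11 X12 X13 X14 X15)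
      (PM X3 X0 X1 X2 X5 X7 X4 X6 X8 X9 X10 X11 X12 X13 X14 X15)
      (PM X0 X1 X2 X3 X4 X5 X6 X7 X8 X9 X10 X11 X12 X13 X14 X15)
      (PM X0 X1 X2 X3 X4 X5 X6 X7 X8 X9 X10 X11 X12 X13 X14 X15)
      (PM X1 X0 X4 X5 X6 X7 X3 X2 X8 X9 X10 X11 X12 X13 X14 X15)
      (PM X1 X0 X7 X6 X2 X3 X4 X5 X8 X9 X10 X11 X12 X13 X14 X15)
      (PM X0 X1 X2 X3 X4 X5 X6 X7 X8 X9 X10 X11 X12 X13 X14 X15)
      (PM X0 X1 X2 X3 X4 X5 X6 X7 X8 X9 X10 X11 X12 X13 X14 X15),
    Model
      (PM X1 X0 X4 X5 X2 X3 X8 X9 X6 X7 X11 X10 X12 X13 X14 X15)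
      (PM X1 X0 X4 X5 X2 X3 X8 X9 X6 X7 X11 X10 X12 X13 X14 X15)
      (PM X2 X4 X0 X7 X1 X9 X11 X3 X10 X5 X8 X6 X12 X13 X14 X15)
      (PM X2 X4 X0 X7 X1 X9 X11 X3 X10 X5 X8 X6 X12 X13 X14 X15)
      (PM X2 X5 X0 X7 X9 X1 X8 X3 X6 X4 X10 X11 X12 X13 X14 X15)
      (PM X2 X5 X0 X7 X9 X1 X8 X3 X6 X4 X10 X11 X12 X13 X14 X15)
      (PM X3 X5 X6 X8 X10 X11 X7 X2 X0 X4 X9 X1 X12 X13 X14 X15)
      (PM X8 X11 X7 X0 X9 X1 X2 X6 X3 X10 X4 X5 X12 X13 X14 X15),
    Model
      (PM X1 X0 X4 X6 X2 X8 X3 X12 X5 X13 X11 X10 X7 X9 X15 X14)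
      (PM X1 X0 X4 X6 X2 X8 X3 X12 X5 X13 X11 X10 X7 X9 X15 X14)
      (PM X2 X4 X0 X7 X1 X10 X12 X3 X11 X14 X5 X8 X6 X15 X9 X13)
      (PM X2 X4 X0 X7 X1 X10 X12 X3 X11 X14 X5 X8 X6 X15 X9 X13)
      (PM X3 X5 X2 X8 X9 X11 X1 X6 X0 X4 X12 X14 X15 X13 X7 X10)
      (PM X8 X6 X2 X0 X9 X1 X7 X14 X3 X4 X15 X5 X10 X13 X11 X12)
      (PM X0 X1 X2 X3 X4 X5 X6 X7 X8 X9 X10 X11 X12 X13 X14 X15)
      (PM X0 X1 X2 X3 X4 X5 X6 X7 X8 X9 X10 X11 X12 X13 X14 X15),
    Model
      (PM X1 X0 X4 X8 X2 X11 X9 X13 X3 X6 X15 X5 X14 X7 X12 X10)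
      (PM X1 X0 X4 X8 X2 X11 X9 X13 X3 X6 X15 X5 X14 X7 X12 X10)
      (PM X0 X1 X6 X3 X9 X11 X2 X14 X8 X4 X15 X5 X13 X12 X7 X10)
      (PM X0 X1 X6 X3 X9 X11 X2 X14 X8 X4 X15 X5 X13 X12 X7 X10)
      (PM X2 X4 X0 X9 X1 X12 X8 X10 X6 X3 X7 X13 X5 X11 X15 X14)
      (PM X2 X4 X0 X9 X1 X12 X8 X10 X6 X3 X7 X13 X5 X11 X15 X14)
      (PM X3 X5 X7 X10 X6 X8 X12 X9 X1 X2 X0 X11 X4 X13 X14 X15)
      (PM X10 X8 X9 X0 X12 X1 X4 X2 X5 X7 X3 X11 X6 X13 X14 X15),
    Model
      (PM X1 X0 X4 X7 X2 X9 X8 X3 X6 X5 X11 X10 X12 X13 X14 X15)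
      (PM X1 X0 X4 X7 X2 X9 X8 X3 X6 X5 X11 X10 X12 X13 X14 X15)
      (PM X2 X4 X0 X8 X1 X11 X7 X6 X3 X10 X9 X5 X12 X13 X14 X15)
      (PM X2 X4 X0 X8 X1 X11 X7 X6 X3 X10 X9 X5 X12 X13 X14 X15)
      (PM X3 X5 X6 X9 X10 X11 X7 X1 X4 X0 X8 X2 X12 X13 X14 X15)
      (PM X9 X7 X11 X0 X8 X1 X2 X6 X10 X3 X4 X5 X12 X13 X14 X15)
      (PM X0 X1 X2 X3 X4 X5 X6 X7 X8 X9 X10 X11 X12 X13 X14 X15)
      (PM X0 X1 X2 X3 X4 X5 X6 X7 X8 X9 X10 X11 X12 X13 X14 X15),
    Model
      (PM X1 X3 X5 X4 X0 X2 X6 X7 X8 X9 X10 X11 X12 X13 X14 X15)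
      (PM X4 X0 X5 X1 X3 X2 X6 X7 X8 X9 X10 X11 X12 X13 X14 X15)
      (PM X0 X1 X2 X3 X4 X5 X6 X7 X8 X9 X10 X11 X12 X13 X14 X15)
      (PM X0 X1 X2 X3 X4 X5 X6 X7 X8 X9 X10 X11 X12 X13 X14 X15)
      (PM X2 X4 X0 X5 X1 X3 X6 X7 X8 X9 X10 X11 X12 X13 X14 X15)
      (PM X2 X4 X0 X5 X1 X3 X6 X7 X8 X9 X10 X11 X12 X13 X14 X15)
      (PM X1 X5 X3 X4 X2 X0 X6 X7 X8 X9 X10 X11 X12 X13 X14 X15)
      (PM X5 X0 X4 X2 X3 X1 X6 X7 X8 X9 X10 X11 X12 X13 X14 X15),
    Model
      (PM X1 X0 X4 X6 X2 X8 X3 X10 X5 X11 X7 X9 X12 X13 X14 X15)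
      (PM X1 X0 X4 X6 X2 X8 X3 X10 X5 X11 X7 X9 X12 X13 X14 X15)
      (PM X2 X4 X0 X6 X1 X8 X3 X7 X5 X9 X10 X11 X12 X13 X14 X15)
      (PM X2 X4 X0 X6 X1 X8 X3 X7 X5 X9 X10 X11 X12 X13 X14 X15)
      (PM X3 X5 X6 X7 X8 X9 X10 X4 X11 X1 X2 X0 X12 X13 X14 X15)
      (PM X11 X9 X10 X0 X7 X1 X2 X3 X4 X5 X6 X8 X12 X13 X14 X15)
      (PM X0 X1 X2 X3 X4 X5 X6 X7 X8 X9 X10 X11 X12 X13 X14 X15)
      (PM X0 X1 X2 X3 X4 X5 X6 X7 X8 X9 X10 X11 X12 X13 X14 X15),
    Model
      (PM X1 X0 X4 X3 X2 X9 X11 X7 X10 X5 X8 X6 X12 X14 X13 X15)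
      (PM X1 X0 X4 X3 X2 X9 X11 X7 X10 X5 X8 X6 X12 X14 X13 X15)
      (PM X0 X1 X5 X7 X9 X2 X6 X3 X13 X4 X14 X11 X15 X8 X10 X12)
      (PM X0 X1 X5 X7 X9 X2 X6 X3 X13 X4 X14 X11 X15 X8 X10 X12)
      (PM X2 X3 X6 X8 X1 X10 X12 X11 X7 X14 X5 X4 X13 X15 X9 X0)
      (PM X15 X4 X0 X1 X11 X10 X2 X8 X3 X14 X5 X7 X6 X12 X9 X13)
      (PM X0 X1 X2 X3 X4 X5 X6 X7 X8 X9 X10 X11 X12 X13 X14 X15)
      (PM X0 X1 X2 X3 X4 X5 X6 X7 X8 X9 X10 X11 X12 X13 X14 X15),
    Model
      (PM X1 X3 X4 X5 X6 X0 X7 X2 X8 X9 X10 X11 X12 X13 X14 X15)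
      (PM X5 X0 X7 X1 X2 X3 X4 X6 X8 X9 X10 X11 X12 X13 X14 X15)
      (PM X0 X1 X2 X3 X4 X5 X6 X7 X8 X9 X10 X11 X12 X13 X14 X15)
      (PM X0 X1 X2 X3 X4 X5 X6 X7 X8 X9 X10 X11 X12 X13 X14 X15)
      (PM X2 X4 X0 X5 X1 X3 X7 X6 X8 X9 X10 X11 X12 X13 X14 X15)
      (PM X2 X4 X0 X5 X1 X3 X7 X6 X8 X9 X10 X11 X12 X13 X14 X15)
      (PM X3 X5 X1 X4 X0 X2 X6 X7 X8 X9 X10 X11 X12 X13 X14 X15)
      (PM X4 X2 X5 X0 X3 X1 X6 X7 X8 X9 X10 X11 X12 X13 X14 X15),
    Model
      (PM X1 X0 X4 X5 X2 X3 X11 X9 X13 X7 X14 X6 X15 X8 X10 X12)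
      (PM X1 X0 X4 X5 X2 X3 X11 X9 X13 X7 X14 X6 X15 X8 X10 X12)
      (PM X2 X4 X0 X3 X1 X5 X6 X7 X12 X9 X10 X11 X8 X15 X14 X13)
      (PM X2 X4 X0 X3 X1 X5 X6 X7 X12 X9 X10 X11 X8 X15 X14 X13)
      (PM X3 X5 X7 X0 X9 X1 X12 X2 X10 X4 X8 X13 X6 X11 X15 X14)
      (PM X3 X5 X7 X0 X9 X1 X12 X2 X10 X4 X8 X13 X6 X11 X15 X14)
      (PM X4 X6 X1 X8 X10 X7 X2 X12 X9 X3 X0 X11 X5 X13 X14 X15)
      (PM X10 X2 X6 X9 X0 X12 X1 X5 X3 X8 X4 X11 X7 X13 X14 X15),
    Model
      (PM X0 X1 X4 X7 X2 X9 X8 X3 X6 X5 X10 X11 X12 X13 X14 X15)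
      (PM X0 X1 X4 X7 X2 X9 X8 X3 X6 X5 X10 X11 X12 X13 X14 X15)
      (PM X1 X0 X6 X5 X8 X3 X2 X9 X4 X7 X11 X10 X12 X13 X14 X15)
      (PM X1 X0 X6 X5 X8 X3 X2 X9 X4 X7 X11 X10 X12 X13 X14 X15)
      (PM X2 X4 X0 X5 X1 X3 X10 X7 X11 X9 X6 X8 X12 X13 X14 X15)
      (PM X2 X4 X0 X5 X1 X3 X10 X7 X11 X9 X6 X8 X12 X13 X14 X15)
      (PM X3 X5 X1 X4 X0 X2 X10 X8 X11 X6 X9 X7 X12 X13 X14 X15)
      (PM X4 X2 X5 X0 X3 X1 X9 X11 X7 X10 X6 X8 X12 X13 X14 X15)] ! (i - 1)"

text \<open>The first two conditions make the permutations a representation of \<open>L i\<close>.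
  The third is faithfulness on the two subgroups, from which their orders four and six
  follow.\<close>

definition model_ok :: "nat \<Rightarrow> bool" where
  "model_ok i \<longleftrightarrow>
     list_all (\<lambda>x. list_all (\<lambda>k. app (perm (model i) x False) (app (perm (model i) x True) k) = k \<and>
       app (perm (model i) x True) (app (perm (model i) x False) k) = k) pts) [A1, A2, B1, B2] \<and>
     list_all (\<lambda>r. list_all (\<lambda>k. actw (model i) r k = k) pts) (snd (pres i)) \<and>
     list_all (\<lambda>s. moves (model i) (spell (ltype i) s) pts) [SE E1, SE E2, SE E3, SF F1, SF F2, SF F3, SF F4, SF F5]"

lemma models_ok: "list_all model_ok [1, 2, 3, 4, 5, 6, 7, 8, 9, 10, 11]"
  by code_simp

fun separates :: "model \<Rightarrow> ty \<Rightarrow> ee te \<Rightarrow> ff tf \<Rightarrow> wd list \<Rightarrow> bool" where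
  "separates m t x y [] = False"
| "separates m t x y (w # ws) =
    (if moves m (concat (map (spell t) (map (mapS x y) (sylls w)))) pts then True else separates m t x y ws)"

text \<open>Groups of different types already have nonisomorphic subgroups. For equal types,
  isomorphisms between the subgroups are pairs from \<open>auts\<close> in coordinates, and each
  pair has to be refuted.\<close>

definition distinct_models :: "nat \<Rightarrow> nat \<Rightarrow> bool" where
  "distinct_models i j \<longleftrightarrow> (if i = j then True else if ltype i = ltype j then
     list_all (\<lambda>x. list_all (\<lambda>y. separates (model j) (ltype i) x y (lwords i)) (snd (auts (ltype i)))) (fst (auts (ltype i)))
     else True)"

lemma models_distinct:
  "list_all (\<lambda>i. list_all (distinct_models i) [1, 2, 3, 4, 5, 6, 7, 8, 9, 10, 11]) [1, 2, 3, 4, 5, 6, 7, 8, 9, 10, 11]"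
  by code_simp

lemma set_pts: "k \<in> set pts"
  unfolding pts_def by (cases k) simp_all

lemma moves_iff: "moves m w ks \<longleftrightarrow> (\<exists>k \<in> set ks. actw m w k \<noteq> k)"
  by (induction ks) auto

lemma actw_append: "actw m (u @ w) k = actw m w (actw m u k)"
  by (induction m u k rule: actw.induct) simp_all

lemma model_okD:
  assumes "i \<in> {1..11}"
  shows "app (perm (model i) x (\<not> e)) (app (perm (model i) x e) k) = k"
    and "r \<in> set (snd (pres i)) \<Longrightarrow> actw (model i) r k = k"
    and "s \<in> set [SE E1, SE E2, SE E3, SF F1, SF F2, SF F3, SF F4, SF F5] \<Longrightarrow>
      \<exists>k. actw (model i) (spell (ltype i) s) k \<noteq> k"
proof -
  have "model_ok i" using models_ok index_cases[OF assms] unfolding list_all_iff by blast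
  note * = this[unfolded model_ok_def list_all_iff]
  have "x \<in> set [A1, A2, B1, B2]" by (cases x) simp_all
  then show "app (perm (model i) x (\<not> e)) (app (perm (model i) x e) k) = k"
    using * set_pts[of k] by (cases e) (simp_all only: simp_thms)
  show "actw (model i) r k = k" if "r \<in> set (snd (pres i))" using * set_pts that by blast
  show "\<exists>k. actw (model i) (spell (ltype i) s) k \<noteq> k"
    if "s \<in> set [SE E1, SE E2, SE E3, SF F1, SF F2, SF F3, SF F4, SF F5]"
    using * that unfolding moves_iff by blast
qed

lemma actw_pres_eq:
  assumes i: "i \<in> {1..11}" and "pres_eq (fst (pres i)) (set (snd (pres i))) u w"
  shows "actw (model i) u k = actw (model i) w k"
  using assms(2)
proof (induction arbitrary: k rule: pres_eq.induct)
  case (cancel x e)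
  then show ?case using model_okD(1)[OF i, of x e] by simp
next
  case (relator r)
  then show ?case using model_okD(2)[OF i] by simp
qed (simp_all add: actw_append)

section \<open>Isomorphisms between the pairs of subgroups\<close>

lemma inv_mul_eq: "mulE t (invE t a) b = E0 \<longleftrightarrow> a = b" "mulF t (invF t c) d = F0 \<longleftrightarrow> c = d"
proof -
  obtain p q where t: "t = Ty p q" by (cases t)
  show "mulE t (invE t a) b = E0 \<longleftrightarrow> a = b" unfolding t by (cases p; cases a; cases b; simp)
  show "mulF t (invF t c) d = F0 \<longleftrightarrow> c = d" unfolding t by (cases q; cases c; cases d; simp)
qed

lemma aut_E:
  assumes hom: "\<And>a b. \<alpha> (mulE (Ty p q) a b) = mulE (Ty p' q') (\<alpha> a) (\<alpha> b)" and inj: "inj \<alpha>"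
  shows "p' = p" and "TE (\<alpha> E1) (\<alpha> E2) (\<alpha> E3) \<in> set (fst (auts (Ty p q)))"
    and "\<alpha> = mapE (TE (\<alpha> E1) (\<alpha> E2) (\<alpha> E3))"
proof -
  have 0: "\<alpha> E0 = E0" using hom[of E0 E0] by (cases "\<alpha> E0"; cases p') simp_all
  have ne: "\<alpha> E1 \<noteq> E0" "\<alpha> E2 \<noteq> E0" "\<alpha> E3 \<noteq> E0" "\<alpha> E1 \<noteq> \<alpha> E2" "\<alpha> E1 \<noteq> \<alpha> E3" "\<alpha> E2 \<noteq> \<alpha> E3"
    using injD[OF inj, of E1 E0] injD[OF inj, of E2 E0] injD[OF inj, of E3 E0] injD[OF inj, of E1 E2]
      injD[OF inj, of E1 E3] injD[OF inj, of E2 E3] 0 by auto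
  have m: "\<alpha> (mulE (Ty p q) E1 E1) = mulE (Ty p' q') (\<alpha> E1) (\<alpha> E1)"
    "\<alpha> (mulE (Ty p q) E1 E2) = mulE (Ty p' q') (\<alpha> E1) (\<alpha> E2)"
    "\<alpha> (mulE (Ty p q) E2 E2) = mulE (Ty p' q') (\<alpha> E2) (\<alpha> E2)" by (rule hom)+
  have "p' = p \<and> TE (\<alpha> E1) (\<alpha> E2) (\<alpha> E3) \<in> set (fst (auts (Ty p q)))"
    using m ne 0 by (cases "\<alpha> E1"; cases "\<alpha> E2"; simp; cases "\<alpha> E3"; cases p; cases p'; simp)
  then show "p' = p" "TE (\<alpha> E1) (\<alpha> E2) (\<alpha> E3) \<in> set (fst (auts (Ty p q)))" by auto
  show "\<alpha> = mapE (TE (\<alpha> E1) (\<alpha> E2) (\<alpha> E3))"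
    by (rule ext, rename_tac a, case_tac a) (simp_all add: 0)
qed

text \<open>The cyclic group is generated by \<open>F1\<close> and S_3 by \<open>F1\<close> and
  \<open>F3\<close>. Expressing the other images through these reduces the proof to their possible
  values.\<close>

lemma aut_F:
  assumes hom: "\<And>a b. \<beta> (mulF (Ty p q) a b) = mulF (Ty p' q') (\<beta> a) (\<beta> b)" and inj: "inj \<beta>"
  shows "q' = q" and "TF (\<beta> F1) (\<beta> F2) (\<beta> F3) (\<beta> F4) (\<beta> F5) \<in> set (snd (auts (Ty p q)))"
    and "\<beta> = mapF (TF (\<beta> F1) (\<beta> F2) (\<beta> F3) (\<beta> F4) (\<beta> F5))"
proof -
  have 0: "\<beta> F0 = F0" using hom[of F0 F0] by (cases "\<beta> F0"; cases q') simp_all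
  have ne: "\<beta> F1 \<noteq> F0" "\<beta> F2 \<noteq> F0" "\<beta> F3 \<noteq> F0" "\<beta> F4 \<noteq> \<beta> F5"
    using injD[OF inj, of F1 F0] injD[OF inj, of F2 F0] injD[OF inj, of F3 F0] injD[OF inj, of F4 F5] 0 by auto
  have "q' = q \<and> TF (\<beta> F1) (\<beta> F2) (\<beta> F3) (\<beta> F4) (\<beta> F5) \<in> set (snd (auts (Ty p q)))"
  proof (cases q)
    case True
    have "\<beta> F2 = mulF (Ty p' q') (\<beta> F1) (\<beta> F1)" "\<beta> F3 = mulF (Ty p' q') (\<beta> F1) (\<beta> F2)"
      "\<beta> F4 = mulF (Ty p' q') (\<beta> F1) (\<beta> F3)" "\<beta> F5 = mulF (Ty p' q') (\<beta> F1) (\<beta> F4)"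
      using hom[of F1 F1] hom[of F1 F2] hom[of F1 F3] hom[of F1 F4] True by simp_all
    then show ?thesis using ne True by (cases "\<beta> F1"; cases q'; simp)
  next
    case False
    have "\<beta> F2 = mulF (Ty p' q') (\<beta> F1) (\<beta> F1)" "\<beta> F4 = mulF (Ty p' q') (\<beta> F1) (\<beta> F3)"
      "\<beta> F5 = mulF (Ty p' q') (\<beta> F3) (\<beta> F1)" "\<beta> F5 = mulF (Ty p' q') (\<beta> F1) (\<beta> F4)"
      "F0 = mulF (Ty p' q') (\<beta> F1) (\<beta> F2)" "F0 = mulF (Ty p' q') (\<beta> F3) (\<beta> F3)"
      using hom[of F1 F1] hom[of F1 F3] hom[of F3 F1] hom[of F1 F4] hom[of F1 F2] hom[of F3 F3] False 0 by simp_all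
    then show ?thesis using ne False by (cases "\<beta> F1"; cases "\<beta> F3"; cases q'; simp)
  qed
  then show "q' = q" "TF (\<beta> F1) (\<beta> F2) (\<beta> F3) (\<beta> F4) (\<beta> F5) \<in> set (snd (auts (Ty p q)))" by auto
  show "\<beta> = mapF (TF (\<beta> F1) (\<beta> F2) (\<beta> F3) (\<beta> F4) (\<beta> F5))"
    by (rule ext, rename_tac a, case_tac a) (simp_all add: 0)
qed

text \<open>The stabilizer of a vertex of a coset graph is a conjugate of the subgroup;
  \<open>not_isomorphic_L\<close> undoes the conjugation.\<close>

lemma (in group) coset_stabilizer:
  assumes "subgroup U G" "x \<in> carrier G" "g \<in> carrier G"
  shows "g <# (x <# U) = x <# U \<longleftrightarrow> inv x \<otimes> g \<otimes> x \<in> U"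
proof -
  interpret U: subgroup U G by fact
  have "g <# (x <# U) = (g \<otimes> x) <# U" using assms U.subset by (simp add: lcos_m_assoc)
  also have "\<dots> = x <# U \<longleftrightarrow> inv x \<otimes> g \<otimes> x \<in> U"
  proof
    assume *: "(g \<otimes> x) <# U = x <# U"
    have "g \<otimes> x \<otimes> \<one> \<in> (g \<otimes> x) <# U" unfolding l_coset_def by (intro UN_I[OF U.one_closed]) simp
    then have "g \<otimes> x \<in> x <# U" using assms(2,3) unfolding * by simp
    then obtain u where u: "u \<in> U" "g \<otimes> x = x \<otimes> u" unfolding l_coset_def by blast
    have "inv x \<otimes> g \<otimes> x = u" using u assms(2,3) U.mem_carrier[OF u(1)] by (simp add: m_assoc) (simp add: m_assoc[symmetric])
    then show "inv x \<otimes> g \<otimes> x \<in> U" using u(1) by simp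
  next
    assume u: "inv x \<otimes> g \<otimes> x \<in> U"
    have "g \<otimes> x = x \<otimes> (inv x \<otimes> g \<otimes> x)" using assms(2,3) by (simp add: m_assoc[symmetric])
    then have "(g \<otimes> x) <# U = x <# ((inv x \<otimes> g \<otimes> x) <# U)" using assms(2,3) U.subset by (simp add: lcos_m_assoc)
    also have "(inv x \<otimes> g \<otimes> x) <# U = U" by (intro coset_join3[OF _ assms(1) u]) (use assms in simp)
    finally show "(g \<otimes> x) <# U = x <# U" .
  qed
  finally show ?thesis .
qed

context
  fixes i assumes i: "i \<in> {1..11::nat}"
begin

interpretation L: group "L i" by (rule group_L)
interpretation A: amalgam "L i" "ltype i" "epsL i" "phiL i" by (rule amalgam_L[OF i])

lemma evalS_spell: "A.evalS s = word_class (fst (pres i)) (set (snd (pres i))) (concat (map (spell (ltype i)) s))"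
proof -
  obtain p q where t: "ltype i = Ty p q" by (cases "ltype i")
  have g: "fst (pres i) = gens (ltype i)" by (rule pres_okD(1)[OF i])
  have cl: "x \<in> gens (Ty p q) \<Longrightarrow> L_gen i x \<in> carrier (L i)" for x using L_gen_closed[of x i] g t by simp
  have w: "spell (ltype i) z \<in> words (gens (ltype i))" for z
    unfolding t by (cases z; rename_tac a; case_tac a; simp)
  have val: "A.val z = word_val (L i) (L_gen i) (spell (ltype i) z)" for z
    using cl[of A1] cl[of A2] cl[of B1] cl[of B2] unfolding t
    by (cases p; cases q; cases z; rename_tac a; case_tac a; simp; simp add: epsL_def phiL_def t)
  have ws: "concat (map (spell (ltype i)) s) \<in> words (gens (ltype i))" for s
  proof (induction s)
    case (Cons z s)
    then show ?case using w[of z] by (simp del: gens.simps)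
  qed simp
  have "A.evalS s = word_val (L i) (L_gen i) (concat (map (spell (ltype i)) s))"
  proof (induction s)
    case (Cons z s)
    show ?case using Cons ws[of s] L.word_val_append[of "L_gen i" "gens (ltype i)" "spell (ltype i) z"] w[of z] cl
      by (simp add: val image_subset_iff t del: gens.simps)
  qed simp
  then show ?thesis using word_val_L[of "concat (map (spell (ltype i)) s)" i] ws[of s] g by simp
qed

lemma evalS_moves:
  assumes "actw (model i) (concat (map (spell (ltype i)) s)) k \<noteq> k" shows "A.evalS s \<noteq> \<one>\<^bsub>L i\<^esub>"
proof
  let ?c = "word_class (fst (pres i)) (set (snd (pres i)))"
  assume "A.evalS s = \<one>\<^bsub>L i\<^esub>"
  then have "?c (concat (map (spell (ltype i)) s)) = ?c []"
    unfolding evalS_spell by (simp add: L_def presented_group_def)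
  moreover have "[] \<in> ?c []" by (simp add: word_class_def pres_eq.refl)
  ultimately have "pres_eq (fst (pres i)) (set (snd (pres i))) (concat (map (spell (ltype i)) s)) []"
    unfolding word_class_def by blast
  from actw_pres_eq[OF i this, of k] show False using assms by simp
qed

lemma inj_L: "inj (epsL i)" "inj (phiL i)"
proof -
  have ne: "A.val s \<noteq> \<one>\<^bsub>L i\<^esub>" if "nonunit s" for s
  proof -
    have "s \<in> set [SE E1, SE E2, SE E3, SF F1, SF F2, SF F3, SF F4, SF F5]"
      using that by (cases s; rename_tac a; case_tac a; simp)
    from model_okD(3)[OF i this] obtain k where "actw (model i) (concat (map (spell (ltype i)) [s])) k \<noteq> k" by auto
    then show ?thesis using evalS_moves[of "[s]" k] by simp
  qed
  show "inj (epsL i)"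
  proof (rule injI)
    fix a b assume *: "epsL i a = epsL i b"
    have "A.val (SE (mulE (ltype i) (invE (ltype i) a) b)) = \<one>\<^bsub>L i\<^esub>"
      using * by (simp add: A.E_mult A.E_inv)
    then have "\<not> nonunit (SE (mulE (ltype i) (invE (ltype i) a) b))" using ne by blast
    then show "a = b" by (simp add: inv_mul_eq)
  qed
  show "inj (phiL i)"
  proof (rule injI)
    fix a b assume *: "phiL i a = phiL i b"
    have "A.val (SF (mulF (ltype i) (invF (ltype i) a) b)) = \<one>\<^bsub>L i\<^esub>"
      using * by (simp add: A.F_mult A.F_inv)
    then have "\<not> nonunit (SF (mulF (ltype i) (invF (ltype i) a) b))" using ne by blast
    then show "a = b" by (simp add: inv_mul_eq)
  qed
qed

lemma card_L: "card (L_a i) = 4" "card (L_b i) = 6"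
  unfolding generated_L[OF i] using card_image[OF inj_L(1)] card_image[OF inj_L(2)] by (simp_all add: card_UNIV_E card_UNIV_F)

lemma subgroup_L: "subgroup (L_a i) (L i)" "subgroup (L_b i) (L i)"
  unfolding generated_L[OF i] by (rule A.subgroup_range)+

end

lemma separates_iff:
  "separates m t x y ws \<longleftrightarrow>
    (\<exists>w \<in> set ws. \<exists>k. actw m (concat (map (spell t) (map (mapS x y) (sylls w)))) k \<noteq> k)"
  by (induction ws) (use set_pts in \<open>auto simp: moves_iff\<close>)

lemma separates_L:
  assumes "i \<in> {1..11}" "j \<in> {1..11}" "i \<noteq> j" "ltype j = ltype i"
    and "x \<in> set (fst (auts (ltype i)))" "y \<in> set (snd (auts (ltype i)))"
  shows "separates (model j) (ltype i) x y (lwords i)"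
proof -
  have "distinct_models i j"
    using models_distinct index_cases[OF assms(1)] index_cases[OF assms(2)] unfolding list_all_iff by blast
  then show ?thesis using assms(3-6) unfolding distinct_models_def list_all_iff by simp
qed

lemma not_isomorphic_L:
  assumes i: "i \<in> {1..11}" and j: "j \<in> {1..11}" and "i \<noteq> j"
  shows "\<not> isomorphic_actions (L i) (coset_action (L i)) (L_graph i) (L j) (coset_action (L j)) (L_graph j)"
proof
  assume "isomorphic_actions (L i) (coset_action (L i)) (L_graph i) (L j) (coset_action (L j)) (L_graph j)"
  then obtain \<theta> f where \<theta>: "\<theta> \<in> iso (L i) (L j)" and f: "graph_iso f (L_graph i) (L_graph j)"
    and eqv: "\<forall>g \<in> carrier (L i). \<forall>v \<in> verts (L_graph i). f (coset_action (L i) g v) = coset_action (L j) (\<theta> g) (f v)"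
    unfolding isomorphic_actions_def by (elim bexE exE conjE)
  interpret Li: group "L i" by (rule group_L)
  interpret Lj: group "L j" by (rule group_L)
  interpret A: amalgam "L i" "ltype i" "epsL i" "phiL i" by (rule amalgam_L[OF i])
  interpret B: amalgam "L j" "ltype j" "epsL j" "phiL j" by (rule amalgam_L[OF j])
  have \<theta>_cl: "\<theta> g \<in> carrier (L j)" if "g \<in> carrier (L i)" for g
    using \<theta> that by (auto simp: iso_def hom_def)
  have \<theta>_mult: "\<theta> (g \<otimes>\<^bsub>L i\<^esub> h) = \<theta> g \<otimes>\<^bsub>L j\<^esub> \<theta> h" if "g \<in> carrier (L i)" "h \<in> carrier (L i)" for g h
    using \<theta> that by (auto simp: iso_def hom_def)
  have \<theta>_inj: "g = h" if "g \<in> carrier (L i)" "h \<in> carrier (L i)" "\<theta> g = \<theta> h" for g h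
    using \<theta> that by (auto simp: iso_def bij_betw_def inj_on_def)
  have \<theta>_surj: "\<exists>g \<in> carrier (L i). y = \<theta> g" if "y \<in> carrier (L j)" for y
    using \<theta> that by (auto simp: iso_def bij_betw_def)
  note subi = subgroup_L[OF i] and subj = subgroup_L[OF j]
  have verts: "Inl (g <#\<^bsub>L i\<^esub> L_a i) \<in> verts (L_graph i)" "Inr (g <#\<^bsub>L i\<^esub> L_b i) \<in> verts (L_graph i)"
    if "g \<in> carrier (L i)" for g
    using that by (auto simp: coset_graph_def LCOSETS_def)
  have one: "\<one>\<^bsub>L i\<^esub> <#\<^bsub>L i\<^esub> L_a i = L_a i" "\<one>\<^bsub>L i\<^esub> <#\<^bsub>L i\<^esub> L_b i = L_b i"
    using subi[THEN subgroup.subset] by (simp_all add: Li.lcos_mult_one)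
  have uv: "Inl (L_a i) \<in> verts (L_graph i)" "Inr (L_b i) \<in> verts (L_graph i)"
    using verts[OF Li.one_closed] unfolding one .
  have "{Inl (\<one>\<^bsub>L i\<^esub> <#\<^bsub>L i\<^esub> L_a i), Inr (\<one>\<^bsub>L i\<^esub> <#\<^bsub>L i\<^esub> L_b i)} \<in> edges (L_graph i)"
    unfolding coset_graph_def graph.simps by (rule imageI[OF Li.one_closed])
  then have "adjacent (L_graph i) (Inl (L_a i)) (Inr (L_b i))" unfolding one .
  then have "adjacent (L_graph j) (f (Inl (L_a i))) (f (Inr (L_b i)))"
    using f uv unfolding graph_iso_def by blast
  then obtain x where x: "x \<in> carrier (L j)"
    and fuv: "{f (Inl (L_a i)), f (Inr (L_b i))} = {Inl (x <#\<^bsub>L j\<^esub> L_a j), Inr (x <#\<^bsub>L j\<^esub> L_b j)}"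
    unfolding coset_graph_def graph.simps by (elim imageE)
  \<comment> \<open>The element \<open>x\<close> translates the base edge of the second graph to the
    image of that of the first; conjugation by it brings the images of the stabilizers back to
    \<open>L_a j\<close> and \<open>L_b j\<close>.\<close>
  define \<psi> where "\<psi> g = inv\<^bsub>L j\<^esub> x \<otimes>\<^bsub>L j\<^esub> \<theta> g \<otimes>\<^bsub>L j\<^esub> x" for g
  have \<psi>_mult: "\<psi> (g \<otimes>\<^bsub>L i\<^esub> h) = \<psi> g \<otimes>\<^bsub>L j\<^esub> \<psi> h" if g: "g \<in> carrier (L i)" and h: "h \<in> carrier (L i)" for g h
  proof -
    have "x \<otimes>\<^bsub>L j\<^esub> (inv\<^bsub>L j\<^esub> x \<otimes>\<^bsub>L j\<^esub> (\<theta> h \<otimes>\<^bsub>L j\<^esub> x)) = \<theta> h \<otimes>\<^bsub>L j\<^esub> x"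
      using B.cancel_inv[OF x, of "\<theta> h \<otimes>\<^bsub>L j\<^esub> x"] \<theta>_cl[OF h] x by simp
    then show ?thesis
      unfolding \<psi>_def \<theta>_mult[OF g h] using \<theta>_cl[OF g] \<theta>_cl[OF h] x by (simp add: Lj.m_assoc)
  qed
  have \<psi>_inj: "g = h" if "g \<in> carrier (L i)" "h \<in> carrier (L i)" "\<psi> g = \<psi> h" for g h
    using that \<theta>_inj[of g h] \<theta>_cl x unfolding \<psi>_def by simp
  have \<psi>_surj: "\<exists>g \<in> carrier (L i). y = \<psi> g" if y: "y \<in> carrier (L j)" for y
  proof -
    obtain g where g: "g \<in> carrier (L i)" "x \<otimes>\<^bsub>L j\<^esub> y \<otimes>\<^bsub>L j\<^esub> inv\<^bsub>L j\<^esub> x = \<theta> g"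
      using \<theta>_surj[of "x \<otimes>\<^bsub>L j\<^esub> y \<otimes>\<^bsub>L j\<^esub> inv\<^bsub>L j\<^esub> x"] x y by auto
    have "\<psi> g = y" unfolding \<psi>_def g(2)[symmetric] using x y by (simp add: Lj.m_assoc B.cancel_inv')
    then show ?thesis using g(1) by blast
  qed
  \<comment> \<open>Stabilizers correspond to stabilizers. The statement is used for both ends of
    the base edge, and also for the case that the graph isomorphism interchanges the two kinds of
    vertices, which 4 \<noteq> 6 refutes.\<close>
  have image: "\<psi> ` U = U'"
    if U: "subgroup U (L i)" and U': "subgroup U' (L j)" and w: "w \<in> verts (L_graph i)"
      and act: "\<And>g. g \<in> carrier (L i) \<Longrightarrow> coset_action (L i) g w \<in> verts (L_graph i)"
      and fix_w: "\<And>g. coset_action (L i) g w = w \<longleftrightarrow> g <#\<^bsub>L i\<^esub> U = U"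
      and fix_fw: "\<And>g. coset_action (L j) g (f w) = f w \<longleftrightarrow> g <#\<^bsub>L j\<^esub> (x <#\<^bsub>L j\<^esub> U') = x <#\<^bsub>L j\<^esub> U'"
    for U U' w
  proof -
    have iff: "g \<in> U \<longleftrightarrow> \<psi> g \<in> U'" if g: "g \<in> carrier (L i)" for g
    proof -
      have "g \<in> U \<longleftrightarrow> g <#\<^bsub>L i\<^esub> U = U"
        using Li.coset_stabilizer[OF U Li.one_closed g] subgroup.subset[OF U] g by (simp add: Li.lcos_mult_one)
      also have "\<dots> \<longleftrightarrow> f (coset_action (L i) g w) = f w"
        unfolding fix_w[symmetric] using f act[OF g] w by (auto simp: graph_iso_def bij_betw_def inj_on_def)
      also have "\<dots> \<longleftrightarrow> coset_action (L j) (\<theta> g) (f w) = f w"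
        using eqv g w by simp
      also have "\<dots> \<longleftrightarrow> \<psi> g \<in> U'"
        unfolding fix_fw \<psi>_def by (rule Lj.coset_stabilizer[OF U' x \<theta>_cl[OF g]])
      finally show ?thesis .
    qed
    show ?thesis
    proof (intro equalityI subsetI)
      show "y \<in> U'" if "y \<in> \<psi> ` U" for y
        using that iff subgroup.mem_carrier[OF U] by blast
      show "y \<in> \<psi> ` U" if y: "y \<in> U'" for y
      proof -
        obtain g where "g \<in> carrier (L i)" "y = \<psi> g" using \<psi>_surj[OF subgroup.mem_carrier[OF U' y]] by blast
        then show ?thesis using iff y by blast
      qed
    qed
  qed
  have act: "coset_action (L i) g (Inl (L_a i)) \<in> verts (L_graph i)"
    "coset_action (L i) g (Inr (L_b i)) \<in> verts (L_graph i)" if "g \<in> carrier (L i)" for g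
    using verts[OF that] by (simp_all add: coset_action_def)
  have fix_u: "coset_action (L i) g (Inl (L_a i)) = Inl (L_a i) \<longleftrightarrow> g <#\<^bsub>L i\<^esub> L_a i = L_a i"
    and fix_v: "coset_action (L i) g (Inr (L_b i)) = Inr (L_b i) \<longleftrightarrow> g <#\<^bsub>L i\<^esub> L_b i = L_b i" for g
    by (simp_all add: coset_action_def)
  have fu: "f (Inl (L_a i)) = Inl (x <#\<^bsub>L j\<^esub> L_a j)"
  proof (rule ccontr)
    assume "f (Inl (L_a i)) \<noteq> Inl (x <#\<^bsub>L j\<^esub> L_a j)"
    then have *: "f (Inl (L_a i)) = Inr (x <#\<^bsub>L j\<^esub> L_b j)" using fuv by (auto simp: doubleton_eq_iff)
    have "\<psi> ` L_a i = L_b j"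
      by (rule image[OF subi(1) subj(2) uv(1) act(1) fix_u]) (simp_all add: * coset_action_def)
    moreover have "inj_on \<psi> (L_a i)"
      using \<psi>_inj subgroup.mem_carrier[OF subi(1)] by (intro inj_onI) blast
    ultimately show False using card_image[of \<psi> "L_a i"] card_L(1)[OF i] card_L(2)[OF j] by simp
  qed
  then have fv: "f (Inr (L_b i)) = Inr (x <#\<^bsub>L j\<^esub> L_b j)" using fuv by (auto simp: doubleton_eq_iff)
  have imE: "\<psi> ` range (epsL i) = range (epsL j)"
    unfolding generated_L[OF i, symmetric] generated_L[OF j, symmetric]
    by (rule image[OF subi(1) subj(1) uv(1) act(1) fix_u]) (simp_all add: fu coset_action_def)
  have imF: "\<psi> ` range (phiL i) = range (phiL j)"
    unfolding generated_L[OF i, symmetric] generated_L[OF j, symmetric]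
    by (rule image[OF subi(2) subj(2) uv(2) act(2) fix_v]) (simp_all add: fv coset_action_def)
  \<comment> \<open>These are the restrictions of \<psi> to the two subgroups, in the coordinates
    given by \<open>epsL\<close> and \<open>phiL\<close>.\<close>
  define \<alpha> where "\<alpha> a = inv_into UNIV (epsL j) (\<psi> (epsL i a))" for a
  define \<beta> where "\<beta> b = inv_into UNIV (phiL j) (\<psi> (phiL i b))" for b
  have \<alpha>: "epsL j (\<alpha> a) = \<psi> (epsL i a)" for a
    unfolding \<alpha>_def using imE by (intro f_inv_into_f) blast
  have \<beta>: "phiL j (\<beta> b) = \<psi> (phiL i b)" for b
    unfolding \<beta>_def using imF by (intro f_inv_into_f) blast
  have \<alpha>_hom: "\<alpha> (mulE (ltype i) a b) = mulE (ltype j) (\<alpha> a) (\<alpha> b)" for a b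
    by (rule injD[OF inj_L(1)[OF j]]) (simp add: \<alpha> A.E_mult B.E_mult \<psi>_mult)
  have \<beta>_hom: "\<beta> (mulF (ltype i) a b) = mulF (ltype j) (\<beta> a) (\<beta> b)" for a b
    by (rule injD[OF inj_L(2)[OF j]]) (simp add: \<beta> A.F_mult B.F_mult \<psi>_mult)
  have \<alpha>_inj: "inj \<alpha>"
  proof (rule injI)
    fix a b assume "\<alpha> a = \<alpha> b"
    then have "\<psi> (epsL i a) = \<psi> (epsL i b)" using \<alpha> by metis
    then show "a = b" using \<psi>_inj[OF A.E_closed A.E_closed] injD[OF inj_L(1)[OF i]] by blast
  qed
  have \<beta>_inj: "inj \<beta>"
  proof (rule injI)
    fix a b assume "\<beta> a = \<beta> b"
    then have "\<psi> (phiL i a) = \<psi> (phiL i b)" using \<beta> by metis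
    then show "a = b" using \<psi>_inj[OF A.F_closed A.F_closed] injD[OF inj_L(2)[OF i]] by blast
  qed
  obtain p q p' q' where t: "ltype i = Ty p q" "ltype j = Ty p' q'" by (cases "ltype i"; cases "ltype j")
  note autE = aut_E[OF \<alpha>_hom[unfolded t] \<alpha>_inj] and autF = aut_F[OF \<beta>_hom[unfolded t] \<beta>_inj]
  define X where "X = TE (\<alpha> E1) (\<alpha> E2) (\<alpha> E3)"
  define Y where "Y = TF (\<beta> F1) (\<beta> F2) (\<beta> F3) (\<beta> F4) (\<beta> F5)"
  have tt: "ltype j = ltype i" using autE(1) autF(1) t by simp
  have XY: "X \<in> set (fst (auts (ltype i)))" "Y \<in> set (snd (auts (ltype i)))"
    unfolding X_def Y_def t by (rule autE(2), rule autF(2))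
  have maps: "mapE X = \<alpha>" "mapF Y = \<beta>" unfolding X_def Y_def by (rule autE(3)[symmetric], rule autF(3)[symmetric])
  have \<psi>_one: "\<psi> \<one>\<^bsub>L i\<^esub> = \<one>\<^bsub>L j\<^esub>"
    using \<alpha>[of E0] \<alpha>_hom[of E0 E0] maps(1) by (metis A.E_one B.E_one mapE_aut(2)[OF XY(1)])
  have eval: "B.evalS (map (mapS X Y) s) = \<psi> (A.evalS s)" for s
  proof (induction s)
    case Nil
    then show ?case by (simp add: \<psi>_one)
  next
    case (Cons z s)
    then show ?case by (cases z) (simp_all add: maps \<alpha> \<beta> \<psi>_mult)
  qed
  \<comment> \<open>The word \<open>w\<close> is a relator of \<open>L i\<close>, so its image in
    \<open>L j\<close> has to be trivial; the representation of \<open>L j\<close> shows that it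
    moves the point \<open>k\<close>.\<close>
  obtain w k where w: "w \<in> set (lwords i)"
    and k: "actw (model j) (concat (map (spell (ltype j)) (map (mapS X Y) (sylls w)))) k \<noteq> k"
    using separates_L[OF i j \<open>i \<noteq> j\<close> tt XY] unfolding separates_iff tt by (elim bexE exE)
  have "A.evalS (sylls w) = \<one>\<^bsub>L i\<^esub>" using lwords_Rel[OF i] w A.Rel_iff by blast
  then have "B.evalS (map (mapS X Y) (sylls w)) = \<one>\<^bsub>L j\<^esub>" unfolding eval by (simp add: \<psi>_one)
  then show False using evalS_moves[OF j k] by simp
qed

theorem lemma42:
  shows
    "(\<forall>(Q :: 'v graph) G.
        generalized_quadrangle_of_order 3 5 Q \<longrightarrow> aut_subgroup G Q \<longrightarrow>
        regular_on_edges (BijGroup (verts Q)\<lparr>carrier := G\<rparr>) (\<lambda>g. g) Q \<longrightarrow>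
        (\<exists>i \<in> {1..11}.
           isomorphic_actions (BijGroup (verts Q)\<lparr>carrier := G\<rparr>) (\<lambda>g. g) Q
             (L i) (coset_action (L i)) (L_graph i))) \<and>
     (\<forall>i \<in> {1..11}. card (L_a i) = 4 \<and> card (L_b i) = 6) \<and>
     (\<forall>i \<in> {1..11}. \<forall>j \<in> {1..11}. i \<noteq> j \<longrightarrow>
        \<not> isomorphic_actions (L i) (coset_action (L i)) (L_graph i)
            (L j) (coset_action (L j)) (L_graph j))"
proof (intro conjI allI impI ballI)
  show "\<exists>i \<in> {1..11}. isomorphic_actions (BijGroup (verts Q)\<lparr>carrier := G\<rparr>) (\<lambda>g. g) Q
      (L i) (coset_action (L i)) (L_graph i)"
    if "generalized_quadrangle_of_order 3 5 Q" "aut_subgroup G Q"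
      "regular_on_edges (BijGroup (verts Q)\<lparr>carrier := G\<rparr>) (\<lambda>g. g) Q" for Q :: "'v graph" and G
    using that by (rule classification)
qed (rule card_L not_isomorphic_L; assumption)+

end
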